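(* For $a\in\mathbb R$, the matrix polynomials $\mathcal P_{2,n,a}$, $n=0,3,4,\dots$, defined in the context, are orthogonal with respect to the weight matrix $\mathcal W(t)\,dt$ on $\mathbb R$, where $$\mathcal W(t)=\frac{e^{-t^{2}}}{\mathfrak p^{2}(t)}\begin{pmatrix} \frac{(a^2+2)[(a^{2}t^{2}+3a^{2}+1)\mathfrak p(t)+a^{2}(3a^{2}+2)(2t^{2}-3)]}{(3a^2+2)^2} & \frac{at(\mathfrak p(t)+8((a^{2}+2)t^{2}+1))}{3a^{2}+2} \\ \frac{at(\mathfrak p(t)+8((a^{2}+2)t^{2}+1))}{3a^{2}+2} & \frac{\mathfrak p(t) + 2a^{2}\left(\frac{6(a^{2}+2)t^{2}}{3a^{2}+2}-1\right)}{a^2+2}\end{pmatrix},$$ $\mathfrak p(t)=4(a^2+2)t^4+8t^2+3a^2+2$, with norm $$\Vert\mathcal P_{2,n,a}\Vert^2_{\mathcal W}=(n-1)(n-2)\begin{pmatrix}\frac{1}{4(3a^2+2)^2}&0\\ 0&\frac{1}{4(3a^2+2)(a^2+2)}\end{pmatrix}\Vert P_{n,a}\Vert^2_{W_a},$$ where $$\Vert P_{n,a}\Vert^2_{W_a}=\sqrt\pi\,2^nn!\begin{pmatrix}1+a^2(n+1)/2&0\\ 0&1+a^2n/2\end{pmatrix}.$$ Moreover, their linear combinations are dense in $L^2(\mathcal W)$.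
   Context: Let $H_n$ be the Hermite polynomials $H_n(t)=(-1)^ne^{t^2}\frac{d^n}{dt^n}e^{-t^2}$. For $n\ge0$ put $$P_{n,a}(t)=H_n(t)\,I+nH_{n-1}(t)\begin{pmatrix}0&-a\\ -a&a^2t\end{pmatrix},$$ so $P_{1,a}(t)=\begin{pmatrix}2t&-a\\ -a&t(a^2+2)\end{pmatrix}$. (These are orthogonal with respect to $W_a(t)=e^{-t^2}\begin{pmatrix}1&at\\ 0&1\end{pmatrix}\begin{pmatrix}1&0\\ at&1\end{pmatrix}$, and $\Vert P_{n,a}\Vert^2_{W_a}=\int P_{n,a}W_aP_{n,a}^*\,dt$ is given by the formula in the statement.) Define the first order operators $$\mathcal A_1(y)=yA_{1,0}+y'A_{1,1},\quad A_{1,0}=-P_{1,a}',\quad A_{1,1}=(P_{1,a}')^{-1}P_{1,a}P_{1,a}',$$ and, with $\mathcal P_{1,n,a}=\mathcal A_1(P_{n,a})$, $$\mathcal A_2(y)=yA_{2,0}+y'A_{2,1},\quad A_{2,0}=-\begin{pmatrix}1/2&0\\ 0&1/(a^2+2)\end{pmatrix},\quad A_{2,1}=-(\mathcal P_{1,2,a}')^{-1}\mathcal P_{1,2,a}A_{2,0}.$$ Then $\mathcal P_{2,n,a}=\mathcal A_2(\mathcal P_{1,n,a})$, which is a matrix polynomial (zero for $n=1,2$). Orthogonality: $\int_{\mathbb R}\mathcal P_{2,n,a}\mathcal W\mathcal P_{2,m,a}^*\,dt=0$ for $n\ne m$; $\Vert\mathcal P_{2,n,a}\Vert^2_{\mathcal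 W}=\int_{\mathbb R}\mathcal P_{2,n,a}\mathcal W\mathcal P_{2,n,a}^*\,dt$ (a $2\times2$ matrix); $*$ is (conjugate) transpose. A weight matrix is a positive definite matrix of measures with finite moments of every order. $L^2(\mathcal W)$ is the space of $2\times2$ matrix functions $f$ with $\int\operatorname{tr}(f\mathcal Wf^* )\,dt<\infty$ (modulo null functions), and linear combinations are finite sums $\sum C_n\mathcal P_{2,n,a}$ with constant $2\times2$ matrix coefficients $C_n$ on the left. *)

theory Defs
  imports "HOL-Analysis.Analysis"
begin

definition hermite :: "nat \<Rightarrow> real \<Rightarrow> real" where
  "hermite n t = (-1) ^ n * exp (t\<^sup>2) * (deriv ^^ n) (\<lambda>s. exp (- s\<^sup>2)) t"

text \<open>Matrices are complex, so that \<open>L\<^sup>2(W)\<close> is the complex space and the coefficients of linear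
  combinations are arbitrary complex matrices; the specific matrices below have real entries.\<close>

definition rmat2 :: "real \<Rightarrow> real \<Rightarrow> real \<Rightarrow> real \<Rightarrow> complex^2^2" where
  "rmat2 p q r s = vector [vector [of_real p, of_real q], vector [of_real r, of_real s]]"

definition ctranspose :: "complex^2^2 \<Rightarrow> complex^2^2" where
  "ctranspose A = (\<chi> i j. cnj (A $ j $ i))"

text \<open>The inner product of \<^typ>\<open>complex^2\<close> is the real part of the Hermitian form, and
  \<open>v\<^sup>*Av\<close> is real for Hermitian \<open>A\<close>.\<close>

definition pos_def :: "complex^2^2 \<Rightarrow> bool" where
  "pos_def A \<longleftrightarrow> ctranspose A = A \<and> (\<forall>v. v \<noteq> 0 \<longrightarrow> 0 < v \<bullet> (A *v v))"

text \<open>The matrix of measures \<open>W(t)dt\<close> on the real line, given by its Lebesgue density. Positive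
  definiteness of a measure can only be required on non-null sets.\<close>

definition weight_matrix :: "(real \<Rightarrow> complex^2^2) \<Rightarrow> bool" where
  "weight_matrix W \<longleftrightarrow>
     (\<forall>k. integrable lborel (\<lambda>t. t ^ k *\<^sub>R W t)) \<and>
     (\<forall>A \<in> sets lborel. emeasure lborel A > 0 \<longrightarrow> pos_def (LINT t:A|lborel. W t))"

definition matrix_polynomial :: "(real \<Rightarrow> complex^2^2) \<Rightarrow> bool" where
  "matrix_polynomial Q \<longleftrightarrow> (\<forall>i j. \<exists>p :: complex poly. \<forall>t. Q t $ i $ j = poly p (of_real t))"

definition matrix_ip ::
  "(real \<Rightarrow> complex^2^2) \<Rightarrow> (real \<Rightarrow> complex^2^2) \<Rightarrow> (real \<Rightarrow> complex^2^2) \<Rightarrow> complex^2^2" where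
  "matrix_ip W f g = (LINT t|lborel. f t ** W t ** ctranspose (g t))"

text \<open>The Bochner integral of a non-integrable function is 0, hence the integrability condition.\<close>

definition matrix_orthogonal ::
  "(real \<Rightarrow> complex^2^2) \<Rightarrow> nat set \<Rightarrow> (nat \<Rightarrow> real \<Rightarrow> complex^2^2) \<Rightarrow> bool" where
  "matrix_orthogonal W I Q \<longleftrightarrow>
     (\<forall>n\<in>I. \<forall>m\<in>I. n \<noteq> m \<longrightarrow>
        integrable lborel (\<lambda>t. Q n t ** W t ** ctranspose (Q m t)) \<and>
        matrix_ip W (Q n) (Q m) = 0)"

abbreviation matrix_sqnorm :: "(real \<Rightarrow> complex^2^2) \<Rightarrow> (real \<Rightarrow> complex^2^2) \<Rightarrow> complex^2^2" where
  "matrix_sqnorm W f \<equiv> matrix_ip W f f"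

definition L2_space :: "(real \<Rightarrow> complex^2^2) \<Rightarrow> (real \<Rightarrow> complex^2^2) set" where
  "L2_space W = {f \<in> borel_measurable lborel.
     integrable lborel (\<lambda>t. trace (f t ** W t ** ctranspose (f t)))}"

definition L2_seminorm :: "(real \<Rightarrow> complex^2^2) \<Rightarrow> (real \<Rightarrow> complex^2^2) \<Rightarrow> real" where
  "L2_seminorm W f = sqrt (Re (LINT t|lborel. trace (f t ** W t ** ctranspose (f t))))"

definition dense_in_L2 :: "(real \<Rightarrow> complex^2^2) \<Rightarrow> (real \<Rightarrow> complex^2^2) set \<Rightarrow> bool" where
  "dense_in_L2 W V \<longleftrightarrow> V \<subseteq> L2_space W \<and>
     (\<forall>f \<in> L2_space W. \<forall>\<epsilon>>0. \<exists>g\<in>V. L2_seminorm W (\<lambda>t. f t - g t) < \<epsilon>)"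

definition left_span :: "nat set \<Rightarrow> (nat \<Rightarrow> real \<Rightarrow> complex^2^2) \<Rightarrow> (real \<Rightarrow> complex^2^2) set" where
  "left_span I Q = {(\<lambda>t. \<Sum>n\<in>S. C n ** Q n t) | S C. finite S \<and> S \<subseteq> I}"

definition matrix_deriv :: "(real \<Rightarrow> complex^2^2) \<Rightarrow> real \<Rightarrow> complex^2^2" where
  "matrix_deriv y t = vector_derivative y (at t)"

definition first_order_op ::
  "(real \<Rightarrow> complex^2^2) \<Rightarrow> (real \<Rightarrow> complex^2^2) \<Rightarrow> (real \<Rightarrow> complex^2^2) \<Rightarrow> real \<Rightarrow> complex^2^2" where
  "first_order_op A\<^sub>0 A\<^sub>1 y t = y t ** A\<^sub>0 t + matrix_deriv y t ** A\<^sub>1 t"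

definition P\<^sub>a :: "real \<Rightarrow> nat \<Rightarrow> real \<Rightarrow> complex^2^2" where
  "P\<^sub>a a n t = hermite n t *\<^sub>R mat 1 + (real n * hermite (n - 1) t) *\<^sub>R rmat2 0 (- a) (- a) (a\<^sup>2 * t)"

definition W\<^sub>a :: "real \<Rightarrow> real \<Rightarrow> complex^2^2" where
  "W\<^sub>a a t = exp (- t\<^sup>2) *\<^sub>R (rmat2 1 (a * t) 0 1 ** rmat2 1 0 (a * t) 1)"

definition A\<^sub>1\<^sub>0 :: "real \<Rightarrow> real \<Rightarrow> complex^2^2" where
  "A\<^sub>1\<^sub>0 a t = - matrix_deriv (P\<^sub>a a 1) t"

definition A\<^sub>1\<^sub>1 :: "real \<Rightarrow> real \<Rightarrow> complex^2^2" where
  "A\<^sub>1\<^sub>1 a t = matrix_inv (matrix_deriv (P\<^sub>a a 1) t) ** P\<^sub>a a 1 t ** matrix_deriv (P\<^sub>a a 1) t"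

definition \<A>\<^sub>1 :: "real \<Rightarrow> (real \<Rightarrow> complex^2^2) \<Rightarrow> real \<Rightarrow> complex^2^2" where
  "\<A>\<^sub>1 a = first_order_op (A\<^sub>1\<^sub>0 a) (A\<^sub>1\<^sub>1 a)"

definition \<P>\<^sub>1 :: "real \<Rightarrow> nat \<Rightarrow> real \<Rightarrow> complex^2^2" where
  "\<P>\<^sub>1 a n = \<A>\<^sub>1 a (P\<^sub>a a n)"

definition A\<^sub>2\<^sub>0 :: "real \<Rightarrow> real \<Rightarrow> complex^2^2" where
  "A\<^sub>2\<^sub>0 a t = - rmat2 (1 / 2) 0 0 (1 / (a\<^sup>2 + 2))"

definition A\<^sub>2\<^sub>1 :: "real \<Rightarrow> real \<Rightarrow> complex^2^2" where
  "A\<^sub>2\<^sub>1 a t = - (matrix_inv (matrix_deriv (\<P>\<^sub>1 a 2) t) ** \<P>\<^sub>1 a 2 t ** A\<^sub>2\<^sub>0 a t)"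

definition \<A>\<^sub>2 :: "real \<Rightarrow> (real \<Rightarrow> complex^2^2) \<Rightarrow> real \<Rightarrow> complex^2^2" where
  "\<A>\<^sub>2 a = first_order_op (A\<^sub>2\<^sub>0 a) (A\<^sub>2\<^sub>1 a)"

text \<open>The coefficient \<open>A\<^sub>2\<^sub>1\<close> is a rational function with poles at the zeros of the determinant of
  \<open>\<P>\<^sub>1\<^sub>,\<^sub>2'\<close>, where \<^const>\<open>matrix_inv\<close> has an arbitrary value. The polynomial \<open>\<A>\<^sub>2(\<P>\<^sub>1\<^sub>,\<^sub>n)\<close> is therefore
  the one that has the prescribed values outside of these points.\<close>

definition is_\<P>\<^sub>2 :: "real \<Rightarrow> nat \<Rightarrow> (real \<Rightarrow> complex^2^2) \<Rightarrow> bool" where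
  "is_\<P>\<^sub>2 a n Q \<longleftrightarrow> matrix_polynomial Q \<and>
     (\<forall>t. invertible (matrix_deriv (\<P>\<^sub>1 a 2) t) \<longrightarrow> Q t = \<A>\<^sub>2 a (\<P>\<^sub>1 a n) t)"

definition \<P>\<^sub>2 :: "real \<Rightarrow> nat \<Rightarrow> real \<Rightarrow> complex^2^2" where
  "\<P>\<^sub>2 a n = (THE Q. is_\<P>\<^sub>2 a n Q)"

definition \<pp> :: "real \<Rightarrow> real \<Rightarrow> real" where
  "\<pp> a t = 4 * (a\<^sup>2 + 2) * t ^ 4 + 8 * t\<^sup>2 + 3 * a\<^sup>2 + 2"

definition \<W> :: "real \<Rightarrow> real \<Rightarrow> complex^2^2" where
  "\<W> a t = (exp (- t\<^sup>2) / (\<pp> a t)\<^sup>2) *\<^sub>R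
     rmat2
       ((a\<^sup>2 + 2) * ((a\<^sup>2 * t\<^sup>2 + 3 * a\<^sup>2 + 1) * \<pp> a t + a\<^sup>2 * (3 * a\<^sup>2 + 2) * (2 * t\<^sup>2 - 3))
         / (3 * a\<^sup>2 + 2)\<^sup>2)
       (a * t * (\<pp> a t + 8 * ((a\<^sup>2 + 2) * t\<^sup>2 + 1)) / (3 * a\<^sup>2 + 2))
       (a * t * (\<pp> a t + 8 * ((a\<^sup>2 + 2) * t\<^sup>2 + 1)) / (3 * a\<^sup>2 + 2))
       ((\<pp> a t + 2 * a\<^sup>2 * (6 * (a\<^sup>2 + 2) * t\<^sup>2 / (3 * a\<^sup>2 + 2) - 1)) / (a\<^sup>2 + 2))"

definition idx :: "nat set" where
  "idx = {n. n = 0 \<or> 3 \<le> n}"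

end

theory Submission
  imports Defs "HOL-Probability.Distributions"
begin

text \<open>The composition \<open>\<A>\<^sub>2 \<circ> \<A>\<^sub>1\<close> is the operator \<open>X(y) = y + y'X\<^sub>1 + y''X\<^sub>2\<close> with polynomial coefficients, and
  \<open>\<pp>\<close> is a multiple of \<open>det X\<^sub>2\<close>. For a row \<open>z\<close> of \<open>P\<^sub>m\<close> put \<open>R = \<W> X(z)\<^sup>T\<close>, \<open>U = X\<^sub>2 R\<close> and \<open>Q = X\<^sub>1 R - U'\<close>.
  Then \<open>Q' = R - \<lambda> W\<^sub>a z\<^sup>T\<close> with a constant \<open>\<lambda>\<close> proportional to \<open>(m - 1)(m - 2)\<close>, so that
  \<open>(yQ + y'U)' = X(y)R - \<lambda> y W\<^sub>a z\<^sup>T\<close> for every row \<open>y\<close>. Integration reduces the inner products for \<open>\<W>\<close> to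
  those for \<open>W\<^sub>a\<close>, and these to the orthogonality of the Hermite polynomials.

  For density, the range of \<open>X\<close> on matrix polynomials is the span of the \<open>\<P>\<^sub>2\<^sub>,\<^sub>n\<close>, and by variation of constants it
  contains \<open>\<pp>\<^sup>2 q\<close> for every matrix polynomial \<open>q\<close>. Hence it suffices to approximate \<open>f / \<pp>\<^sup>2\<close> for bounded \<open>f\<close> by
  polynomials in the scalar weights \<open>e\<^bsup>c|t| - t\<^sup>2\<^esup>\<close>. There the Taylor series of the cosine converges, so powers of
  \<open>sin (\<omega>t)\<close> can be approximated, hence so can bounded continuous and then bounded measurable functions.\<close>

section \<open>Gaussian integrals of exponentially bounded functions\<close>

text \<open>In adjoint form the equation for Q' reads R - (X_1 R)' + (X_2 R)'' = \<lambda> W_a z^T.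
  So the P_m are eigenfunctions of the adjoint of X following X, and X carries one orthogonal family
  to another, multiplying norms by \<lambda>. The factor (m - 1)(m - 2) is forced by degrees: X
  sends t^m to (1 - m + m(m - 1)/2) t^m plus lower terms. The same count shows the obstacle to
  density: the degrees 1 and 2 are lost, the range of X is a proper subspace of the matrix
  polynomials, and density of all polynomials is not enough. The multiples of \<pp>^2 remain, and
  since \<pp> has no real zero, division by \<pp>^2 is harmless. The error measured by \<W> then
  carries \<pp>^2 times the quadratic form of the weight; this polynomial growth is the reason for
  the factor e^{c|t|} in the scalar weights.\<close>

definition exp_bounded :: "(real \<Rightarrow> real) \<Rightarrow> bool" where
  "exp_bounded f \<longleftrightarrow> continuous_on UNIV f \<and> (\<exists>C c. \<forall>t. \<bar>f t\<bar> \<le> C * exp (c * \<bar>t\<bar>))"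

lemma exp_boundedI:
  "continuous_on UNIV f \<Longrightarrow> (\<And>t. \<bar>f t\<bar> \<le> C * exp (c * \<bar>t\<bar>)) \<Longrightarrow> exp_bounded f"
  unfolding exp_bounded_def by blast

lemma exp_bounded_continuous: "exp_bounded f \<Longrightarrow> continuous_on UNIV f"
  by (simp add: exp_bounded_def)

lemma exp_bounded_measurable: "exp_bounded f \<Longrightarrow> f \<in> borel_measurable borel"
  by (simp add: exp_bounded_def borel_measurable_continuous_onI)

lemma exp_bounded_const [intro, simp]: "exp_bounded (\<lambda>t. x)"
  by (rule exp_boundedI[where C = "\<bar>x\<bar>" and c = 0]) auto

lemma exp_bounded_ident [intro, simp]: "exp_bounded (\<lambda>t. t)"
proof (rule exp_boundedI[where C = 1 and c = 1])
  show "\<bar>t\<bar> \<le> 1 * exp (1 * \<bar>t\<bar>)" for t :: real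
    using exp_ge_add_one_self[of "\<bar>t\<bar>"] by (simp del: exp_ge_add_one_self)
qed (intro continuous_intros)

lemma exp_bounded_add [intro]:
  assumes "exp_bounded f" "exp_bounded g"
  shows "exp_bounded (\<lambda>t. f t + g t)"
proof -
  obtain C c where f: "\<And>t. \<bar>f t\<bar> \<le> C * exp (c * \<bar>t\<bar>)"
    using assms(1) by (auto simp: exp_bounded_def)
  obtain D e where g: "\<And>t. \<bar>g t\<bar> \<le> D * exp (e * \<bar>t\<bar>)"
    using assms(2) by (auto simp: exp_bounded_def)
  have 0: "C \<ge> 0" "D \<ge> 0" using f[of 0] g[of 0] by auto
  show ?thesis
  proof (rule exp_boundedI)
    show "continuous_on UNIV (\<lambda>t. f t + g t)"
      using assms by (intro continuous_intros) (auto simp: exp_bounded_def)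
    fix t
    have "C * exp (c * \<bar>t\<bar>) \<le> C * exp (max c e * \<bar>t\<bar>)" "D * exp (e * \<bar>t\<bar>) \<le> D * exp (max c e * \<bar>t\<bar>)"
      using 0 by (auto intro!: mult_left_mono mult_right_mono)
    then show "\<bar>f t + g t\<bar> \<le> (C + D) * exp (max c e * \<bar>t\<bar>)"
      using f[of t] g[of t] abs_triangle_ineq[of "f t" "g t"] unfolding distrib_right by linarith
  qed
qed

lemma exp_bounded_mult [intro]:
  assumes "exp_bounded f" "exp_bounded g"
  shows "exp_bounded (\<lambda>t. f t * g t)"
proof -
  obtain C c where f: "\<And>t. \<bar>f t\<bar> \<le> C * exp (c * \<bar>t\<bar>)"
    using assms(1) by (auto simp: exp_bounded_def)
  obtain D e where g: "\<And>t. \<bar>g t\<bar> \<le> D * exp (e * \<bar>t\<bar>)"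
    using assms(2) by (auto simp: exp_bounded_def)
  show ?thesis
  proof (rule exp_boundedI)
    show "continuous_on UNIV (\<lambda>t. f t * g t)"
      using assms by (intro continuous_intros) (auto simp: exp_bounded_def)
    fix t
    have "\<bar>f t * g t\<bar> \<le> (C * exp (c * \<bar>t\<bar>)) * (D * exp (e * \<bar>t\<bar>))"
      unfolding abs_mult using order_trans[OF abs_ge_zero f] by (intro mult_mono f g) auto
    also have "\<dots> = (C * D) * exp ((c + e) * \<bar>t\<bar>)"
      by (simp add: distrib_right exp_add)
    finally show "\<bar>f t * g t\<bar> \<le> (C * D) * exp ((c + e) * \<bar>t\<bar>)" .
  qed
qed

lemma exp_bounded_minus [intro]: "exp_bounded f \<Longrightarrow> exp_bounded (\<lambda>t. - f t)"
  using exp_bounded_mult[of "\<lambda>t. -1" f] by simp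

lemma exp_bounded_diff [intro]: "exp_bounded f \<Longrightarrow> exp_bounded g \<Longrightarrow> exp_bounded (\<lambda>t. f t - g t)"
  using exp_bounded_add[of f "\<lambda>t. - g t"] by auto

lemma exp_bounded_power [intro]: "exp_bounded f \<Longrightarrow> exp_bounded (\<lambda>t. f t ^ n)"
  by (induction n) auto

lemma exp_bounded_sum [intro]: "(\<And>i. i \<in> S \<Longrightarrow> exp_bounded (f i)) \<Longrightarrow> exp_bounded (\<lambda>t. \<Sum>i\<in>S. f i t)"
  by (induction S rule: infinite_finite_induct) auto

lemma exp_bounded_poly [intro, simp]: "exp_bounded (poly p)"
proof -
  have "exp_bounded (\<lambda>t. poly p t)"
    by (induction p) (simp_all add: exp_bounded_add exp_bounded_mult)
  then show ?thesis .
qed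

lemma exp_bounded_exp_abs [intro, simp]: "exp_bounded (\<lambda>t. exp (c * \<bar>t\<bar>))"
  by (rule exp_boundedI[where C = 1 and c = c]) (auto intro!: continuous_intros)

text \<open>Meant for denominators that are powers of \<pp>, which is at least 1; rational
  coefficients thus stay in the class.\<close>

lemma exp_bounded_divide [intro]:
  assumes f: "exp_bounded f" and g: "continuous_on UNIV g" "\<And>t. g t \<ge> 1"
  shows "exp_bounded (\<lambda>t. f t / g t)"
proof -
  have 0: "g t \<noteq> 0" "g t > 0" for t using g(2)[of t] by auto
  have "exp_bounded (\<lambda>t. 1 / g t)"
    by (rule exp_boundedI[where C = 1 and c = 0])
      (use 0 g in \<open>auto intro!: continuous_intros simp: abs_of_pos\<close>)
  from exp_bounded_mult[OF f this] show ?thesis by simp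
qed

text \<open>Completing the square in |t| - c: half of the Gaussian absorbs the exponential, and the
  other half stays integrable.\<close>

lemma gauss_exp_le:
  fixes t :: real
  shows "exp (- t\<^sup>2) * exp (c * \<bar>t\<bar>) \<le> exp (c\<^sup>2 / 2) * exp (- t\<^sup>2 / 2)"
proof -
  have "0 \<le> (\<bar>t\<bar> - c)\<^sup>2" by simp
  also have "\<dots> = t\<^sup>2 - 2 * c * \<bar>t\<bar> + c\<^sup>2" by (simp add: power2_eq_square algebra_simps)
  finally have "- t\<^sup>2 + c * \<bar>t\<bar> \<le> c\<^sup>2 / 2 + - t\<^sup>2 / 2" by simp
  then show ?thesis unfolding exp_add[symmetric] by simp
qed

lemma exp_bounded_gauss_le:
  assumes "exp_bounded f"
  obtains C where "\<And>t. \<bar>exp (- t\<^sup>2) * f t\<bar> \<le> C * exp (- t\<^sup>2 / 2)"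
proof -
  obtain C c where f: "\<And>t. \<bar>f t\<bar> \<le> C * exp (c * \<bar>t\<bar>)"
    using assms by (auto simp: exp_bounded_def)
  have C: "C \<ge> 0" using f[of 0] by auto
  show ?thesis
  proof
    fix t
    have "\<bar>exp (- t\<^sup>2) * f t\<bar> \<le> exp (- t\<^sup>2) * (C * exp (c * \<bar>t\<bar>))"
      unfolding abs_mult by (intro mult_mono f) auto
    also have "\<dots> = C * (exp (- t\<^sup>2) * exp (c * \<bar>t\<bar>))" by simp
    also have "\<dots> \<le> C * (exp (c\<^sup>2 / 2) * exp (- t\<^sup>2 / 2))"
      by (intro mult_left_mono gauss_exp_le C)
    finally show "\<bar>exp (- t\<^sup>2) * f t\<bar> \<le> (C * exp (c\<^sup>2 / 2)) * exp (- t\<^sup>2 / 2)" by simp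
  qed
qed

lemma integrable_gauss_half: "integrable lborel (\<lambda>t::real. exp (- t\<^sup>2 / 2))"
proof -
  have "integrable lborel (\<lambda>t. sqrt (2 * pi) * std_normal_density t)"
    by (intro integrable_mult_right integrable_normal_density) auto
  then show ?thesis by (simp add: std_normal_density_def)
qed

lemma exp_bounded_integrable:
  assumes "exp_bounded f"
  shows "integrable lborel (\<lambda>t. exp (- t\<^sup>2) * f t)"
proof -
  obtain C where C: "\<And>t. \<bar>exp (- t\<^sup>2) * f t\<bar> \<le> C * exp (- t\<^sup>2 / 2)"
    using exp_bounded_gauss_le[OF assms] by blast
  have "integrable lborel (\<lambda>t::real. C * exp (- t\<^sup>2 / 2))"
    by (intro integrable_mult_right integrable_gauss_half)
  then show ?thesis
  proof (rule Bochner_Integration.integrable_bound)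
    have "norm (exp (- t\<^sup>2) * f t) \<le> norm (C * exp (- t\<^sup>2 / 2))" for t
      using C[of t] by (metis abs_ge_self order_trans real_norm_def)
    then show "AE t in lborel. norm (exp (- t\<^sup>2) * f t) \<le> norm (C * exp (- t\<^sup>2 / 2))" by simp
  qed (use exp_bounded_measurable[OF assms] in measurable)
qed

lemma exp_bounded_gauss_tendsto:
  assumes "exp_bounded f"
  shows "((\<lambda>t. exp (- t\<^sup>2) * f t) \<longlongrightarrow> 0) at_top" "((\<lambda>t. exp (- t\<^sup>2) * f t) \<longlongrightarrow> 0) at_bot"
proof -
  obtain C where C: "\<And>t. \<bar>exp (- t\<^sup>2) * f t\<bar> \<le> C * exp (- t\<^sup>2 / 2)"
    using exp_bounded_gauss_le[OF assms] by blast
  have *: "((\<lambda>t. exp (- t\<^sup>2) * f t) \<longlongrightarrow> 0) F" if F: "filterlim (\<lambda>t::real. t\<^sup>2) at_top F" for F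
  proof (rule Lim_null_comparison)
    show "\<forall>\<^sub>F t in F. norm (exp (- t\<^sup>2) * f t) \<le> C * exp (- t\<^sup>2 / 2)" using C by simp
    have "filterlim (\<lambda>t. (1/2) * t\<^sup>2) at_top F"
      using F by (intro filterlim_tendsto_pos_mult_at_top[where c = "1/2"]) auto
    then have "((\<lambda>t. exp (- ((1/2) * t\<^sup>2))) \<longlongrightarrow> 0) F"
      by (intro filterlim_compose[OF exp_at_bot] filterlim_compose[OF filterlim_uminus_at_bot_at_top])
    then show "((\<lambda>t. C * exp (- t\<^sup>2 / 2)) \<longlongrightarrow> 0) F"
      using tendsto_mult_right_zero[of "\<lambda>t. exp (- ((1/2) * t\<^sup>2))" F C] by simp
  qed
  have "filterlim (\<lambda>t::real. t\<^sup>2) at_top at_top"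
    by (intro filterlim_pow_at_top filterlim_ident) auto
  moreover have "filterlim (\<lambda>t::real. t\<^sup>2) at_top at_bot"
    by (intro filterlim_pow_at_bot_even filterlim_ident) auto
  ultimately show "((\<lambda>t. exp (- t\<^sup>2) * f t) \<longlongrightarrow> 0) at_top" "((\<lambda>t. exp (- t\<^sup>2) * f t) \<longlongrightarrow> 0) at_bot"
    by (auto intro: *)
qed

text \<open>The fundamental theorem on the whole line with vanishing boundary terms. Integration by
  parts is always done through it, by supplying the total derivative.\<close>

lemma integral_gauss_deriv_eq_0:
  assumes "exp_bounded F" "exp_bounded f"
    and D: "\<And>t. ((\<lambda>t. exp (- t\<^sup>2) * F t) has_real_derivative exp (- t\<^sup>2) * f t) (at t)"
  shows "(LINT t|lborel. exp (- t\<^sup>2) * f t) = 0"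
proof -
  have "(LBINT t=-\<infinity>..\<infinity>. exp (- t\<^sup>2) * f t) = 0 - 0"
  proof (rule interval_integral_FTC_integrable)
    show "((\<lambda>t. exp (- t\<^sup>2) * F t) has_vector_derivative exp (- t\<^sup>2) * f t) (at t)" for t
      using D[of t] by (simp add: has_real_derivative_iff_has_vector_derivative)
    have "continuous_on UNIV (\<lambda>t. exp (- t\<^sup>2) * f t)"
      using exp_bounded_continuous[OF assms(2)] by (intro continuous_intros)
    then show "isCont (\<lambda>t. exp (- t\<^sup>2) * f t) t" for t
      by (simp add: continuous_on_eq_continuous_at)
    show "set_integrable lborel (einterval (- \<infinity>) \<infinity>) (\<lambda>t. exp (- t\<^sup>2) * f t)"
      using exp_bounded_integrable[OF assms(2)] by (simp add: set_integrable_def)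
  qed (use exp_bounded_gauss_tendsto[OF assms(1)] in
      \<open>simp_all only: ereal_tendsto_simps1, simp_all\<close>)
  then show ?thesis by (simp add: interval_lebesgue_integral_def set_lebesgue_integral_def)
qed

lemma has_integral_gauss: "has_bochner_integral lborel (\<lambda>t::real. exp (- t\<^sup>2)) (sqrt pi)"
  using has_bochner_integral_even_function[OF gaussian_moment_0] by simp

section \<open>Hermite polynomials\<close>

text \<open>The recursion comes from differentiating e^{-t^2} H_n once more in Rodrigues'
  formula.\<close>

fun hermite_poly :: "nat \<Rightarrow> real poly" where
  "hermite_poly 0 = 1"
| "hermite_poly (Suc n) = [:0, 2:] * hermite_poly n - pderiv (hermite_poly n)"

lemma deriv_gauss_poly:
  "((\<lambda>s. exp (- s\<^sup>2) * poly p s) has_real_derivative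
    exp (- t\<^sup>2) * (poly (pderiv p) t - 2 * t * poly p t)) (at t)"
  by (auto intro!: derivative_eq_intros simp: algebra_simps)

lemma funpow_deriv_gauss:
  "(deriv ^^ n) (\<lambda>s. exp (- s\<^sup>2)) = (\<lambda>t. (-1) ^ n * (exp (- t\<^sup>2) * poly (hermite_poly n) t))"
proof (induction n)
  case (Suc n)
  have "((\<lambda>t. (-1) ^ n * (exp (- t\<^sup>2) * poly (hermite_poly n) t)) has_real_derivative
    (-1) ^ n * (exp (- t\<^sup>2) * (poly (pderiv (hermite_poly n)) t - 2 * t * poly (hermite_poly n) t))) (at t)" for t
    by (intro DERIV_cmult deriv_gauss_poly)
  from DERIV_imp_deriv[OF this] show ?case
    by (simp add: Suc fun_eq_iff algebra_simps)
qed simp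

lemma hermite_eq_poly: "hermite n = poly (hermite_poly n)"
proof
  fix t
  have "hermite n t = ((-1) ^ n * (-1) ^ n) * (exp (t\<^sup>2) * exp (- t\<^sup>2)) * poly (hermite_poly n) t"
    unfolding hermite_def funpow_deriv_gauss by (simp add: mult_ac)
  then show "hermite n t = poly (hermite_poly n) t"
    by (simp flip: exp_add power_mult_distrib)
qed

text \<open>Differentiating the recursion gives 2 H_n plus 2n times the recursion one step lower,
  together 2(n + 1) H_n.\<close>

lemma pderiv_hermite_poly: "pderiv (hermite_poly n) = smult (2 * real n) (hermite_poly (n - 1))"
proof (induction n)
  case (Suc n)
  show ?case
  proof (cases n)
    case (Suc m)
    have "pderiv (hermite_poly (Suc n)) =
        smult 2 (hermite_poly n) + [:0, 2:] * pderiv (hermite_poly n) - pderiv (pderiv (hermite_poly n))"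
      by (simp add: pderiv_diff pderiv_pCons pderiv_smult)
    also have "\<dots> = smult 2 (hermite_poly n) + smult (2 * real n) ([:0, 2:] * hermite_poly m - pderiv (hermite_poly m))"
      using Suc.IH by (simp add: Suc pderiv_smult smult_diff_right mult.commute del: hermite_poly.simps)
    also have "\<dots> = smult 2 (hermite_poly n) + smult (2 * real n) (hermite_poly n)"
      by (simp add: Suc)
    also have "\<dots> = smult (2 * real (Suc n)) (hermite_poly n)"
      by (simp flip: smult_add_left)
    finally show ?thesis by simp
  qed (simp add: pderiv_pCons numeral_poly)
qed (simp)

text \<open>Half the derivative of \<open>H\<^sub>n\<close>. By Hermite's equation, the functions \<open>A H\<^sub>n + B K\<^sub>n\<close> with polynomial
  \<open>A\<close>, \<open>B\<close> are closed under differentiation.\<close>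

definition Kr :: "nat \<Rightarrow> real \<Rightarrow> real" where "Kr n t = real n * hermite (n - 1) t"

lemma hermite_Suc: "hermite (Suc n) t = 2 * t * hermite n t - 2 * Kr n t"
  by (simp add: hermite_eq_poly Kr_def pderiv_hermite_poly algebra_simps)

lemma hermite_0: "hermite 0 t = 1" by (simp add: hermite_eq_poly)
lemma Kr_0 [simp]: "Kr 0 t = 0" by (simp add: Kr_def)
lemma Kr_Suc: "Kr (Suc n) t = (real n + 1) * hermite n t" by (simp add: Kr_def)

lemma Kr_eq: "n > 0 \<Longrightarrow> 2 * t * Kr n t - real n * hermite n t = 2 * real n * Kr (n - 1) t"
  by (cases n) (auto simp: Kr_Suc hermite_Suc algebra_simps)

lemma hermite_deriv [derivative_intros]: "(hermite n has_real_derivative 2 * Kr n t) (at t)"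
  unfolding hermite_eq_poly Kr_def
  by (rule DERIV_cong[OF poly_DERIV]) (simp add: pderiv_hermite_poly)

lemma Kr_deriv [derivative_intros]: "(Kr n has_real_derivative 2 * t * Kr n t - real n * hermite n t) (at t)"
proof (cases n)
  case (Suc m)
  have "((\<lambda>t. real n * hermite (n - 1) t) has_real_derivative real n * (2 * Kr (n - 1) t)) (at t)"
    by (intro DERIV_cmult hermite_deriv)
  moreover have "(\<lambda>t. real n * hermite (n - 1) t) = Kr n" by (simp add: Kr_def fun_eq_iff)
  moreover have "real n * (2 * Kr (n - 1) t) = 2 * t * Kr n t - real n * hermite n t"
    using Kr_eq[of n t] by (simp add: Suc)
  ultimately show ?thesis by simp
qed (simp add: Kr_def[abs_def])

lemma exp_bounded_hermite [intro, simp]: "exp_bounded (hermite n)" by (simp add: hermite_eq_poly)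
lemma exp_bounded_Kr [intro, simp]: "exp_bounded (Kr n)" unfolding Kr_def[abs_def] by auto

definition gauss_ip :: "(real \<Rightarrow> real) \<Rightarrow> (real \<Rightarrow> real) \<Rightarrow> real" where
  "gauss_ip f g = (LINT t|lborel. exp (- t\<^sup>2) * (f t * g t))"

text \<open>For the Gaussian weight, 2t - d/dt is adjoint to d/dt, so both indices drop by one. At
  \<open>m = 0\<close> the truncated \<open>m - 1\<close> is harmless, its factor being
  zero.\<close>

lemma gauss_ip_hermite_Suc: "gauss_ip (hermite (Suc n)) (hermite m) = 2 * real m * gauss_ip (hermite n) (hermite (m - 1))"
proof -
  have "(LINT t|lborel. exp (- t\<^sup>2) * (hermite n t * (2 * Kr m t) - hermite (Suc n) t * hermite m t)) = 0"
  proof (rule integral_gauss_deriv_eq_0)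
    show "((\<lambda>t. exp (- t\<^sup>2) * (hermite n t * hermite m t)) has_real_derivative
        exp (- t\<^sup>2) * (hermite n t * (2 * Kr m t) - hermite (Suc n) t * hermite m t)) (at t)" for t
      by (auto intro!: derivative_eq_intros simp: hermite_Suc algebra_simps)
  qed (auto intro!: exp_bounded_mult exp_bounded_diff)
  moreover have "integrable lborel (\<lambda>t. exp (- t\<^sup>2) * (hermite n t * (2 * Kr m t)))"
    "integrable lborel (\<lambda>t. exp (- t\<^sup>2) * (hermite (Suc n) t * hermite m t))"
    by (auto intro!: exp_bounded_integrable exp_bounded_mult)
  ultimately have "gauss_ip (hermite (Suc n)) (hermite m) = (LINT t|lborel. exp (- t\<^sup>2) * (hermite n t * (2 * Kr m t)))"
    by (simp add: gauss_ip_def right_diff_distrib)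
  also have "\<dots> = (LINT t|lborel. (2 * real m) * (exp (- t\<^sup>2) * (hermite n t * hermite (m - 1) t)))"
    by (simp add: Kr_def mult_ac)
  finally show ?thesis by (simp add: gauss_ip_def)
qed

lemma gauss_ip_commute: "gauss_ip f g = gauss_ip g f"
  by (simp add: gauss_ip_def mult.commute)

lemma gauss_ip_hermite: "gauss_ip (hermite n) (hermite m) = (if n = m then sqrt pi * 2 ^ n * fact n else 0)"
proof (induction n arbitrary: m)
  case 0
  show ?case
  proof (cases m)
    case 0
    then show ?thesis using has_integral_gauss by (simp add: hermite_0 gauss_ip_def has_bochner_integral_iff)
  next
    case (Suc k)
    then show ?thesis by (subst gauss_ip_commute) (simp add: gauss_ip_hermite_Suc)
  qed
next
  case (Suc n)
  show ?case
  proof (cases m)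
    case 0
    then show ?thesis using gauss_ip_hermite_Suc[of n 0] by simp
  qed (simp add: gauss_ip_hermite_Suc Suc)
qed

section \<open>Complex two by two matrices and the composed operator\<close>

type_synonym cmat = "complex^2^2"

lemma mat2_eq_iff:
  fixes A B :: "'a^2^2"
  shows "A = B \<longleftrightarrow> A $ 1 $ 1 = B $ 1 $ 1 \<and> A $ 1 $ 2 = B $ 1 $ 2 \<and> A $ 2 $ 1 = B $ 2 $ 1 \<and> A $ 2 $ 2 = B $ 2 $ 2"
  by (auto simp: vec_eq_iff forall_2)

lemma mat2_mult_nth:
  fixes A B :: "'a::semiring_1^2^2"
  shows "(A ** B) $ i $ j = A $ i $ 1 * B $ 1 $ j + A $ i $ 2 * B $ 2 $ j"
  by (simp add: matrix_matrix_mult_def sum_2)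

lemma rmat2_nth [simp]:
  "rmat2 p q r s $ 1 $ 1 = of_real p" "rmat2 p q r s $ 1 $ 2 = of_real q"
  "rmat2 p q r s $ 2 $ 1 = of_real r" "rmat2 p q r s $ 2 $ 2 = of_real s"
  by (simp_all add: rmat2_def)

lemma ctranspose_nth [simp]: "ctranspose A $ i $ j = cnj (A $ j $ i)"
  by (simp add: ctranspose_def)

lemma rmat2_eq_iff: "rmat2 p q r s = rmat2 p' q' r' s' \<longleftrightarrow> p = p' \<and> q = q' \<and> r = r' \<and> s = s'"
  by (auto simp: mat2_eq_iff)

lemma rmat2_arith:
  "rmat2 p q r s + rmat2 p' q' r' s' = rmat2 (p + p') (q + q') (r + r') (s + s')"
  "rmat2 p q r s - rmat2 p' q' r' s' = rmat2 (p - p') (q - q') (r - r') (s - s')"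
  "- rmat2 p q r s = rmat2 (- p) (- q) (- r) (- s)"
  "x *\<^sub>R rmat2 p q r s = rmat2 (x * p) (x * q) (x * r) (x * s)"
  "rmat2 p q r s ** rmat2 p' q' r' s' =
     rmat2 (p * p' + q * r') (p * q' + q * s') (r * p' + s * r') (r * q' + s * s')"
  "ctranspose (rmat2 p q r s) = rmat2 p r q s"
  "mat 1 = rmat2 1 0 0 1"
  "0 = rmat2 0 0 0 0"
  by (simp_all add: mat2_eq_iff mat2_mult_nth scaleR_conv_of_real[where 'a = complex] mat_def)

definition entry :: "2 \<Rightarrow> 2 \<Rightarrow> complex \<Rightarrow> cmat" where
  "entry i j z = (\<chi> k l. if k = i \<and> l = j then z else 0)"

lemma bounded_linear_entry: "bounded_linear (entry i j)"
  by (rule linear_conv_bounded_linear[THEN iffD1])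
    (auto simp: entry_def vec_eq_iff intro!: linearI)

text \<open>Each summand is a bounded linear image of one entry, which reduces derivatives and
  integrability of matrix functions to scalar statements.\<close>

lemma mat2_decomp: "A = entry 1 1 (A $ 1 $ 1) + entry 1 2 (A $ 1 $ 2) + entry 2 1 (A $ 2 $ 1) + entry 2 2 (A $ 2 $ 2)"
  by (simp add: mat2_eq_iff entry_def)

lemma bounded_linear_mat_nth: "bounded_linear (\<lambda>A :: cmat. A $ i $ j)"
  using bounded_linear_compose[OF bounded_linear_vec_nth bounded_linear_vec_nth] .

lemma has_vector_derivative_mat2:
  assumes "\<And>i j. ((\<lambda>t. Q t $ i $ j) has_vector_derivative Q' $ i $ j) (at t)"
  shows "((Q :: real \<Rightarrow> cmat) has_vector_derivative Q') (at t)"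
proof -
  have "((\<lambda>t. entry 1 1 (Q t $ 1 $ 1) + entry 1 2 (Q t $ 1 $ 2) + entry 2 1 (Q t $ 2 $ 1) + entry 2 2 (Q t $ 2 $ 2))
    has_vector_derivative entry 1 1 (Q' $ 1 $ 1) + entry 1 2 (Q' $ 1 $ 2) + entry 2 1 (Q' $ 2 $ 1) + entry 2 2 (Q' $ 2 $ 2)) (at t)"
    by (intro has_vector_derivative_add bounded_linear.has_vector_derivative[OF bounded_linear_entry] assms)
  then show ?thesis by (simp flip: mat2_decomp)
qed

lemma has_vector_derivative_rmat2:
  assumes "(f has_real_derivative f') (at t)" "(g has_real_derivative g') (at t)"
    "(h has_real_derivative h') (at t)" "(k has_real_derivative k') (at t)"
  shows "((\<lambda>t. rmat2 (f t) (g t) (h t) (k t)) has_vector_derivative rmat2 f' g' h' k') (at t)"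
proof (rule has_vector_derivative_mat2)
  have "((\<lambda>t. of_real (u t) :: complex) has_vector_derivative of_real u') (at t)"
    if "(u has_real_derivative u') (at t)" for u u'
    using that by (intro has_vector_derivative_of_real) (simp add: has_real_derivative_iff_has_vector_derivative)
  note * = assms[THEN this]
  show "((\<lambda>t. rmat2 (f t) (g t) (h t) (k t) $ i $ j) has_vector_derivative rmat2 f' g' h' k' $ i $ j) (at t)" for i j
    using exhaust_2[of i] exhaust_2[of j] * by auto
qed

lemma integrable_mat2:
  assumes "\<And>i j. integrable M (\<lambda>t. Q t $ i $ j)"
  shows "integrable M (Q :: _ \<Rightarrow> cmat)"
proof -
  have "integrable M (\<lambda>t. entry 1 1 (Q t $ 1 $ 1) + entry 1 2 (Q t $ 1 $ 2) + entry 2 1 (Q t $ 2 $ 1) + entry 2 2 (Q t $ 2 $ 2))"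
    by (intro Bochner_Integration.integrable_add integrable_bounded_linear[OF bounded_linear_entry] assms)
  then show ?thesis by (simp flip: mat2_decomp)
qed

lemma integral_mat2_nth:
  "integrable M (Q :: _ \<Rightarrow> cmat) \<Longrightarrow> (LINT t|M. Q t) $ i $ j = (LINT t|M. Q t $ i $ j)"
  by (rule integral_bounded_linear[OF bounded_linear_mat_nth, symmetric])

lemma has_bochner_integral_rmat2:
  assumes "has_bochner_integral M f If'" "has_bochner_integral M g Ig'"
    "has_bochner_integral M h Ih'" "has_bochner_integral M k Ik'"
  shows "has_bochner_integral M (\<lambda>t. rmat2 (f t) (g t) (h t) (k t)) (rmat2 If' Ig' Ih' Ik')"
proof -
  have *: "integrable M (\<lambda>t. rmat2 (f t) (g t) (h t) (k t) $ i $ j)" for i j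
    using assms exhaust_2[of i] exhaust_2[of j] by (auto simp: has_bochner_integral_iff)
  have int: "integrable M (\<lambda>t. rmat2 (f t) (g t) (h t) (k t))"
    by (rule integrable_mat2[OF *])
  moreover have "(LINT t|M. rmat2 (f t) (g t) (h t) (k t)) = rmat2 If' Ig' Ih' Ik'"
    using assms by (simp add: mat2_eq_iff integral_mat2_nth[OF int] has_bochner_integral_iff)
  ultimately show ?thesis by (simp add: has_bochner_integral_iff)
qed

lemma measurable_mat2_nth:
  "(Q :: _ \<Rightarrow> cmat) \<in> borel_measurable M \<Longrightarrow> (\<lambda>t. Q t $ i $ j) \<in> borel_measurable M"
  by (rule measurable_compose[OF _ borel_measurable_continuous_onI[OF linear_continuous_on[OF bounded_linear_mat_nth]]])

lemma bounded_bilinear_mat_mult: "bounded_bilinear ((**) :: cmat \<Rightarrow> cmat \<Rightarrow> cmat)"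
  unfolding bilinear_conv_bounded_bilinear[symmetric] bilinear_def
  by (auto intro!: linearI simp: mat2_eq_iff mat2_mult_nth algebra_simps)

lemmas has_vector_derivative_mat_mult =
  bounded_bilinear.has_vector_derivative[OF bounded_bilinear_mat_mult]

lemmas mat_scaleR_mult =
  bounded_bilinear.scaleR_left[OF bounded_bilinear_mat_mult]
  bounded_bilinear.scaleR_right[OF bounded_bilinear_mat_mult]

lemmas mat_minus_mult =
  bounded_bilinear.minus_left[OF bounded_bilinear_mat_mult]
  bounded_bilinear.minus_right[OF bounded_bilinear_mat_mult]

lemma matrix_inv_eqI:
  assumes "A ** B = mat 1" "B ** A = (mat 1 :: cmat)"
  shows "matrix_inv A = B"
proof -
  have "A ** matrix_inv A = mat 1 \<and> matrix_inv A ** A = mat 1"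
    unfolding matrix_inv_def by (rule someI[where x = B]) (use assms in simp)
  then have "matrix_inv A = (B ** A) ** matrix_inv A" using assms by simp
  also have "\<dots> = B" using \<open>A ** matrix_inv A = mat 1 \<and> _\<close> by (simp flip: matrix_mul_assoc)
  finally show ?thesis .
qed

lemma matrix_inv_right_mult: "invertible A \<Longrightarrow> A ** matrix_inv A = (mat 1 :: cmat)"
  unfolding invertible_def matrix_inv_def by (rule someI2_ex) auto

lemma matrix_derivI: "(\<And>t. (y has_vector_derivative y' t) (at t)) \<Longrightarrow> matrix_deriv y = y'"
  by (auto simp: matrix_deriv_def fun_eq_iff intro: vector_derivative_at)

section \<open>The composition of the two first-order operators\<close>

definition X\<^sub>1 :: "real \<Rightarrow> real \<Rightarrow> cmat" where
  "X\<^sub>1 a t = rmat2 (- t) (a / 2) (a / (a\<^sup>2 + 2)) (- t)"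

definition X\<^sub>2 :: "real \<Rightarrow> real \<Rightarrow> cmat" where
  "X\<^sub>2 a t = rmat2 (t\<^sup>2 / 2 + (3 * a\<^sup>2 + 2) / (4 * (a\<^sup>2 + 2))) (- (a * t / 2))
     (- (a * t / (a\<^sup>2 + 2))) (t\<^sup>2 / 2 + 1 / 4)"

definition Xop :: "real \<Rightarrow> (real \<Rightarrow> cmat) \<Rightarrow> real \<Rightarrow> cmat" where
  "Xop a y t = y t + matrix_deriv y t ** X\<^sub>1 a t + matrix_deriv (matrix_deriv y) t ** X\<^sub>2 a t"

lemma hermite_small: "hermite 0 t = 1" "hermite 1 t = 2 * t" "hermite (Suc 0) t = 2 * t" "hermite 2 t = 4 * t\<^sup>2 - 2"
  by (simp_all add: hermite_eq_poly numeral_2_eq_2 pderiv_pCons power2_eq_square algebra_simps)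

lemma P\<^sub>a_1: "P\<^sub>a a 1 = (\<lambda>t. rmat2 (2 * t) (- a) (- a) ((a\<^sup>2 + 2) * t))"
  by (auto simp: P\<^sub>a_def rmat2_arith hermite_small fun_eq_iff rmat2_eq_iff algebra_simps)

lemma P\<^sub>a_2: "P\<^sub>a a 2 = (\<lambda>t. rmat2 (4 * t\<^sup>2 - 2) (- (4 * a * t)) (- (4 * a * t)) (4 * (1 + a\<^sup>2) * t\<^sup>2 - 2))"
  by (auto simp: P\<^sub>a_def rmat2_arith hermite_small fun_eq_iff rmat2_eq_iff algebra_simps power2_eq_square)

lemma matrix_deriv_P\<^sub>a_1: "matrix_deriv (P\<^sub>a a 1) = (\<lambda>t. rmat2 2 0 0 (a\<^sup>2 + 2))"
  unfolding P\<^sub>a_1 by (rule matrix_derivI, rule has_vector_derivative_rmat2) (auto intro!: derivative_eq_intros)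

lemma matrix_deriv_P\<^sub>a_2: "matrix_deriv (P\<^sub>a a 2) = (\<lambda>t. rmat2 (8 * t) (- (4 * a)) (- (4 * a)) (8 * (1 + a\<^sup>2) * t))"
  unfolding P\<^sub>a_2 by (rule matrix_derivI, rule has_vector_derivative_rmat2) (auto intro!: derivative_eq_intros)

text \<open>The coefficient \<open>A\<^sub>1\<^sub>1\<close> with the inverse carried out: D^{-1}
  P_1 D for D = P_1'. Its derivative is again D.\<close>

definition M\<^sub>1 :: "real \<Rightarrow> real \<Rightarrow> cmat" where
  "M\<^sub>1 a t = rmat2 (2 * t) (- (a * (a\<^sup>2 + 2) / 2)) (- (2 * a / (a\<^sup>2 + 2))) ((a\<^sup>2 + 2) * t)"

lemma pos_consts: "a\<^sup>2 + 2 > (0::real)" "3 * a\<^sup>2 + 2 > (0::real)" "1 + a\<^sup>2 > (0::real)"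
  using zero_le_power2[of a] by linarith+

lemma nz_consts: "a\<^sup>2 + 2 \<noteq> (0::real)" "3 * a\<^sup>2 + 2 \<noteq> (0::real)" "1 + a\<^sup>2 \<noteq> (0::real)"
  using pos_consts[of a] by linarith+

lemma \<A>\<^sub>1_eq: "\<A>\<^sub>1 a y t = matrix_deriv y t ** M\<^sub>1 a t - y t ** rmat2 2 0 0 (a\<^sup>2 + 2)"
proof -
  have inv: "matrix_inv (rmat2 2 0 0 (a\<^sup>2 + 2)) = rmat2 (1 / 2) 0 0 (1 / (a\<^sup>2 + 2))"
    using nz_consts[of a] by (intro matrix_inv_eqI) (simp_all add: rmat2_arith)
  have "A\<^sub>1\<^sub>1 a t = M\<^sub>1 a t"
    unfolding A\<^sub>1\<^sub>1_def matrix_deriv_P\<^sub>a_1 inv unfolding P\<^sub>a_1 M\<^sub>1_def rmat2_arith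
    using nz_consts[of a] by (simp add: rmat2_eq_iff)
  then show ?thesis
    unfolding \<A>\<^sub>1_def first_order_op_def A\<^sub>1\<^sub>0_def matrix_deriv_P\<^sub>a_1
    by (simp add: mat_minus_mult)
qed

lemma M\<^sub>1_deriv: "(M\<^sub>1 a has_vector_derivative rmat2 2 0 0 (a\<^sup>2 + 2)) (at t)"
  unfolding M\<^sub>1_def[abs_def] by (rule has_vector_derivative_rmat2) (auto intro!: derivative_eq_intros)

text \<open>The derivative of \<open>M\<^sub>1\<close> is P_1', so the two terms with y' cancel and
  only y'' is left.\<close>

lemma matrix_deriv_\<A>\<^sub>1:
  assumes y: "\<And>t. (y has_vector_derivative y' t) (at t)" "\<And>t. (y' has_vector_derivative y'' t) (at t)"
  shows "matrix_deriv (\<A>\<^sub>1 a y) = (\<lambda>t. y'' t ** M\<^sub>1 a t)"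
proof (rule matrix_derivI)
  fix t
  have "\<A>\<^sub>1 a y = (\<lambda>t. y' t ** M\<^sub>1 a t - y t ** rmat2 2 0 0 (a\<^sup>2 + 2))"
    unfolding \<A>\<^sub>1_eq matrix_derivI[OF y(1)] ..
  moreover have "(\<dots> has_vector_derivative ((y' t ** rmat2 2 0 0 (a\<^sup>2 + 2) + y'' t ** M\<^sub>1 a t) -
      (y t ** 0 + y' t ** rmat2 2 0 0 (a\<^sup>2 + 2)))) (at t)"
    by (intro has_vector_derivative_diff has_vector_derivative_mat_mult y M\<^sub>1_deriv has_vector_derivative_const)
  ultimately show "(\<A>\<^sub>1 a y has_vector_derivative y'' t ** M\<^sub>1 a t) (at t)" by simp
qed

lemma P\<^sub>a_2_derivs:
  "(P\<^sub>a a 2 has_vector_derivative matrix_deriv (P\<^sub>a a 2) t) (at t)"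
  "(matrix_deriv (P\<^sub>a a 2) has_vector_derivative rmat2 8 0 0 (8 * (1 + a\<^sup>2))) (at t)"
proof -
  show "(P\<^sub>a a 2 has_vector_derivative matrix_deriv (P\<^sub>a a 2) t) (at t)"
    unfolding matrix_deriv_P\<^sub>a_2 unfolding P\<^sub>a_2
    by (rule has_vector_derivative_rmat2) (auto intro!: derivative_eq_intros)
  show "(matrix_deriv (P\<^sub>a a 2) has_vector_derivative rmat2 8 0 0 (8 * (1 + a\<^sup>2))) (at t)"
    unfolding matrix_deriv_P\<^sub>a_2
    by (rule has_vector_derivative_rmat2) (auto intro!: derivative_eq_intros)
qed

lemma matrix_deriv_\<P>\<^sub>1_2: "matrix_deriv (\<P>\<^sub>1 a 2) t = rmat2 8 0 0 (8 * (1 + a\<^sup>2)) ** M\<^sub>1 a t"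
  unfolding \<P>\<^sub>1_def using matrix_deriv_\<A>\<^sub>1[OF P\<^sub>a_2_derivs] by simp

text \<open>The poles cancel here: the matrix to be inverted is E \<open>M\<^sub>1\<close> with a
  constant diagonal E, and it is met only behind y'' \<open>M\<^sub>1\<close>, so that just the
  inverse of E remains. Invertibility at t gives \<open>matrix_inv\<close> its meaning.\<close>

lemma \<A>\<^sub>2_\<A>\<^sub>1_eq:
  assumes y: "\<And>t. (y has_vector_derivative y' t) (at t)" "\<And>t. (y' has_vector_derivative y'' t) (at t)"
    and inv: "invertible (matrix_deriv (\<P>\<^sub>1 a 2) t)"
  shows "\<A>\<^sub>2 a (\<A>\<^sub>1 a y) t = Xop a y t"
proof -
  let ?E = "rmat2 8 0 0 (8 * (1 + a\<^sup>2))" and ?E' = "rmat2 (1 / 8) 0 0 (1 / (8 * (1 + a\<^sup>2)))"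
  let ?D' = "rmat2 (1 / 2) 0 0 (1 / (a\<^sup>2 + 2))" and ?D = "rmat2 2 0 0 (a\<^sup>2 + 2)"
  let ?I = "matrix_inv (matrix_deriv (\<P>\<^sub>1 a 2) t)"
  have E: "?E' ** ?E = mat 1" using nz_consts[of a] by (simp add: rmat2_arith rmat2_eq_iff)
  have "M\<^sub>1 a t ** ?I = ?E' ** (?E ** M\<^sub>1 a t ** ?I)"
    using E by (simp add: matrix_mul_assoc)
  also have "\<dots> = ?E'"
    using matrix_inv_right_mult[OF inv] by (simp add: matrix_deriv_\<P>\<^sub>1_2)
  finally have MI: "M\<^sub>1 a t ** ?I = ?E'" .
  have P12: "\<P>\<^sub>1 a 2 t = rmat2 (8 * t) (- (4 * a)) (- (4 * a)) (8 * (1 + a\<^sup>2) * t) ** M\<^sub>1 a t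
      - rmat2 (4 * t\<^sup>2 - 2) (- (4 * a * t)) (- (4 * a * t)) (4 * (1 + a\<^sup>2) * t\<^sup>2 - 2) ** ?D"
    unfolding \<P>\<^sub>1_def \<A>\<^sub>1_eq matrix_deriv_P\<^sub>a_2 unfolding P\<^sub>a_2 ..
  \<comment> \<open>This identity and the next are the origin of the coefficients
    \<open>X\<^sub>2\<close> and \<open>X\<^sub>1\<close>.\<close>
  have X2: "?E' ** \<P>\<^sub>1 a 2 t ** ?D' = X\<^sub>2 a t"
    unfolding P12 X\<^sub>2_def M\<^sub>1_def rmat2_arith rmat2_eq_iff using nz_consts[of a]
    by (auto simp: divide_simps) (simp_all add: algebra_simps power2_eq_square)
  have X1: "M\<^sub>1 a t ** ?D' = - X\<^sub>1 a t"
    unfolding X\<^sub>1_def M\<^sub>1_def rmat2_arith rmat2_eq_iff using nz_consts[of a]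
    by (simp add: field_simps)
  have DD: "?D ** ?D' = mat 1" using nz_consts[of a] by (simp add: rmat2_arith rmat2_eq_iff)
  have "\<A>\<^sub>2 a (\<A>\<^sub>1 a y) t = - (\<A>\<^sub>1 a y t ** ?D') + y'' t ** (M\<^sub>1 a t ** ?I) ** \<P>\<^sub>1 a 2 t ** ?D'"
    unfolding \<A>\<^sub>2_def first_order_op_def A\<^sub>2\<^sub>0_def A\<^sub>2\<^sub>1_def matrix_deriv_\<A>\<^sub>1[OF y]
    by (simp add: mat_minus_mult matrix_mul_assoc)
  also have "\<A>\<^sub>1 a y t ** ?D' = y' t ** (M\<^sub>1 a t ** ?D') - y t ** (?D ** ?D')"
    unfolding \<A>\<^sub>1_eq matrix_derivI[OF y(1)]
    by (simp add: matrix_mul_assoc bounded_bilinear.diff_left[OF bounded_bilinear_mat_mult])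
  also have "y'' t ** (M\<^sub>1 a t ** ?I) ** \<P>\<^sub>1 a 2 t ** ?D' = y'' t ** (?E' ** \<P>\<^sub>1 a 2 t ** ?D')"
    unfolding MI by (simp add: matrix_mul_assoc)
  finally show ?thesis
    unfolding X1 X2 DD Xop_def matrix_derivI[OF y(1)] matrix_derivI[OF y(2)]
    by (simp add: mat_minus_mult)
qed

section \<open>Green's identity\<close>

text \<open>First component of X on a row. The values of the derivatives are plain real arguments,
  so that pointwise claims become algebraic identities.\<close>

definition X_fst :: "real \<Rightarrow> real \<Rightarrow> real \<Rightarrow> real \<Rightarrow> real \<Rightarrow> real \<Rightarrow> real \<Rightarrow> real" where
  "X_fst a t y\<^sub>1 y\<^sub>1' y\<^sub>2' y\<^sub>1'' y\<^sub>2'' = y\<^sub>1 - t * y\<^sub>1' + a / (a\<^sup>2 + 2) * y\<^sub>2'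
     + (t\<^sup>2 / 2 + (3 * a\<^sup>2 + 2) / (4 * (a\<^sup>2 + 2))) * y\<^sub>1'' - a * t / (a\<^sup>2 + 2) * y\<^sub>2''"

definition X_snd :: "real \<Rightarrow> real \<Rightarrow> real \<Rightarrow> real \<Rightarrow> real \<Rightarrow> real \<Rightarrow> real \<Rightarrow> real" where
  "X_snd a t y\<^sub>2 y\<^sub>1' y\<^sub>2' y\<^sub>1'' y\<^sub>2'' = y\<^sub>2 + a / 2 * y\<^sub>1' - t * y\<^sub>2' - a * t / 2 * y\<^sub>1''
     + (t\<^sup>2 / 2 + 1 / 4) * y\<^sub>2''"

lemma Xop_rmat2:
  assumes "\<And>t. (y has_vector_derivative y' t) (at t)" "\<And>t. (y' has_vector_derivative y'' t) (at t)"
    and "y t = rmat2 y\<^sub>1\<^sub>1 y\<^sub>1\<^sub>2 y\<^sub>2\<^sub>1 y\<^sub>2\<^sub>2" "y' t = rmat2 z\<^sub>1\<^sub>1 z\<^sub>1\<^sub>2 z\<^sub>2\<^sub>1 z\<^sub>2\<^sub>2" "y'' t = rmat2 w\<^sub>1\<^sub>1 w\<^sub>1\<^sub>2 w\<^sub>2\<^sub>1 w\<^sub>2\<^sub>2"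
  shows "Xop a y t = rmat2 (X_fst a t y\<^sub>1\<^sub>1 z\<^sub>1\<^sub>1 z\<^sub>1\<^sub>2 w\<^sub>1\<^sub>1 w\<^sub>1\<^sub>2) (X_snd a t y\<^sub>1\<^sub>2 z\<^sub>1\<^sub>1 z\<^sub>1\<^sub>2 w\<^sub>1\<^sub>1 w\<^sub>1\<^sub>2)
    (X_fst a t y\<^sub>2\<^sub>1 z\<^sub>2\<^sub>1 z\<^sub>2\<^sub>2 w\<^sub>2\<^sub>1 w\<^sub>2\<^sub>2) (X_snd a t y\<^sub>2\<^sub>2 z\<^sub>2\<^sub>1 z\<^sub>2\<^sub>2 w\<^sub>2\<^sub>1 w\<^sub>2\<^sub>2)"
  unfolding Xop_def matrix_derivI[OF assms(1)] matrix_derivI[OF assms(2)] assms(3-5)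
    X\<^sub>1_def X\<^sub>2_def rmat2_arith rmat2_eq_iff X_fst_def X_snd_def
  by (simp add: algebra_simps)

text \<open>The Gaussian is divided out: \<open>u\<close>, \<open>q\<close>, \<open>r\<close>,
  \<open>w\<close> stand for e^{t^2} times U, Q, R and \<lambda> W_a z^T, whence the terms with 2t.
  In the derivative of yQ + y'U the factor of y' is Q + U' = X_1 R and that of y'' is U = X_2
  R.\<close>

lemma green_integral:
  assumes y: "\<And>t. (y\<^sub>1 has_real_derivative y\<^sub>1' t) (at t)" "\<And>t. (y\<^sub>2 has_real_derivative y\<^sub>2' t) (at t)"
      "\<And>t. (y\<^sub>1' has_real_derivative y\<^sub>1'' t) (at t)" "\<And>t. (y\<^sub>2' has_real_derivative y\<^sub>2'' t) (at t)"
    and y_eb: "exp_bounded y\<^sub>1" "exp_bounded y\<^sub>2" "exp_bounded y\<^sub>1'" "exp_bounded y\<^sub>2'"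
      "exp_bounded y\<^sub>1''" "exp_bounded y\<^sub>2''"
    and eb: "exp_bounded u\<^sub>1" "exp_bounded u\<^sub>2" "exp_bounded q\<^sub>1" "exp_bounded q\<^sub>2"
      "exp_bounded r\<^sub>1" "exp_bounded r\<^sub>2" "exp_bounded w\<^sub>1" "exp_bounded w\<^sub>2"
    and u_eq: "\<And>t. u\<^sub>1 t = (t\<^sup>2 / 2 + (3 * a\<^sup>2 + 2) / (4 * (a\<^sup>2 + 2))) * r\<^sub>1 t - a * t / 2 * r\<^sub>2 t"
      "\<And>t. u\<^sub>2 t = (t\<^sup>2 / 2 + 1 / 4) * r\<^sub>2 t - a * t / (a\<^sup>2 + 2) * r\<^sub>1 t"
    and u: "\<And>t. (u\<^sub>1 has_real_derivative 2 * t * u\<^sub>1 t - t * r\<^sub>1 t + a / 2 * r\<^sub>2 t - q\<^sub>1 t) (at t)"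
      "\<And>t. (u\<^sub>2 has_real_derivative 2 * t * u\<^sub>2 t + a / (a\<^sup>2 + 2) * r\<^sub>1 t - t * r\<^sub>2 t - q\<^sub>2 t) (at t)"
    and q: "\<And>t. (q\<^sub>1 has_real_derivative 2 * t * q\<^sub>1 t + r\<^sub>1 t - w\<^sub>1 t) (at t)"
      "\<And>t. (q\<^sub>2 has_real_derivative 2 * t * q\<^sub>2 t + r\<^sub>2 t - w\<^sub>2 t) (at t)"
  defines "f \<equiv> \<lambda>t. X_fst a t (y\<^sub>1 t) (y\<^sub>1' t) (y\<^sub>2' t) (y\<^sub>1'' t) (y\<^sub>2'' t) * r\<^sub>1 t
      + X_snd a t (y\<^sub>2 t) (y\<^sub>1' t) (y\<^sub>2' t) (y\<^sub>1'' t) (y\<^sub>2'' t) * r\<^sub>2 t"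
  shows "exp_bounded f"
    "(LINT t|lborel. exp (- t\<^sup>2) * f t) = (LINT t|lborel. exp (- t\<^sup>2) * (y\<^sub>1 t * w\<^sub>1 t + y\<^sub>2 t * w\<^sub>2 t))"
proof -
  note exp_bounded_intros = exp_bounded_add exp_bounded_mult exp_bounded_diff exp_bounded_const exp_bounded_ident
    exp_bounded_power y_eb eb
  have c: "exp_bounded (\<lambda>t. g t / x)" if "exp_bounded g" for g and x :: real
    using exp_bounded_mult[OF that exp_bounded_const[of "1 / x"]] by simp
  show f: "exp_bounded f"
    unfolding f_def X_fst_def X_snd_def by (intro exp_bounded_intros c)
  let ?g = "\<lambda>t. y\<^sub>1 t * w\<^sub>1 t + y\<^sub>2 t * w\<^sub>2 t"
  have g: "exp_bounded ?g" by (intro exp_bounded_intros)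
  have "(LINT t|lborel. exp (- t\<^sup>2) * (f t - ?g t)) = 0"
  proof (rule integral_gauss_deriv_eq_0)
    let ?F = "\<lambda>t. y\<^sub>1 t * q\<^sub>1 t + y\<^sub>2 t * q\<^sub>2 t + y\<^sub>1' t * u\<^sub>1 t + y\<^sub>2' t * u\<^sub>2 t"
    show "exp_bounded ?F" by (intro exp_bounded_intros)
    show "exp_bounded (\<lambda>t. f t - ?g t)" by (rule exp_bounded_diff[OF f g])
    fix t
    show "((\<lambda>t. exp (- t\<^sup>2) * ?F t) has_real_derivative exp (- t\<^sup>2) * (f t - ?g t)) (at t)"
      apply (rule derivative_eq_intros y u q refl)+
      apply (simp add: f_def X_fst_def X_snd_def u_eq)
      apply (simp add: algebra_simps)
      done
  qed
  then show "(LINT t|lborel. exp (- t\<^sup>2) * f t) = (LINT t|lborel. exp (- t\<^sup>2) * ?g t)"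
    using exp_bounded_integrable[OF f] exp_bounded_integrable[OF g]
    by (simp only: right_diff_distrib Bochner_Integration.integral_diff)
qed

section \<open>The denominator of the weight and quotients by it\<close>

lemma \<pp>_ge: "\<pp> a t \<ge> 1"
proof -
  have "0 \<le> 4 * (a\<^sup>2 + 2) * t ^ 4" "0 \<le> 8 * t\<^sup>2" "0 \<le> a\<^sup>2" by auto
  then show ?thesis unfolding \<pp>_def by linarith
qed

lemma \<pp>_nz: "\<pp> a t \<noteq> 0" using \<pp>_ge[of a t] by linarith

lemma \<pp>_deriv: "(\<pp> a has_real_derivative 16 * (a\<^sup>2 + 2) * t ^ 3 + 16 * t) (at t)"
  unfolding \<pp>_def[abs_def] by (auto intro!: derivative_eq_intros)

lemma continuous_\<pp>: "continuous_on UNIV (\<pp> a)"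
  unfolding \<pp>_def[abs_def] by (intro continuous_intros)

lemma exp_bounded_divide_\<pp>:
  "exp_bounded f \<Longrightarrow> exp_bounded (\<lambda>t. f t / \<pp> a t)"
  by (rule exp_bounded_divide[OF _ continuous_\<pp> \<pp>_ge])

text \<open>The derivative is prescribed by an equation without denominators. With H' = 2K and K' =
  2tK - nH it becomes a polynomial identity in t and the values of H and K, which
  \<open>algebra\<close> can decide.\<close>

lemma deriv_hermite_Kr_\<pp>:
  assumes "(A has_real_derivative A') (at t)" "(B has_real_derivative B') (at t)"
    and "(hermite n t * (A' - n * B t) + Kr n t * (2 * A t + B' + 2 * t * B t)) * \<pp> a t
      - (hermite n t * A t + Kr n t * B t) * (16 * (a\<^sup>2 + 2) * t ^ 3 + 16 * t) = D * (\<pp> a t)\<^sup>2"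
  shows "((\<lambda>t. (hermite n t * A t + Kr n t * B t) / \<pp> a t) has_real_derivative D) (at t)"
proof -
  have "((\<lambda>t. (hermite n t * A t + Kr n t * B t) / \<pp> a t) has_real_derivative
     ((hermite n t * (A' - n * B t) + Kr n t * (2 * A t + B' + 2 * t * B t)) * \<pp> a t
      - (hermite n t * A t + Kr n t * B t) * (16 * (a\<^sup>2 + 2) * t ^ 3 + 16 * t)) / (\<pp> a t)\<^sup>2) (at t)"
    apply (rule derivative_eq_intros assms(1,2) \<pp>_deriv \<pp>_nz refl)+
    apply (simp add: algebra_simps power2_eq_square)
    done
  then show ?thesis unfolding assms(3) using \<pp>_nz[of a t] by simp
qed

text \<open>The shape suited to a factor e^{-t^2}: the term with 2t is compensated by the Gaussian,
  and \<open>G\<close> is the numerator of the rest.\<close>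

lemma deriv_divide_\<pp>:
  assumes "(A has_real_derivative A') (at t)" "(B has_real_derivative B') (at t)"
    and "(hermite n t * (A' - n * B t) + Kr n t * (2 * A t + B' + 2 * t * B t)) * \<pp> a t
      - (hermite n t * A t + Kr n t * B t) * (16 * (a\<^sup>2 + 2) * t ^ 3 + 16 * t)
      = 2 * t * (hermite n t * A t + Kr n t * B t) * \<pp> a t + G"
  shows "((\<lambda>t. (hermite n t * A t + Kr n t * B t) / \<pp> a t) has_real_derivative
    2 * t * ((hermite n t * A t + Kr n t * B t) / \<pp> a t) + G / (\<pp> a t)\<^sup>2) (at t)"
proof (rule deriv_hermite_Kr_\<pp>[OF assms(1,2)])
  show "(hermite n t * (A' - n * B t) + Kr n t * (2 * A t + B' + 2 * t * B t)) * \<pp> a t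
      - (hermite n t * A t + Kr n t * B t) * (16 * (a\<^sup>2 + 2) * t ^ 3 + 16 * t)
      = (2 * t * ((hermite n t * A t + Kr n t * B t) / \<pp> a t) + G / (\<pp> a t)\<^sup>2) * (\<pp> a t)\<^sup>2"
    unfolding assms(3) using \<pp>_nz[of a t] by (simp add: distrib_right power2_eq_square)
qed

lemma eq_div_square: "(P::real) \<noteq> 0 \<Longrightarrow> N * P = x * S + y * S' \<Longrightarrow> N / P = x * (S / P\<^sup>2) + y * (S' / P\<^sup>2)"
  by (simp add: field_simps power2_eq_square)

text \<open>Put \<open>c = 3a\<^sup>2 + 2\<close>, \<open>d = a\<^sup>2 + 2\<close>, and let \<open>X\<close> be the composed operator. In the following closed forms
  \<open>(r\<^sub>j\<^sub>1, r\<^sub>j\<^sub>2)\<close> is the column \<open>e\<^bsup>t\<^sup>2\<^esup> W X(P\<^sub>n)\<^sub>j\<^sup>T\<close> of the \<open>j\<close>-th row of \<open>X(P\<^sub>n)\<close>, scaled by \<open>8c\<^sup>2\<close> for \<open>j = 1\<close> and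
  by \<open>8cd\<close> for \<open>j = 2\<close>; \<open>u\<^sub>j = X\<^sub>2 r\<^sub>j\<close>; and \<open>q\<^sub>j\<close> is \<open>X\<^sub>1 r\<^sub>j - e\<^bsup>t\<^sup>2\<^esup> (e\<^bsup>-t\<^sup>2\<^esup> u\<^sub>j)'\<close>. They were obtained by computer
  algebra. That \<open>u\<^sub>j\<close> and \<open>q\<^sub>j\<close> only have a simple denominator \<open>\<pp>\<close> comes from the factorization of \<open>W\<close>
  in \<open>\<W>_eq\<close> below.\<close>

context
  fixes a :: real and n :: nat
begin

text \<open>Up to constants, \<open>e\<^sub>1\<close>, \<open>e\<^sub>2\<close> are the values of
  the two linear forms in \<open>gram\<close> on the first row of X(P_n), and
  \<open>e\<^sub>3\<close>, \<open>e\<^sub>1\<close> those on the second row; see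
  \<open>x_e\<close>.\<close>

definition e\<^sub>1 :: "real \<Rightarrow> real" where
  "e\<^sub>1 t = hermite n t * (- 4 * real n * t ^ 4 - 4 * (real n - 1) * t\<^sup>2 - (real n - 2)) + Kr n t * (8 * t ^ 5 - 2 * t)"

definition e\<^sub>2 :: "real \<Rightarrow> real" where
  "e\<^sub>2 t = hermite n t * (- 4 * (2 * a\<^sup>2 * real n - a\<^sup>2 + 2 * real n - 2) * t ^ 3 + 2 * (3 * a\<^sup>2 - 2 * real n + 6) * t)
     + Kr n t * (4 * (a\<^sup>2 * real n + a\<^sup>2 + 2 * real n - 2) * t ^ 4 - 4 * (3 * a\<^sup>2 - 2 * real n + 6) * t\<^sup>2
       + (3 * a\<^sup>2 + 2) * (real n - 1))"

definition e\<^sub>3 :: "real \<Rightarrow> real" where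
  "e\<^sub>3 t = hermite n t * (4 * (a\<^sup>2 + 2) * real n * t ^ 5 + (3 * a\<^sup>2 * real n - 2 * real n + 8) * t)
     + Kr n t * (- 8 * (a\<^sup>2 + 2) * t ^ 6 + 4 * (a\<^sup>2 + 2) * (real n - 1) * t ^ 4
       - 2 * (3 * a\<^sup>2 - 4 * real n + 10) * t\<^sup>2 + (3 * a\<^sup>2 + 2) * (real n - 1))"

text \<open>The values of the two forms recombined with the coefficients of these forms, as in
  \<open>gram\<close>, with common constants removed.\<close>

definition s\<^sub>1\<^sub>1 :: "real \<Rightarrow> real" where
  "s\<^sub>1\<^sub>1 t = (3 * a\<^sup>2 + 2) * (2 * t\<^sup>2 + 1) * e\<^sub>1 t + a\<^sup>2 * t * (2 * t\<^sup>2 + 3) * e\<^sub>2 t"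

definition s\<^sub>1\<^sub>2 :: "real \<Rightarrow> real" where
  "s\<^sub>1\<^sub>2 t = (3 * a\<^sup>2 + 2) * (4 * t * e\<^sub>1 t + (2 * t\<^sup>2 + 1) * e\<^sub>2 t)"

definition s\<^sub>2\<^sub>1 :: "real \<Rightarrow> real" where
  "s\<^sub>2\<^sub>1 t = (2 * t\<^sup>2 + 1) * e\<^sub>3 t + (a\<^sup>2 + 2) * t * (2 * t\<^sup>2 + 3) * e\<^sub>1 t"

definition s\<^sub>2\<^sub>2 :: "real \<Rightarrow> real" where
  "s\<^sub>2\<^sub>2 t = 4 * a\<^sup>2 * t * e\<^sub>3 t + (a\<^sup>2 + 2) * (3 * a\<^sup>2 + 2) * (2 * t\<^sup>2 + 1) * e\<^sub>1 t"

definition r\<^sub>1\<^sub>1 :: "real \<Rightarrow> real" where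
  "r\<^sub>1\<^sub>1 t = 4 * (a\<^sup>2 + 2) * (s\<^sub>1\<^sub>1 t / (\<pp> a t)\<^sup>2)"

definition r\<^sub>1\<^sub>2 :: "real \<Rightarrow> real" where
  "r\<^sub>1\<^sub>2 t = 4 * a * (s\<^sub>1\<^sub>2 t / (\<pp> a t)\<^sup>2)"

definition r\<^sub>2\<^sub>1 :: "real \<Rightarrow> real" where
  "r\<^sub>2\<^sub>1 t = 4 * a * (a\<^sup>2 + 2) * (s\<^sub>2\<^sub>1 t / (\<pp> a t)\<^sup>2)"

definition r\<^sub>2\<^sub>2 :: "real \<Rightarrow> real" where
  "r\<^sub>2\<^sub>2 t = 4 * (s\<^sub>2\<^sub>2 t / (\<pp> a t)\<^sup>2)"

definition u\<^sub>1\<^sub>1 :: "real \<Rightarrow> real" where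
  "u\<^sub>1\<^sub>1 t = (hermite n t * (- 4 * (a\<^sup>2 + 2) * (2 * a\<^sup>2 * real n - a\<^sup>2 + real n) * t ^ 4
         + 2 * (3 * a ^ 4 - 8 * a\<^sup>2 * real n + 12 * a\<^sup>2 - 4 * real n + 4) * t\<^sup>2 - (3 * a\<^sup>2 + 2) * (real n - 2))
     + Kr n t * (4 * (a\<^sup>2 + 2) * (a\<^sup>2 * real n + a\<^sup>2 + 2) * t ^ 5 - 4 * a\<^sup>2 * (3 * a\<^sup>2 - 2 * real n + 6) * t ^ 3
         + (3 * a\<^sup>2 + 2) * (a\<^sup>2 * real n - a\<^sup>2 - 2) * t)) / \<pp> a t"

definition u\<^sub>1\<^sub>2 :: "real \<Rightarrow> real" where
  "u\<^sub>1\<^sub>2 t = (hermite n t * (a * (- 4 * (2 * a\<^sup>2 * real n - a\<^sup>2 + 2 * real n - 2) * t ^ 3 + 2 * (3 * a\<^sup>2 - 2 * real n + 6) * t))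
     + Kr n t * (a * (4 * (a\<^sup>2 * real n + a\<^sup>2 + 2 * real n - 2) * t ^ 4 - 4 * (3 * a\<^sup>2 - 2 * real n + 6) * t\<^sup>2
       + (3 * a\<^sup>2 + 2) * (real n - 1)))) / \<pp> a t"

definition N\<^sub>1\<^sub>1 :: "real \<Rightarrow> real" where
  "N\<^sub>1\<^sub>1 t = hermite n t * (4 * a\<^sup>2 * (a\<^sup>2 + 2) * (real n - 1) * (real n - 2) * t ^ 5
         + 4 * (a ^ 4 * real n + a ^ 4 + 2 * a\<^sup>2 * (real n)\<^sup>2 - 4 * a\<^sup>2 * real n + 8 * a\<^sup>2 + 4) * t ^ 3
         + (3 * a ^ 4 * (real n)\<^sup>2 - 3 * a ^ 4 * real n + 2 * a\<^sup>2 * (real n)\<^sup>2 + 6 * a\<^sup>2 * real n - 4 * a\<^sup>2 + 8) * t)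
     + Kr n t * (4 * (a\<^sup>2 + 2) * (a\<^sup>2 * real n - 5 * a\<^sup>2 + 2 * real n - 6) * t ^ 4
         + 8 * (a\<^sup>2 + 2) * (real n - 2) * t\<^sup>2 + (a\<^sup>2 + 2) * (3 * a\<^sup>2 + 2) * (real n - 1))"

definition q\<^sub>1\<^sub>1 :: "real \<Rightarrow> real" where
  "q\<^sub>1\<^sub>1 t = N\<^sub>1\<^sub>1 t / \<pp> a t"

definition N\<^sub>1\<^sub>2 :: "real \<Rightarrow> real" where
  "N\<^sub>1\<^sub>2 t = hermite n t * (a * (4 * (a\<^sup>2 + 2) * (real n - 1) * (real n - 2) * t ^ 4
         + 4 * (3 * a\<^sup>2 * real n + 2 * (real n)\<^sup>2 - 4 * real n + 4) * t\<^sup>2 + (3 * a\<^sup>2 + 2) * (real n - 2) * (real n + 1)))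
     + Kr n t * (a * (3 * a\<^sup>2 + 2) * (4 * t - 8 * t ^ 3))"

definition q\<^sub>1\<^sub>2 :: "real \<Rightarrow> real" where
  "q\<^sub>1\<^sub>2 t = N\<^sub>1\<^sub>2 t / \<pp> a t"

definition u\<^sub>2\<^sub>1 :: "real \<Rightarrow> real" where
  "u\<^sub>2\<^sub>1 t = (hermite n t * (a * (- 4 * (a\<^sup>2 + 2) * (real n - 1) * t ^ 3 + 2 * (a\<^sup>2 * real n + a\<^sup>2 - 2 * real n + 6) * t))
     + Kr n t * (a * (4 * (a\<^sup>2 + 2) * (real n - 1) * t ^ 4 - 8 * (a\<^sup>2 - real n + 3) * t\<^sup>2
       + (3 * a\<^sup>2 + 2) * (real n - 1)))) / \<pp> a t"

definition u\<^sub>2\<^sub>2 :: "real \<Rightarrow> real" where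
  "u\<^sub>2\<^sub>2 t = (hermite n t * ((a\<^sup>2 + 2) * (- 4 * real n * t ^ 4 - 4 * (real n - 1) * t\<^sup>2 - (real n - 2)))
     + Kr n t * ((a\<^sup>2 + 2) * (8 * t ^ 5 - 2 * t))) / \<pp> a t"

definition N\<^sub>2\<^sub>1 :: "real \<Rightarrow> real" where
  "N\<^sub>2\<^sub>1 t = hermite n t * (a * (4 * (a\<^sup>2 + 2) * (real n - 1) * (real n - 2) * t ^ 4
         + 4 * (a\<^sup>2 * real n + 2 * (real n)\<^sup>2 - 4 * real n + 4) * t\<^sup>2 + (real n - 2) * (3 * a\<^sup>2 * real n - a\<^sup>2 + 2 * real n + 2)))
     + Kr n t * (a * (a\<^sup>2 + 2) * (4 * t - 8 * t ^ 3))"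

definition q\<^sub>2\<^sub>1 :: "real \<Rightarrow> real" where
  "q\<^sub>2\<^sub>1 t = N\<^sub>2\<^sub>1 t / \<pp> a t"

definition N\<^sub>2\<^sub>2 :: "real \<Rightarrow> real" where
  "N\<^sub>2\<^sub>2 t = hermite n t * (8 * (a\<^sup>2 + 2) * t ^ 3 + 4 * (2 * a\<^sup>2 * real n - a\<^sup>2 + 2) * t)
     + Kr n t * (8 * (a\<^sup>2 + 2) * (real n - 3) * t ^ 4 - 8 * (a\<^sup>2 - 2 * real n + 4) * t\<^sup>2
       + 2 * (3 * a\<^sup>2 + 2) * (real n - 1))"

definition q\<^sub>2\<^sub>2 :: "real \<Rightarrow> real" where
  "q\<^sub>2\<^sub>2 t = N\<^sub>2\<^sub>2 t / \<pp> a t"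

text \<open>With the next three: e^{t^2} W_a on the transposed rows of P_n, times 2(n - 1)(n - 2).
  This factor is \<lambda> = (n - 1)(n - 2) / (4c^2) for the first row, or (n - 1)(n - 2) / (4cd)
  for the second, times the scaling 8c^2 or 8cd.\<close>

definition w\<^sub>1\<^sub>1 :: "real \<Rightarrow> real" where
  "w\<^sub>1\<^sub>1 t = 2 * (real n - 1) * (real n - 2) * (hermite n t + a * t * (a * t * hermite n t - a * Kr n t))"

definition w\<^sub>1\<^sub>2 :: "real \<Rightarrow> real" where
  "w\<^sub>1\<^sub>2 t = 2 * (real n - 1) * (real n - 2) * (a * t * hermite n t - a * Kr n t)"

definition w\<^sub>2\<^sub>1 :: "real \<Rightarrow> real" where
  "w\<^sub>2\<^sub>1 t = 2 * (real n - 1) * (real n - 2) * (a * t * hermite n t - a * Kr n t)"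

definition w\<^sub>2\<^sub>2 :: "real \<Rightarrow> real" where
  "w\<^sub>2\<^sub>2 t = 2 * (real n - 1) * (real n - 2) * hermite n t"


text \<open>The weight begins with the inverse of X_2, and \<pp> = 16 d det X_2; multiplication by
  X_2 therefore removes one of the two factors \<pp>.\<close>

lemma u\<^sub>1\<^sub>1_eq: "u\<^sub>1\<^sub>1 t = (t\<^sup>2 / 2 + (3 * a\<^sup>2 + 2) / (4 * (a\<^sup>2 + 2))) * r\<^sub>1\<^sub>1 t - a * t / 2 * r\<^sub>1\<^sub>2 t"
proof -
  \<comment> \<open>Named quotients stay atomic, so that only the constant denominators are
    cleared.\<close>
  define x where "x = s\<^sub>1\<^sub>1 t / (\<pp> a t)\<^sup>2"
  define y where "y = s\<^sub>1\<^sub>2 t / (\<pp> a t)\<^sup>2"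
  have "u\<^sub>1\<^sub>1 t = (2 * (a\<^sup>2 + 2) * t\<^sup>2 + (3 * a\<^sup>2 + 2)) * (s\<^sub>1\<^sub>1 t / (\<pp> a t)\<^sup>2) + (- 2 * a\<^sup>2 * t) * (s\<^sub>1\<^sub>2 t / (\<pp> a t)\<^sup>2)"
    unfolding u\<^sub>1\<^sub>1_def
    apply (rule eq_div_square[OF \<pp>_nz])
    unfolding \<pp>_def s\<^sub>1\<^sub>1_def s\<^sub>1\<^sub>2_def e\<^sub>1_def e\<^sub>2_def
    by algebra
  also have "\<dots> = (t\<^sup>2 / 2 + (3 * a\<^sup>2 + 2) / (4 * (a\<^sup>2 + 2))) * r\<^sub>1\<^sub>1 t - a * t / 2 * r\<^sub>1\<^sub>2 t"
    unfolding r\<^sub>1\<^sub>1_def r\<^sub>1\<^sub>2_def x_def[symmetric] y_def[symmetric] using nz_consts(1)[of a]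
    by (simp add: divide_simps) (simp add: algebra_simps power2_eq_square)?
  finally show ?thesis .
qed

lemma u\<^sub>1\<^sub>1_deriv: "(u\<^sub>1\<^sub>1 has_real_derivative 2 * t * u\<^sub>1\<^sub>1 t - t * r\<^sub>1\<^sub>1 t + a / 2 * r\<^sub>1\<^sub>2 t - q\<^sub>1\<^sub>1 t) (at t)"
proof -
  define x where "x = s\<^sub>1\<^sub>1 t / (\<pp> a t)\<^sup>2"
  define y where "y = s\<^sub>1\<^sub>2 t / (\<pp> a t)\<^sup>2"
  \<comment> \<open>\<pp>^2 times the first component of X_1 r - q.\<close>
  define G where "G = (- (4 * (a\<^sup>2 + 2)) * t) * s\<^sub>1\<^sub>1 t + (2 * a\<^sup>2) * s\<^sub>1\<^sub>2 t - N\<^sub>1\<^sub>1 t * \<pp> a t"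
  have D: "(u\<^sub>1\<^sub>1 has_real_derivative 2 * t * u\<^sub>1\<^sub>1 t + G / (\<pp> a t)\<^sup>2) (at t)"
    unfolding u\<^sub>1\<^sub>1_def[abs_def]
    apply (rule deriv_divide_\<pp>)
      apply (rule derivative_eq_intros refl)+
    unfolding G_def \<pp>_def s\<^sub>1\<^sub>1_def s\<^sub>1\<^sub>2_def e\<^sub>1_def e\<^sub>2_def N\<^sub>1\<^sub>1_def
    apply simp
    apply algebra
    done
  have "G / (\<pp> a t)\<^sup>2 = (- (4 * (a\<^sup>2 + 2)) * t) * (s\<^sub>1\<^sub>1 t / (\<pp> a t)\<^sup>2) + (2 * a\<^sup>2) * (s\<^sub>1\<^sub>2 t / (\<pp> a t)\<^sup>2) - q\<^sub>1\<^sub>1 t"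
    unfolding G_def q\<^sub>1\<^sub>1_def using \<pp>_nz[of a t]
    by (simp add: add_divide_distrib diff_divide_distrib power2_eq_square)
  also have "\<dots> = - t * r\<^sub>1\<^sub>1 t + a / 2 * r\<^sub>1\<^sub>2 t - q\<^sub>1\<^sub>1 t"
    unfolding r\<^sub>1\<^sub>1_def r\<^sub>1\<^sub>2_def x_def[symmetric] y_def[symmetric] using nz_consts(1)[of a]
    by (simp add: divide_simps) (simp add: algebra_simps power2_eq_square)?
  finally have E: "G / (\<pp> a t)\<^sup>2 = - t * r\<^sub>1\<^sub>1 t + a / 2 * r\<^sub>1\<^sub>2 t - q\<^sub>1\<^sub>1 t" .
  show ?thesis by (rule DERIV_cong[OF D], unfold E, simp)
qed

text \<open>This is the eigenvalue equation, first row and first component. The equation for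
  \<open>u\<^sub>1\<^sub>1\<close> merely expresses how Q is formed; here \<lambda> enters, through
  \<open>w\<^sub>1\<^sub>1\<close>.\<close>

lemma q\<^sub>1\<^sub>1_deriv: "(q\<^sub>1\<^sub>1 has_real_derivative 2 * t * q\<^sub>1\<^sub>1 t + r\<^sub>1\<^sub>1 t - w\<^sub>1\<^sub>1 t) (at t)"
proof -
  define G where "G = 4 * (a\<^sup>2 + 2) * s\<^sub>1\<^sub>1 t - w\<^sub>1\<^sub>1 t * (\<pp> a t)\<^sup>2"
  have D: "(q\<^sub>1\<^sub>1 has_real_derivative 2 * t * q\<^sub>1\<^sub>1 t + G / (\<pp> a t)\<^sup>2) (at t)"
    unfolding q\<^sub>1\<^sub>1_def[abs_def] N\<^sub>1\<^sub>1_def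
    apply (rule deriv_divide_\<pp>)
      apply (rule derivative_eq_intros refl)+
    unfolding G_def \<pp>_def s\<^sub>1\<^sub>1_def s\<^sub>1\<^sub>2_def e\<^sub>1_def e\<^sub>2_def w\<^sub>1\<^sub>1_def
    apply simp
    apply algebra
    done
  have "G / (\<pp> a t)\<^sup>2 = r\<^sub>1\<^sub>1 t - w\<^sub>1\<^sub>1 t"
    unfolding G_def r\<^sub>1\<^sub>1_def using \<pp>_nz[of a t] by (simp add: diff_divide_distrib)
  then show ?thesis by (intro DERIV_cong[OF D]) simp
qed

lemma u\<^sub>1\<^sub>2_eq: "u\<^sub>1\<^sub>2 t = (t\<^sup>2 / 2 + 1 / 4) * r\<^sub>1\<^sub>2 t - a * t / (a\<^sup>2 + 2) * r\<^sub>1\<^sub>1 t"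
proof -
  define x where "x = s\<^sub>1\<^sub>1 t / (\<pp> a t)\<^sup>2"
  define y where "y = s\<^sub>1\<^sub>2 t / (\<pp> a t)\<^sup>2"
  have "u\<^sub>1\<^sub>2 t = (- 4 * a * t) * (s\<^sub>1\<^sub>1 t / (\<pp> a t)\<^sup>2) + (a * (2 * t\<^sup>2 + 1)) * (s\<^sub>1\<^sub>2 t / (\<pp> a t)\<^sup>2)"
    unfolding u\<^sub>1\<^sub>2_def
    apply (rule eq_div_square[OF \<pp>_nz])
    unfolding \<pp>_def s\<^sub>1\<^sub>1_def s\<^sub>1\<^sub>2_def e\<^sub>1_def e\<^sub>2_def
    by algebra
  also have "\<dots> = (t\<^sup>2 / 2 + 1 / 4) * r\<^sub>1\<^sub>2 t - a * t / (a\<^sup>2 + 2) * r\<^sub>1\<^sub>1 t"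
    unfolding r\<^sub>1\<^sub>1_def r\<^sub>1\<^sub>2_def x_def[symmetric] y_def[symmetric] using nz_consts(1)[of a]
    by (simp add: divide_simps) (simp add: algebra_simps power2_eq_square)?
  finally show ?thesis .
qed

lemma u\<^sub>1\<^sub>2_deriv: "(u\<^sub>1\<^sub>2 has_real_derivative 2 * t * u\<^sub>1\<^sub>2 t + a / (a\<^sup>2 + 2) * r\<^sub>1\<^sub>1 t - t * r\<^sub>1\<^sub>2 t - q\<^sub>1\<^sub>2 t) (at t)"
proof -
  define x where "x = s\<^sub>1\<^sub>1 t / (\<pp> a t)\<^sup>2"
  define y where "y = s\<^sub>1\<^sub>2 t / (\<pp> a t)\<^sup>2"
  define G where "G = (4 * a) * s\<^sub>1\<^sub>1 t + (- 4 * a * t) * s\<^sub>1\<^sub>2 t - N\<^sub>1\<^sub>2 t * \<pp> a t"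
  have D: "(u\<^sub>1\<^sub>2 has_real_derivative 2 * t * u\<^sub>1\<^sub>2 t + G / (\<pp> a t)\<^sup>2) (at t)"
    unfolding u\<^sub>1\<^sub>2_def[abs_def]
    apply (rule deriv_divide_\<pp>)
      apply (rule derivative_eq_intros refl)+
    unfolding G_def \<pp>_def s\<^sub>1\<^sub>1_def s\<^sub>1\<^sub>2_def e\<^sub>1_def e\<^sub>2_def N\<^sub>1\<^sub>2_def
    apply simp
    apply algebra
    done
  have "G / (\<pp> a t)\<^sup>2 = (4 * a) * (s\<^sub>1\<^sub>1 t / (\<pp> a t)\<^sup>2) + (- 4 * a * t) * (s\<^sub>1\<^sub>2 t / (\<pp> a t)\<^sup>2) - q\<^sub>1\<^sub>2 t"
    unfolding G_def q\<^sub>1\<^sub>2_def using \<pp>_nz[of a t]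
    by (simp add: add_divide_distrib diff_divide_distrib power2_eq_square)
  also have "\<dots> = a / (a\<^sup>2 + 2) * r\<^sub>1\<^sub>1 t - t * r\<^sub>1\<^sub>2 t - q\<^sub>1\<^sub>2 t"
    unfolding r\<^sub>1\<^sub>1_def r\<^sub>1\<^sub>2_def x_def[symmetric] y_def[symmetric] using nz_consts(1)[of a]
    by (simp add: divide_simps) (simp add: algebra_simps power2_eq_square)?
  finally have E: "G / (\<pp> a t)\<^sup>2 = a / (a\<^sup>2 + 2) * r\<^sub>1\<^sub>1 t - t * r\<^sub>1\<^sub>2 t - q\<^sub>1\<^sub>2 t" .
  show ?thesis by (rule DERIV_cong[OF D], unfold E, simp)
qed

lemma q\<^sub>1\<^sub>2_deriv: "(q\<^sub>1\<^sub>2 has_real_derivative 2 * t * q\<^sub>1\<^sub>2 t + r\<^sub>1\<^sub>2 t - w\<^sub>1\<^sub>2 t) (at t)"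
proof -
  define G where "G = 4 * a * s\<^sub>1\<^sub>2 t - w\<^sub>1\<^sub>2 t * (\<pp> a t)\<^sup>2"
  have D: "(q\<^sub>1\<^sub>2 has_real_derivative 2 * t * q\<^sub>1\<^sub>2 t + G / (\<pp> a t)\<^sup>2) (at t)"
    unfolding q\<^sub>1\<^sub>2_def[abs_def] N\<^sub>1\<^sub>2_def
    apply (rule deriv_divide_\<pp>)
      apply (rule derivative_eq_intros refl)+
    unfolding G_def \<pp>_def s\<^sub>1\<^sub>1_def s\<^sub>1\<^sub>2_def e\<^sub>1_def e\<^sub>2_def w\<^sub>1\<^sub>2_def
    apply simp
    apply algebra
    done
  have "G / (\<pp> a t)\<^sup>2 = r\<^sub>1\<^sub>2 t - w\<^sub>1\<^sub>2 t"
    unfolding G_def r\<^sub>1\<^sub>2_def using \<pp>_nz[of a t] by (simp add: diff_divide_distrib)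
  then show ?thesis by (intro DERIV_cong[OF D]) simp
qed

lemma u\<^sub>2\<^sub>1_eq: "u\<^sub>2\<^sub>1 t = (t\<^sup>2 / 2 + (3 * a\<^sup>2 + 2) / (4 * (a\<^sup>2 + 2))) * r\<^sub>2\<^sub>1 t - a * t / 2 * r\<^sub>2\<^sub>2 t"
proof -
  define x where "x = s\<^sub>2\<^sub>1 t / (\<pp> a t)\<^sup>2"
  define y where "y = s\<^sub>2\<^sub>2 t / (\<pp> a t)\<^sup>2"
  have "u\<^sub>2\<^sub>1 t = (a * (2 * (a\<^sup>2 + 2) * t\<^sup>2 + (3 * a\<^sup>2 + 2))) * (s\<^sub>2\<^sub>1 t / (\<pp> a t)\<^sup>2) + (- 2 * a * t) * (s\<^sub>2\<^sub>2 t / (\<pp> a t)\<^sup>2)"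
    unfolding u\<^sub>2\<^sub>1_def
    apply (rule eq_div_square[OF \<pp>_nz])
    unfolding \<pp>_def s\<^sub>2\<^sub>1_def s\<^sub>2\<^sub>2_def e\<^sub>1_def e\<^sub>3_def
    by algebra
  also have "\<dots> = (t\<^sup>2 / 2 + (3 * a\<^sup>2 + 2) / (4 * (a\<^sup>2 + 2))) * r\<^sub>2\<^sub>1 t - a * t / 2 * r\<^sub>2\<^sub>2 t"
    unfolding r\<^sub>2\<^sub>1_def r\<^sub>2\<^sub>2_def x_def[symmetric] y_def[symmetric] using nz_consts(1)[of a]
    by (simp add: divide_simps) (simp add: algebra_simps power2_eq_square)?
  finally show ?thesis .
qed

lemma u\<^sub>2\<^sub>1_deriv: "(u\<^sub>2\<^sub>1 has_real_derivative 2 * t * u\<^sub>2\<^sub>1 t - t * r\<^sub>2\<^sub>1 t + a / 2 * r\<^sub>2\<^sub>2 t - q\<^sub>2\<^sub>1 t) (at t)"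
proof -
  define x where "x = s\<^sub>2\<^sub>1 t / (\<pp> a t)\<^sup>2"
  define y where "y = s\<^sub>2\<^sub>2 t / (\<pp> a t)\<^sup>2"
  define G where "G = (- (4 * a * (a\<^sup>2 + 2)) * t) * s\<^sub>2\<^sub>1 t + (2 * a) * s\<^sub>2\<^sub>2 t - N\<^sub>2\<^sub>1 t * \<pp> a t"
  have D: "(u\<^sub>2\<^sub>1 has_real_derivative 2 * t * u\<^sub>2\<^sub>1 t + G / (\<pp> a t)\<^sup>2) (at t)"
    unfolding u\<^sub>2\<^sub>1_def[abs_def]
    apply (rule deriv_divide_\<pp>)
      apply (rule derivative_eq_intros refl)+
    unfolding G_def \<pp>_def s\<^sub>2\<^sub>1_def s\<^sub>2\<^sub>2_def e\<^sub>1_def e\<^sub>3_def N\<^sub>2\<^sub>1_def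
    apply simp
    apply algebra
    done
  have "G / (\<pp> a t)\<^sup>2 = (- (4 * a * (a\<^sup>2 + 2)) * t) * (s\<^sub>2\<^sub>1 t / (\<pp> a t)\<^sup>2) + (2 * a) * (s\<^sub>2\<^sub>2 t / (\<pp> a t)\<^sup>2) - q\<^sub>2\<^sub>1 t"
    unfolding G_def q\<^sub>2\<^sub>1_def using \<pp>_nz[of a t]
    by (simp add: add_divide_distrib diff_divide_distrib power2_eq_square)
  also have "\<dots> = - t * r\<^sub>2\<^sub>1 t + a / 2 * r\<^sub>2\<^sub>2 t - q\<^sub>2\<^sub>1 t"
    unfolding r\<^sub>2\<^sub>1_def r\<^sub>2\<^sub>2_def x_def[symmetric] y_def[symmetric] using nz_consts(1)[of a]
    by (simp add: divide_simps) (simp add: algebra_simps power2_eq_square)?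
  finally have E: "G / (\<pp> a t)\<^sup>2 = - t * r\<^sub>2\<^sub>1 t + a / 2 * r\<^sub>2\<^sub>2 t - q\<^sub>2\<^sub>1 t" .
  show ?thesis by (rule DERIV_cong[OF D], unfold E, simp)
qed

lemma q\<^sub>2\<^sub>1_deriv: "(q\<^sub>2\<^sub>1 has_real_derivative 2 * t * q\<^sub>2\<^sub>1 t + r\<^sub>2\<^sub>1 t - w\<^sub>2\<^sub>1 t) (at t)"
proof -
  define G where "G = 4 * a * (a\<^sup>2 + 2) * s\<^sub>2\<^sub>1 t - w\<^sub>2\<^sub>1 t * (\<pp> a t)\<^sup>2"
  have D: "(q\<^sub>2\<^sub>1 has_real_derivative 2 * t * q\<^sub>2\<^sub>1 t + G / (\<pp> a t)\<^sup>2) (at t)"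
    unfolding q\<^sub>2\<^sub>1_def[abs_def] N\<^sub>2\<^sub>1_def
    apply (rule deriv_divide_\<pp>)
      apply (rule derivative_eq_intros refl)+
    unfolding G_def \<pp>_def s\<^sub>2\<^sub>1_def s\<^sub>2\<^sub>2_def e\<^sub>1_def e\<^sub>3_def w\<^sub>2\<^sub>1_def
    apply simp
    apply algebra
    done
  have "G / (\<pp> a t)\<^sup>2 = r\<^sub>2\<^sub>1 t - w\<^sub>2\<^sub>1 t"
    unfolding G_def r\<^sub>2\<^sub>1_def using \<pp>_nz[of a t] by (simp add: diff_divide_distrib)
  then show ?thesis by (intro DERIV_cong[OF D]) simp
qed

lemma u\<^sub>2\<^sub>2_eq: "u\<^sub>2\<^sub>2 t = (t\<^sup>2 / 2 + 1 / 4) * r\<^sub>2\<^sub>2 t - a * t / (a\<^sup>2 + 2) * r\<^sub>2\<^sub>1 t"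
proof -
  define x where "x = s\<^sub>2\<^sub>1 t / (\<pp> a t)\<^sup>2"
  define y where "y = s\<^sub>2\<^sub>2 t / (\<pp> a t)\<^sup>2"
  have "u\<^sub>2\<^sub>2 t = (- 4 * a\<^sup>2 * t) * (s\<^sub>2\<^sub>1 t / (\<pp> a t)\<^sup>2) + (2 * t\<^sup>2 + 1) * (s\<^sub>2\<^sub>2 t / (\<pp> a t)\<^sup>2)"
    unfolding u\<^sub>2\<^sub>2_def
    apply (rule eq_div_square[OF \<pp>_nz])
    unfolding \<pp>_def s\<^sub>2\<^sub>1_def s\<^sub>2\<^sub>2_def e\<^sub>1_def e\<^sub>3_def
    by algebra
  also have "\<dots> = (t\<^sup>2 / 2 + 1 / 4) * r\<^sub>2\<^sub>2 t - a * t / (a\<^sup>2 + 2) * r\<^sub>2\<^sub>1 t"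
    unfolding r\<^sub>2\<^sub>1_def r\<^sub>2\<^sub>2_def x_def[symmetric] y_def[symmetric] using nz_consts(1)[of a]
    by (simp add: divide_simps) (simp add: algebra_simps power2_eq_square)?
  finally show ?thesis .
qed

lemma u\<^sub>2\<^sub>2_deriv: "(u\<^sub>2\<^sub>2 has_real_derivative 2 * t * u\<^sub>2\<^sub>2 t + a / (a\<^sup>2 + 2) * r\<^sub>2\<^sub>1 t - t * r\<^sub>2\<^sub>2 t - q\<^sub>2\<^sub>2 t) (at t)"
proof -
  define x where "x = s\<^sub>2\<^sub>1 t / (\<pp> a t)\<^sup>2"
  define y where "y = s\<^sub>2\<^sub>2 t / (\<pp> a t)\<^sup>2"
  define G where "G = (4 * a\<^sup>2) * s\<^sub>2\<^sub>1 t + (- 4 * t) * s\<^sub>2\<^sub>2 t - N\<^sub>2\<^sub>2 t * \<pp> a t"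
  have D: "(u\<^sub>2\<^sub>2 has_real_derivative 2 * t * u\<^sub>2\<^sub>2 t + G / (\<pp> a t)\<^sup>2) (at t)"
    unfolding u\<^sub>2\<^sub>2_def[abs_def]
    apply (rule deriv_divide_\<pp>)
      apply (rule derivative_eq_intros refl)+
    unfolding G_def \<pp>_def s\<^sub>2\<^sub>1_def s\<^sub>2\<^sub>2_def e\<^sub>1_def e\<^sub>3_def N\<^sub>2\<^sub>2_def
    apply simp
    apply algebra
    done
  have "G / (\<pp> a t)\<^sup>2 = (4 * a\<^sup>2) * (s\<^sub>2\<^sub>1 t / (\<pp> a t)\<^sup>2) + (- 4 * t) * (s\<^sub>2\<^sub>2 t / (\<pp> a t)\<^sup>2) - q\<^sub>2\<^sub>2 t"
    unfolding G_def q\<^sub>2\<^sub>2_def using \<pp>_nz[of a t]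
    by (simp add: add_divide_distrib diff_divide_distrib power2_eq_square)
  also have "\<dots> = a / (a\<^sup>2 + 2) * r\<^sub>2\<^sub>1 t - t * r\<^sub>2\<^sub>2 t - q\<^sub>2\<^sub>2 t"
    unfolding r\<^sub>2\<^sub>1_def r\<^sub>2\<^sub>2_def x_def[symmetric] y_def[symmetric] using nz_consts(1)[of a]
    by (simp add: divide_simps) (simp add: algebra_simps power2_eq_square)?
  finally have E: "G / (\<pp> a t)\<^sup>2 = a / (a\<^sup>2 + 2) * r\<^sub>2\<^sub>1 t - t * r\<^sub>2\<^sub>2 t - q\<^sub>2\<^sub>2 t" .
  show ?thesis by (rule DERIV_cong[OF D], unfold E, simp)
qed

lemma q\<^sub>2\<^sub>2_deriv: "(q\<^sub>2\<^sub>2 has_real_derivative 2 * t * q\<^sub>2\<^sub>2 t + r\<^sub>2\<^sub>2 t - w\<^sub>2\<^sub>2 t) (at t)"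
proof -
  define G where "G = 4 * s\<^sub>2\<^sub>2 t - w\<^sub>2\<^sub>2 t * (\<pp> a t)\<^sup>2"
  have D: "(q\<^sub>2\<^sub>2 has_real_derivative 2 * t * q\<^sub>2\<^sub>2 t + G / (\<pp> a t)\<^sup>2) (at t)"
    unfolding q\<^sub>2\<^sub>2_def[abs_def] N\<^sub>2\<^sub>2_def
    apply (rule deriv_divide_\<pp>)
      apply (rule derivative_eq_intros refl)+
    unfolding G_def \<pp>_def s\<^sub>2\<^sub>1_def s\<^sub>2\<^sub>2_def e\<^sub>1_def e\<^sub>3_def w\<^sub>2\<^sub>2_def
    apply simp
    apply algebra
    done
  have "G / (\<pp> a t)\<^sup>2 = r\<^sub>2\<^sub>2 t - w\<^sub>2\<^sub>2 t"
    unfolding G_def r\<^sub>2\<^sub>2_def using \<pp>_nz[of a t] by (simp add: diff_divide_distrib)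
  then show ?thesis by (intro DERIV_cong[OF D]) simp
qed

end

section \<open>Orthogonality\<close>

definition Kr' :: "nat \<Rightarrow> real \<Rightarrow> real" where
  "Kr' n t = 2 * t * Kr n t - real n * hermite n t"

definition Kr'' :: "nat \<Rightarrow> real \<Rightarrow> real" where
  "Kr'' n t = 2 * Kr n t + 2 * t * Kr' n t - 2 * real n * Kr n t"

lemma Kr_deriv': "(Kr n has_real_derivative Kr' n t) (at t)"
  unfolding Kr'_def by (rule Kr_deriv)

lemma Kr'_deriv: "(Kr' n has_real_derivative Kr'' n t) (at t)"
proof -
  have "((\<lambda>t. 2 * t * Kr n t - real n * hermite n t) has_real_derivative Kr'' n t) (at t)"
    by (rule derivative_eq_intros refl)+ (simp add: Kr''_def Kr'_def algebra_simps)
  then show ?thesis by (simp add: Kr'_def[abs_def])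
qed

lemma exp_bounded_Kr' [intro, simp]: "exp_bounded (Kr' n)"
  unfolding Kr'_def[abs_def]
  by (intro exp_bounded_diff exp_bounded_mult exp_bounded_const exp_bounded_ident exp_bounded_hermite exp_bounded_Kr)

lemma exp_bounded_Kr'' [intro, simp]: "exp_bounded (Kr'' n)"
  unfolding Kr''_def[abs_def]
  by (intro exp_bounded_add exp_bounded_diff exp_bounded_mult exp_bounded_const exp_bounded_ident exp_bounded_Kr exp_bounded_Kr')

lemma P\<^sub>a_eq: "P\<^sub>a a n t = rmat2 (hermite n t) (- a * Kr n t) (- a * Kr n t) (hermite n t + a\<^sup>2 * t * Kr n t)"
  by (simp add: P\<^sub>a_def Kr_def rmat2_arith rmat2_eq_iff)

definition P\<^sub>a' :: "real \<Rightarrow> nat \<Rightarrow> real \<Rightarrow> cmat" where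
  "P\<^sub>a' a n t = rmat2 (2 * Kr n t) (- a * Kr' n t) (- a * Kr' n t) (2 * Kr n t + a\<^sup>2 * (Kr n t + t * Kr' n t))"

definition P\<^sub>a'' :: "real \<Rightarrow> nat \<Rightarrow> real \<Rightarrow> cmat" where
  "P\<^sub>a'' a n t = rmat2 (2 * Kr' n t) (- a * Kr'' n t) (- a * Kr'' n t) (2 * Kr' n t + a\<^sup>2 * (2 * Kr' n t + t * Kr'' n t))"

lemma y\<^sub>2\<^sub>2_deriv:
  "((\<lambda>t. hermite n t + a\<^sup>2 * t * Kr n t) has_real_derivative 2 * Kr n t + a\<^sup>2 * (Kr n t + t * Kr' n t)) (at t)"
  by (rule derivative_eq_intros Kr_deriv' refl)+ (simp add: algebra_simps)

lemma y\<^sub>2\<^sub>2_deriv':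
  "((\<lambda>t. 2 * Kr n t + a\<^sup>2 * (Kr n t + t * Kr' n t)) has_real_derivative 2 * Kr' n t + a\<^sup>2 * (2 * Kr' n t + t * Kr'' n t)) (at t)"
  by (rule derivative_eq_intros Kr_deriv' Kr'_deriv refl)+ (simp add: algebra_simps)

lemma P\<^sub>a_deriv: "(P\<^sub>a a n has_vector_derivative P\<^sub>a' a n t) (at t)"
  unfolding P\<^sub>a_eq[abs_def] P\<^sub>a'_def
  by (intro has_vector_derivative_rmat2 hermite_deriv y\<^sub>2\<^sub>2_deriv DERIV_cmult Kr_deriv')

lemma P\<^sub>a'_deriv: "(P\<^sub>a' a n has_vector_derivative P\<^sub>a'' a n t) (at t)"
  unfolding P\<^sub>a'_def[abs_def] P\<^sub>a''_def
  by (intro has_vector_derivative_rmat2 y\<^sub>2\<^sub>2_deriv' DERIV_cmult Kr'_deriv Kr_deriv')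

context
  fixes a :: real and n :: nat
begin

definition x\<^sub>1\<^sub>1 :: "real \<Rightarrow> real" where
  "x\<^sub>1\<^sub>1 t = X_fst a t (hermite n t) (2 * Kr n t) (- a * Kr' n t) (2 * Kr' n t) (- a * Kr'' n t)"
definition x\<^sub>1\<^sub>2 :: "real \<Rightarrow> real" where
  "x\<^sub>1\<^sub>2 t = X_snd a t (- a * Kr n t) (2 * Kr n t) (- a * Kr' n t) (2 * Kr' n t) (- a * Kr'' n t)"
definition x\<^sub>2\<^sub>1 :: "real \<Rightarrow> real" where
  "x\<^sub>2\<^sub>1 t = X_fst a t (- a * Kr n t) (- a * Kr' n t) (2 * Kr n t + a\<^sup>2 * (Kr n t + t * Kr' n t))
    (- a * Kr'' n t) (2 * Kr' n t + a\<^sup>2 * (2 * Kr' n t + t * Kr'' n t))"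
definition x\<^sub>2\<^sub>2 :: "real \<Rightarrow> real" where
  "x\<^sub>2\<^sub>2 t = X_snd a t (hermite n t + a\<^sup>2 * t * Kr n t) (- a * Kr' n t) (2 * Kr n t + a\<^sup>2 * (Kr n t + t * Kr' n t))
    (- a * Kr'' n t) (2 * Kr' n t + a\<^sup>2 * (2 * Kr' n t + t * Kr'' n t))"

lemma Xop_P\<^sub>a: "Xop a (P\<^sub>a a n) t = rmat2 (x\<^sub>1\<^sub>1 t) (x\<^sub>1\<^sub>2 t) (x\<^sub>2\<^sub>1 t) (x\<^sub>2\<^sub>2 t)"
  unfolding x\<^sub>1\<^sub>1_def x\<^sub>1\<^sub>2_def x\<^sub>2\<^sub>1_def x\<^sub>2\<^sub>2_def
  by (rule Xop_rmat2[OF P\<^sub>a_deriv P\<^sub>a'_deriv P\<^sub>a_eq P\<^sub>a'_def P\<^sub>a''_def])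

lemma four_d_X:
  "4 * (a\<^sup>2 + 2) * X_fst a t y\<^sub>1 y\<^sub>1' y\<^sub>2' y\<^sub>1'' y\<^sub>2'' = 4 * (a\<^sup>2 + 2) * y\<^sub>1 - 4 * (a\<^sup>2 + 2) * t * y\<^sub>1' + 4 * a * y\<^sub>2'
     + (2 * (a\<^sup>2 + 2) * t\<^sup>2 + (3 * a\<^sup>2 + 2)) * y\<^sub>1'' - 4 * a * t * y\<^sub>2''"
  "4 * X_snd a t y\<^sub>2 y\<^sub>1' y\<^sub>2' y\<^sub>1'' y\<^sub>2'' = 4 * y\<^sub>2 + 2 * a * y\<^sub>1' - 4 * t * y\<^sub>2' - 2 * a * t * y\<^sub>1''
     + (2 * t\<^sup>2 + 1) * y\<^sub>2''"
proof -
  \<comment> \<open>With arbitrary c and d, clearing denominators does not expand the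
    constants.\<close>
  have "4 * d * (y\<^sub>1 - t * y\<^sub>1' + a / d * y\<^sub>2' + (t\<^sup>2 / 2 + c / (4 * d)) * y\<^sub>1'' - a * t / d * y\<^sub>2'') =
      4 * d * y\<^sub>1 - 4 * d * t * y\<^sub>1' + 4 * a * y\<^sub>2' + (2 * d * t\<^sup>2 + c) * y\<^sub>1'' - 4 * a * t * y\<^sub>2''"
    if "d \<noteq> 0" for c d :: real
    using that by (simp add: field_simps)
  from this[OF nz_consts(1)] show "4 * (a\<^sup>2 + 2) * X_fst a t y\<^sub>1 y\<^sub>1' y\<^sub>2' y\<^sub>1'' y\<^sub>2'' = 4 * (a\<^sup>2 + 2) * y\<^sub>1
     - 4 * (a\<^sup>2 + 2) * t * y\<^sub>1' + 4 * a * y\<^sub>2' + (2 * (a\<^sup>2 + 2) * t\<^sup>2 + (3 * a\<^sup>2 + 2)) * y\<^sub>1'' - 4 * a * t * y\<^sub>2''"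
    unfolding X_fst_def .
qed (simp add: X_snd_def algebra_simps)

text \<open>Only these combinations of the entries of X(P_n) enter the weight. The factor 4 in the
  proof, together with \<open>a\<^sup>2 + 2\<close>, clears the denominators of X; the second
  derivatives are reduced by Hermite's equation, built into \<open>Kr'\<close> and
  \<open>Kr''\<close>.\<close>

lemma x_e:
  "(a\<^sup>2 + 2) * (2 * t\<^sup>2 + 1) * x\<^sub>1\<^sub>1 t + 4 * a * t * x\<^sub>1\<^sub>2 t = (a\<^sup>2 + 2) / 2 * e\<^sub>1 n t"
  "a * t * (a\<^sup>2 + 2) * (2 * t\<^sup>2 + 3) * x\<^sub>1\<^sub>1 t + (3 * a\<^sup>2 + 2) * (2 * t\<^sup>2 + 1) * x\<^sub>1\<^sub>2 t = a / 2 * e\<^sub>2 a n t"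
  "(a\<^sup>2 + 2) * (2 * t\<^sup>2 + 1) * x\<^sub>2\<^sub>1 t + 4 * a * t * x\<^sub>2\<^sub>2 t = a / 2 * e\<^sub>3 a n t"
  "a * t * (a\<^sup>2 + 2) * (2 * t\<^sup>2 + 3) * x\<^sub>2\<^sub>1 t + (3 * a\<^sup>2 + 2) * (2 * t\<^sup>2 + 1) * x\<^sub>2\<^sub>2 t = (3 * a\<^sup>2 + 2) / 2 * e\<^sub>1 n t"
proof -
  note defs = e\<^sub>1_def e\<^sub>2_def e\<^sub>3_def Kr''_def Kr'_def
  note X1 = four_d_X(1)[of t "hermite n t" "2 * Kr n t" "- a * Kr' n t" "2 * Kr' n t" "- a * Kr'' n t", folded x\<^sub>1\<^sub>1_def]
  note X2 = four_d_X(2)[of t "- a * Kr n t" "2 * Kr n t" "- a * Kr' n t" "2 * Kr' n t" "- a * Kr'' n t", folded x\<^sub>1\<^sub>2_def]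
  note X3 = four_d_X(1)[of t "- a * Kr n t" "- a * Kr' n t" "2 * Kr n t + a\<^sup>2 * (Kr n t + t * Kr' n t)"
    "- a * Kr'' n t" "2 * Kr' n t + a\<^sup>2 * (2 * Kr' n t + t * Kr'' n t)", folded x\<^sub>2\<^sub>1_def]
  note X4 = four_d_X(2)[of t "hermite n t + a\<^sup>2 * t * Kr n t" "- a * Kr' n t" "2 * Kr n t + a\<^sup>2 * (Kr n t + t * Kr' n t)"
    "- a * Kr'' n t" "2 * Kr' n t + a\<^sup>2 * (2 * Kr' n t + t * Kr'' n t)", folded x\<^sub>2\<^sub>2_def]
  have "4 * ((a\<^sup>2 + 2) * (2 * t\<^sup>2 + 1) * x\<^sub>1\<^sub>1 t + 4 * a * t * x\<^sub>1\<^sub>2 t) = (2 * t\<^sup>2 + 1) * (4 * (a\<^sup>2 + 2) * x\<^sub>1\<^sub>1 t) + 4 * a * t * (4 * x\<^sub>1\<^sub>2 t)"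
    by (simp add: algebra_simps)
  also have "\<dots> = 2 * ((a\<^sup>2 + 2) * e\<^sub>1 n t)"
    unfolding X1 X2 defs by algebra
  finally have "4 * ((a\<^sup>2 + 2) * (2 * t\<^sup>2 + 1) * x\<^sub>1\<^sub>1 t + 4 * a * t * x\<^sub>1\<^sub>2 t) = 2 * ((a\<^sup>2 + 2) * e\<^sub>1 n t)" .
  then show "(a\<^sup>2 + 2) * (2 * t\<^sup>2 + 1) * x\<^sub>1\<^sub>1 t + 4 * a * t * x\<^sub>1\<^sub>2 t = (a\<^sup>2 + 2) / 2 * e\<^sub>1 n t" by simp
  have "4 * (a * t * (a\<^sup>2 + 2) * (2 * t\<^sup>2 + 3) * x\<^sub>1\<^sub>1 t + (3 * a\<^sup>2 + 2) * (2 * t\<^sup>2 + 1) * x\<^sub>1\<^sub>2 t) = a * t * (2 * t\<^sup>2 + 3) * (4 * (a\<^sup>2 + 2) * x\<^sub>1\<^sub>1 t) + (3 * a\<^sup>2 + 2) * (2 * t\<^sup>2 + 1) * (4 * x\<^sub>1\<^sub>2 t)"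
    by (simp add: algebra_simps)
  also have "\<dots> = 2 * (a * e\<^sub>2 a n t)"
    unfolding X1 X2 defs by algebra
  finally have "4 * (a * t * (a\<^sup>2 + 2) * (2 * t\<^sup>2 + 3) * x\<^sub>1\<^sub>1 t + (3 * a\<^sup>2 + 2) * (2 * t\<^sup>2 + 1) * x\<^sub>1\<^sub>2 t) = 2 * (a * e\<^sub>2 a n t)" .
  then show "a * t * (a\<^sup>2 + 2) * (2 * t\<^sup>2 + 3) * x\<^sub>1\<^sub>1 t + (3 * a\<^sup>2 + 2) * (2 * t\<^sup>2 + 1) * x\<^sub>1\<^sub>2 t = a / 2 * e\<^sub>2 a n t" by simp
  have "4 * ((a\<^sup>2 + 2) * (2 * t\<^sup>2 + 1) * x\<^sub>2\<^sub>1 t + 4 * a * t * x\<^sub>2\<^sub>2 t) = (2 * t\<^sup>2 + 1) * (4 * (a\<^sup>2 + 2) * x\<^sub>2\<^sub>1 t) + 4 * a * t * (4 * x\<^sub>2\<^sub>2 t)"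
    by (simp add: algebra_simps)
  also have "\<dots> = 2 * (a * e\<^sub>3 a n t)"
    unfolding X3 X4 defs by algebra
  finally have "4 * ((a\<^sup>2 + 2) * (2 * t\<^sup>2 + 1) * x\<^sub>2\<^sub>1 t + 4 * a * t * x\<^sub>2\<^sub>2 t) = 2 * (a * e\<^sub>3 a n t)" .
  then show "(a\<^sup>2 + 2) * (2 * t\<^sup>2 + 1) * x\<^sub>2\<^sub>1 t + 4 * a * t * x\<^sub>2\<^sub>2 t = a / 2 * e\<^sub>3 a n t" by simp
  have "4 * (a * t * (a\<^sup>2 + 2) * (2 * t\<^sup>2 + 3) * x\<^sub>2\<^sub>1 t + (3 * a\<^sup>2 + 2) * (2 * t\<^sup>2 + 1) * x\<^sub>2\<^sub>2 t) = a * t * (2 * t\<^sup>2 + 3) * (4 * (a\<^sup>2 + 2) * x\<^sub>2\<^sub>1 t) + (3 * a\<^sup>2 + 2) * (2 * t\<^sup>2 + 1) * (4 * x\<^sub>2\<^sub>2 t)"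
    by (simp add: algebra_simps)
  also have "\<dots> = 2 * ((3 * a\<^sup>2 + 2) * e\<^sub>1 n t)"
    unfolding X3 X4 defs by algebra
  finally have "4 * (a * t * (a\<^sup>2 + 2) * (2 * t\<^sup>2 + 3) * x\<^sub>2\<^sub>1 t + (3 * a\<^sup>2 + 2) * (2 * t\<^sup>2 + 1) * x\<^sub>2\<^sub>2 t) = 2 * ((3 * a\<^sup>2 + 2) * e\<^sub>1 n t)" .
  then show "a * t * (a\<^sup>2 + 2) * (2 * t\<^sup>2 + 3) * x\<^sub>2\<^sub>1 t + (3 * a\<^sup>2 + 2) * (2 * t\<^sup>2 + 1) * x\<^sub>2\<^sub>2 t = (3 * a\<^sup>2 + 2) / 2 * e\<^sub>1 n t" by simp
qed

end

text \<open>The weight is \<open>e\<^bsup>-t\<^sup>2\<^esup> X\<^sub>2\<^sup>-\<^sup>1 T diag(c, d) T\<^sup>T X\<^sub>2\<^sup>-\<^sup>T\<close> up to a constant, where \<open>T\<close> is the triangular factor of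
  \<open>W\<^sub>a\<close>; this displays it as a sum of two squares of linear forms.\<close>

definition gram :: "real \<Rightarrow> real \<Rightarrow> real \<Rightarrow> real \<Rightarrow> real \<Rightarrow> real \<Rightarrow> real" where
  "gram a t y\<^sub>1 y\<^sub>2 z\<^sub>1 z\<^sub>2 =
    ((a\<^sup>2 + 2) * (2 * t\<^sup>2 + 1) * y\<^sub>1 + 4 * a * t * y\<^sub>2) * ((a\<^sup>2 + 2) * (2 * t\<^sup>2 + 1) * z\<^sub>1 + 4 * a * t * z\<^sub>2)
      / ((3 * a\<^sup>2 + 2) * (a\<^sup>2 + 2)) +
    (a * t * (a\<^sup>2 + 2) * (2 * t\<^sup>2 + 3) * y\<^sub>1 + (3 * a\<^sup>2 + 2) * (2 * t\<^sup>2 + 1) * y\<^sub>2)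
      * (a * t * (a\<^sup>2 + 2) * (2 * t\<^sup>2 + 3) * z\<^sub>1 + (3 * a\<^sup>2 + 2) * (2 * t\<^sup>2 + 1) * z\<^sub>2) / (3 * a\<^sup>2 + 2)\<^sup>2"

lemma \<W>_eq: "\<W> a t = (exp (- t\<^sup>2) / (\<pp> a t)\<^sup>2) *\<^sub>R
    rmat2 (gram a t 1 0 1 0) (gram a t 1 0 0 1) (gram a t 0 1 1 0) (gram a t 0 1 0 1)"
proof -
  define c d where "c = 3 * a\<^sup>2 + 2" and "d = a\<^sup>2 + 2"
  have nz: "c \<noteq> 0" "d \<noteq> 0" unfolding c_def d_def by (rule nz_consts)+
  have "d * ((a\<^sup>2 * t\<^sup>2 + 3 * a\<^sup>2 + 1) * \<pp> a t + a\<^sup>2 * c * (2 * t\<^sup>2 - 3)) / c\<^sup>2 = gram a t 1 0 1 0"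
  proof -
    \<comment> \<open>The two squares come from the coefficients of the first variable in the two
      linear forms. The other entries are treated in the same way, with two products off the
      diagonal.\<close>
    have "d * ((a\<^sup>2 * t\<^sup>2 + 3 * a\<^sup>2 + 1) * \<pp> a t + a\<^sup>2 * c * (2 * t\<^sup>2 - 3)) =
      c * (d * (2 * t\<^sup>2 + 1)\<^sup>2) + (a * t * d * (2 * t\<^sup>2 + 3))\<^sup>2"
      unfolding \<pp>_def c_def d_def by algebra
    note * = this
    show ?thesis
      unfolding * gram_def c_def[symmetric] d_def[symmetric] using nz
      by (simp add: field_simps power2_eq_square)
  qed
  moreover have "a * t * (\<pp> a t + 8 * (d * t\<^sup>2 + 1)) / c = gram a t 1 0 0 1"
  proof -
    have "\<pp> a t + 8 * (d * t\<^sup>2 + 1) = (2 * t\<^sup>2 + 1) * 4 + d * (2 * t\<^sup>2 + 3) * (2 * t\<^sup>2 + 1)"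
      unfolding \<pp>_def d_def by algebra
    note * = this
    show ?thesis
      unfolding * gram_def c_def[symmetric] d_def[symmetric] using nz
      by (simp add: field_simps power2_eq_square)
  qed
  moreover have "gram a t 0 1 1 0 = gram a t 1 0 0 1"
    by (simp add: gram_def mult.commute)
  moreover have "(\<pp> a t + 2 * a\<^sup>2 * (6 * d * t\<^sup>2 / c - 1)) / d = gram a t 0 1 0 1"
  proof -
    have "(\<pp> a t + 2 * a\<^sup>2 * (6 * d * t\<^sup>2 / c - 1)) / d = (c * \<pp> a t + 2 * a\<^sup>2 * (6 * d * t\<^sup>2 - c)) / (c * d)"
      using nz by (simp add: field_simps)
    also have "c * \<pp> a t + 2 * a\<^sup>2 * (6 * d * t\<^sup>2 - c) = 16 * a\<^sup>2 * t\<^sup>2 + c * d * (2 * t\<^sup>2 + 1)\<^sup>2"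
      unfolding \<pp>_def c_def d_def by algebra
    finally have * : "(\<pp> a t + 2 * a\<^sup>2 * (6 * d * t\<^sup>2 / c - 1)) / d = (16 * a\<^sup>2 * t\<^sup>2 + c * d * (2 * t\<^sup>2 + 1)\<^sup>2) / (c * d)" .
    show ?thesis
      unfolding * gram_def c_def[symmetric] d_def[symmetric] using nz
      by (simp add: field_simps power2_eq_square)
  qed
  ultimately show ?thesis
    unfolding \<W>_def c_def d_def by simp
qed

lemma gram_linear: "gram a t y\<^sub>1 y\<^sub>2 z\<^sub>1 z\<^sub>2 =
  y\<^sub>1 * z\<^sub>1 * gram a t 1 0 1 0 + y\<^sub>1 * z\<^sub>2 * gram a t 1 0 0 1 + y\<^sub>2 * z\<^sub>1 * gram a t 0 1 1 0 + y\<^sub>2 * z\<^sub>2 * gram a t 0 1 0 1"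
  unfolding gram_def by (simp add: algebra_simps add_divide_distrib)

lemma rmat2_\<W>_rmat2: "rmat2 y\<^sub>1\<^sub>1 y\<^sub>1\<^sub>2 y\<^sub>2\<^sub>1 y\<^sub>2\<^sub>2 ** \<W> a t ** ctranspose (rmat2 z\<^sub>1\<^sub>1 z\<^sub>1\<^sub>2 z\<^sub>2\<^sub>1 z\<^sub>2\<^sub>2) =
  rmat2 (exp (- t\<^sup>2) / (\<pp> a t)\<^sup>2 * gram a t y\<^sub>1\<^sub>1 y\<^sub>1\<^sub>2 z\<^sub>1\<^sub>1 z\<^sub>1\<^sub>2) (exp (- t\<^sup>2) / (\<pp> a t)\<^sup>2 * gram a t y\<^sub>1\<^sub>1 y\<^sub>1\<^sub>2 z\<^sub>2\<^sub>1 z\<^sub>2\<^sub>2)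
    (exp (- t\<^sup>2) / (\<pp> a t)\<^sup>2 * gram a t y\<^sub>2\<^sub>1 y\<^sub>2\<^sub>2 z\<^sub>1\<^sub>1 z\<^sub>1\<^sub>2) (exp (- t\<^sup>2) / (\<pp> a t)\<^sup>2 * gram a t y\<^sub>2\<^sub>1 y\<^sub>2\<^sub>2 z\<^sub>2\<^sub>1 z\<^sub>2\<^sub>2)"
  unfolding \<W>_eq rmat2_arith rmat2_eq_iff
  unfolding gram_linear[of a t y\<^sub>1\<^sub>1 y\<^sub>1\<^sub>2] gram_linear[of a t y\<^sub>2\<^sub>1 y\<^sub>2\<^sub>2]
  by (simp add: algebra_simps)

text \<open>Identifies the closed forms \<open>r\<^sub>1\<^sub>1\<close> to
  \<open>r\<^sub>2\<^sub>2\<close> with e^{t^2} \<W> on the rows of X(P_m), by testing against an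
  arbitrary row.\<close>

lemma gram_x:
  "8 * (3 * a\<^sup>2 + 2)\<^sup>2 * (gram a t y\<^sub>1 y\<^sub>2 (x\<^sub>1\<^sub>1 a m t) (x\<^sub>1\<^sub>2 a m t) / (\<pp> a t)\<^sup>2) = y\<^sub>1 * r\<^sub>1\<^sub>1 a m t + y\<^sub>2 * r\<^sub>1\<^sub>2 a m t"
  "8 * (3 * a\<^sup>2 + 2) * (a\<^sup>2 + 2) * (gram a t y\<^sub>1 y\<^sub>2 (x\<^sub>2\<^sub>1 a m t) (x\<^sub>2\<^sub>2 a m t) / (\<pp> a t)\<^sup>2) = y\<^sub>1 * r\<^sub>2\<^sub>1 a m t + y\<^sub>2 * r\<^sub>2\<^sub>2 a m t"
proof -
  define c d where "c = 3 * a\<^sup>2 + 2" and "d = a\<^sup>2 + 2"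
  have nz: "c \<noteq> 0" "d \<noteq> 0" unfolding c_def d_def by (rule nz_consts)+
  have "8 * c\<^sup>2 * gram a t y\<^sub>1 y\<^sub>2 (x\<^sub>1\<^sub>1 a m t) (x\<^sub>1\<^sub>2 a m t) = y\<^sub>1 * (4 * d * s\<^sub>1\<^sub>1 a m t) + y\<^sub>2 * (4 * a * s\<^sub>1\<^sub>2 a m t)"
    unfolding gram_def x_e s\<^sub>1\<^sub>1_def s\<^sub>1\<^sub>2_def unfolding c_def[symmetric] d_def[symmetric]
    using nz by (simp add: field_simps power2_eq_square)
  then show "8 * (3 * a\<^sup>2 + 2)\<^sup>2 * (gram a t y\<^sub>1 y\<^sub>2 (x\<^sub>1\<^sub>1 a m t) (x\<^sub>1\<^sub>2 a m t) / (\<pp> a t)\<^sup>2) = y\<^sub>1 * r\<^sub>1\<^sub>1 a m t + y\<^sub>2 * r\<^sub>1\<^sub>2 a m t"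
    unfolding r\<^sub>1\<^sub>1_def r\<^sub>1\<^sub>2_def c_def[symmetric] d_def[symmetric]
    by (simp add: add_divide_distrib[symmetric])
  have "8 * c * d * gram a t y\<^sub>1 y\<^sub>2 (x\<^sub>2\<^sub>1 a m t) (x\<^sub>2\<^sub>2 a m t) = y\<^sub>1 * (4 * a * d * s\<^sub>2\<^sub>1 a m t) + y\<^sub>2 * (4 * s\<^sub>2\<^sub>2 a m t)"
    unfolding gram_def x_e s\<^sub>2\<^sub>1_def s\<^sub>2\<^sub>2_def unfolding c_def[symmetric] d_def[symmetric]
    using nz by (simp add: field_simps power2_eq_square)
  then show "8 * (3 * a\<^sup>2 + 2) * (a\<^sup>2 + 2) * (gram a t y\<^sub>1 y\<^sub>2 (x\<^sub>2\<^sub>1 a m t) (x\<^sub>2\<^sub>2 a m t) / (\<pp> a t)\<^sup>2) = y\<^sub>1 * r\<^sub>2\<^sub>1 a m t + y\<^sub>2 * r\<^sub>2\<^sub>2 a m t"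
    unfolding r\<^sub>2\<^sub>1_def r\<^sub>2\<^sub>2_def c_def[symmetric] d_def[symmetric]
    by (simp add: add_divide_distrib[symmetric])
qed


lemmas exp_bounded_intros = exp_bounded_add exp_bounded_diff exp_bounded_mult exp_bounded_const exp_bounded_ident
  exp_bounded_power exp_bounded_hermite exp_bounded_Kr exp_bounded_Kr' exp_bounded_Kr''

lemma exp_bounded_divide_\<pp>2: "exp_bounded f \<Longrightarrow> exp_bounded (\<lambda>t. f t / (\<pp> a t)\<^sup>2)"
  using exp_bounded_divide_\<pp>[OF exp_bounded_divide_\<pp>, of f a a] by (simp add: power2_eq_square)

lemma exp_bounded_uqrw:
  "exp_bounded (u\<^sub>1\<^sub>1 a n)" "exp_bounded (u\<^sub>1\<^sub>2 a n)" "exp_bounded (u\<^sub>2\<^sub>1 a n)" "exp_bounded (u\<^sub>2\<^sub>2 a n)"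
  "exp_bounded (q\<^sub>1\<^sub>1 a n)" "exp_bounded (q\<^sub>1\<^sub>2 a n)" "exp_bounded (q\<^sub>2\<^sub>1 a n)" "exp_bounded (q\<^sub>2\<^sub>2 a n)"
  "exp_bounded (r\<^sub>1\<^sub>1 a n)" "exp_bounded (r\<^sub>1\<^sub>2 a n)" "exp_bounded (r\<^sub>2\<^sub>1 a n)" "exp_bounded (r\<^sub>2\<^sub>2 a n)"
  "exp_bounded (w\<^sub>1\<^sub>1 a n)" "exp_bounded (w\<^sub>1\<^sub>2 a n)" "exp_bounded (w\<^sub>2\<^sub>1 a n)" "exp_bounded (w\<^sub>2\<^sub>2 n)"
proof -
  have e: "exp_bounded (e\<^sub>1 n)" "exp_bounded (e\<^sub>2 a n)" "exp_bounded (e\<^sub>3 a n)"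
    unfolding e\<^sub>1_def[abs_def] e\<^sub>2_def[abs_def] e\<^sub>3_def[abs_def] by (intro exp_bounded_intros)+
  show "exp_bounded (u\<^sub>1\<^sub>1 a n)" "exp_bounded (u\<^sub>1\<^sub>2 a n)" "exp_bounded (u\<^sub>2\<^sub>1 a n)" "exp_bounded (u\<^sub>2\<^sub>2 a n)"
    unfolding u\<^sub>1\<^sub>1_def[abs_def] u\<^sub>1\<^sub>2_def[abs_def] u\<^sub>2\<^sub>1_def[abs_def] u\<^sub>2\<^sub>2_def[abs_def]
    by (intro exp_bounded_divide_\<pp> exp_bounded_intros)+
  show "exp_bounded (q\<^sub>1\<^sub>1 a n)" "exp_bounded (q\<^sub>1\<^sub>2 a n)" "exp_bounded (q\<^sub>2\<^sub>1 a n)" "exp_bounded (q\<^sub>2\<^sub>2 a n)"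
    unfolding q\<^sub>1\<^sub>1_def[abs_def] q\<^sub>1\<^sub>2_def[abs_def] q\<^sub>2\<^sub>1_def[abs_def] q\<^sub>2\<^sub>2_def[abs_def]
      N\<^sub>1\<^sub>1_def N\<^sub>1\<^sub>2_def N\<^sub>2\<^sub>1_def N\<^sub>2\<^sub>2_def
    by (intro exp_bounded_divide_\<pp> exp_bounded_intros)+
  show "exp_bounded (r\<^sub>1\<^sub>1 a n)" "exp_bounded (r\<^sub>1\<^sub>2 a n)" "exp_bounded (r\<^sub>2\<^sub>1 a n)" "exp_bounded (r\<^sub>2\<^sub>2 a n)"
    unfolding r\<^sub>1\<^sub>1_def[abs_def] r\<^sub>1\<^sub>2_def[abs_def] r\<^sub>2\<^sub>1_def[abs_def] r\<^sub>2\<^sub>2_def[abs_def]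
      s\<^sub>1\<^sub>1_def s\<^sub>1\<^sub>2_def s\<^sub>2\<^sub>1_def s\<^sub>2\<^sub>2_def
    by (intro exp_bounded_divide_\<pp>2 exp_bounded_intros e)+
  show "exp_bounded (w\<^sub>1\<^sub>1 a n)" "exp_bounded (w\<^sub>1\<^sub>2 a n)" "exp_bounded (w\<^sub>2\<^sub>1 a n)" "exp_bounded (w\<^sub>2\<^sub>2 n)"
    unfolding w\<^sub>1\<^sub>1_def[abs_def] w\<^sub>1\<^sub>2_def[abs_def] w\<^sub>2\<^sub>1_def[abs_def] w\<^sub>2\<^sub>2_def[abs_def]
    by (intro exp_bounded_intros)+
qed

section \<open>Orthogonality and norms of the P_n for W_a\<close>

lemma has_bochner_integral_hermite2:
  "has_bochner_integral lborel
    (\<lambda>t. exp (- t\<^sup>2) * (x * (hermite i t * hermite j t) + y * (hermite k t * hermite l t)))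
    (x * (if i = j then sqrt pi * 2 ^ i * fact i else 0) + y * (if k = l then sqrt pi * 2 ^ k * fact k else 0))"
proof -
  have *: "has_bochner_integral lborel (\<lambda>t. exp (- t\<^sup>2) * (hermite i t * hermite j t)) (if i = j then sqrt pi * 2 ^ i * fact i else 0)" for i j
    using gauss_ip_hermite[of i j] exp_bounded_integrable[OF exp_bounded_mult[OF exp_bounded_hermite[of i] exp_bounded_hermite[of j]]]
    by (simp add: has_bochner_integral_iff gauss_ip_def)
  have "has_bochner_integral lborel
      (\<lambda>t. x * (exp (- t\<^sup>2) * (hermite i t * hermite j t)) + y * (exp (- t\<^sup>2) * (hermite k t * hermite l t)))
    (x * (if i = j then sqrt pi * 2 ^ i * fact i else 0) + y * (if k = l then sqrt pi * 2 ^ k * fact k else 0))"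
    by (intro has_bochner_integral_add has_bochner_integral_mult_right *)
  then show ?thesis by (simp only: distrib_left mult.left_commute)
qed

definition sqnorm\<^sub>1 :: "real \<Rightarrow> nat \<Rightarrow> real" where
  "sqnorm\<^sub>1 a n = sqrt pi * 2 ^ n * fact n * (1 + a\<^sup>2 * (real n + 1) / 2)"

definition sqnorm\<^sub>2 :: "real \<Rightarrow> nat \<Rightarrow> real" where
  "sqnorm\<^sub>2 a n = sqrt pi * 2 ^ n * fact n * (1 + a\<^sup>2 * real n / 2)"

text \<open>P_n times the triangular factor of W_a has the rows (H_n, (a/2) H_{n+1}) and (-a n
  H_{n-1}, H_n), because t H_n - K_n = H_{n+1} / 2 with K_n = \<open>Kr n\<close>. So each entry is
  a combination of two Hermite products. In the off-diagonal entries both products survive only for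
  neighbouring indices, and there they cancel: (a/2) 2^{n+1} (n + 1)! = a (n + 1) 2^n n!.\<close>

lemma P\<^sub>a_ip:
  "has_bochner_integral lborel (\<lambda>t. exp (- t\<^sup>2) *
      (hermite n t * (hermite m t + a * t * (a * t * hermite m t - a * Kr m t)) + - a * Kr n t * (a * t * hermite m t - a * Kr m t)))
    (if n = m then sqnorm\<^sub>1 a n else 0)" (is ?A)
  "has_bochner_integral lborel (\<lambda>t. exp (- t\<^sup>2) *
      (hermite n t * (a * t * hermite m t - a * Kr m t) + - a * Kr n t * hermite m t)) 0" (is ?B)
  "has_bochner_integral lborel (\<lambda>t. exp (- t\<^sup>2) *
      (- a * Kr n t * (hermite m t + a * t * (a * t * hermite m t - a * Kr m t)) + (hermite n t + a\<^sup>2 * t * Kr n t) * (a * t * hermite m t - a * Kr m t))) 0" (is ?C)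
  "has_bochner_integral lborel (\<lambda>t. exp (- t\<^sup>2) *
      (- a * Kr n t * (a * t * hermite m t - a * Kr m t) + (hermite n t + a\<^sup>2 * t * Kr n t) * hermite m t))
    (if n = m then sqnorm\<^sub>2 a n else 0)" (is ?D)
proof -
  have 1: "hermite n t * (hermite m t + a * t * (a * t * hermite m t - a * Kr m t)) + - a * Kr n t * (a * t * hermite m t - a * Kr m t) =
      1 * (hermite n t * hermite m t) + (a\<^sup>2 / 4) * (hermite (Suc n) t * hermite (Suc m) t)" for t
    unfolding hermite_Suc by (simp add: algebra_simps power2_eq_square)
  have 2: "hermite n t * (a * t * hermite m t - a * Kr m t) + - a * Kr n t * hermite m t =
     (a / 2) * (hermite (Suc n) t * hermite m t) + (- a * real m) * (hermite n t * hermite (m - 1) t)" for t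
    unfolding hermite_Suc Kr_def[of m] by (simp add: algebra_simps)
  have 3: "- a * Kr n t * (hermite m t + a * t * (a * t * hermite m t - a * Kr m t)) + (hermite n t + a\<^sup>2 * t * Kr n t) * (a * t * hermite m t - a * Kr m t) =
     (a / 2) * (hermite n t * hermite (Suc m) t) + (- a * real n) * (hermite (n - 1) t * hermite m t)" for t
    unfolding hermite_Suc Kr_def[of n] by (simp add: algebra_simps power2_eq_square)
  have 4: "- a * Kr n t * (a * t * hermite m t - a * Kr m t) + (hermite n t + a\<^sup>2 * t * Kr n t) * hermite m t =
     1 * (hermite n t * hermite m t) + (a\<^sup>2 * real n * real m) * (hermite (n - 1) t * hermite (m - 1) t)" for t
    unfolding Kr_def by (simp add: algebra_simps power2_eq_square)
  show ?A unfolding 1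
    by (rule has_bochner_integral_cong[THEN iffD1, OF refl refl _ has_bochner_integral_hermite2])
      (auto simp: sqnorm\<^sub>1_def field_simps)
  \<comment> \<open>The case distinction on \<open>m\<close> settles the truncated predecessor,
    whose coefficient vanishes at \<open>m = 0\<close>.\<close>
  show ?B unfolding 2
    by (rule has_bochner_integral_cong[THEN iffD1, OF refl refl _ has_bochner_integral_hermite2])
      (cases m, auto simp: field_simps)
  show ?C unfolding 3
    by (rule has_bochner_integral_cong[THEN iffD1, OF refl refl _ has_bochner_integral_hermite2])
      (cases n, auto simp: field_simps)
  show ?D unfolding 4
    by (rule has_bochner_integral_cong[THEN iffD1, OF refl refl _ has_bochner_integral_hermite2])
      (cases n; cases m, auto simp: sqnorm\<^sub>2_def field_simps)
qed

lemma has_bochner_integral_W\<^sub>a: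
  "has_bochner_integral lborel (\<lambda>t. P\<^sub>a a n t ** W\<^sub>a a t ** ctranspose (P\<^sub>a a m t))
    (if n = m then rmat2 (sqnorm\<^sub>1 a n) 0 0 (sqnorm\<^sub>2 a n) else 0)"
proof -
  have "has_bochner_integral lborel (\<lambda>t. P\<^sub>a a n t ** W\<^sub>a a t ** ctranspose (P\<^sub>a a m t))
    (rmat2 (if n = m then sqnorm\<^sub>1 a n else 0) 0 0 (if n = m then sqnorm\<^sub>2 a n else 0))"
    by (rule has_bochner_integral_cong[THEN iffD1, OF refl _ refl has_bochner_integral_rmat2[OF P\<^sub>a_ip[where n = n and m = m and a = a]]])
      (simp add: P\<^sub>a_eq W\<^sub>a_def rmat2_arith rmat2_eq_iff algebra_simps power2_eq_square)
  then show ?thesis by (simp add: rmat2_arith(8) split: if_splits)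
qed


lemma exp_bounded_rows:
  "exp_bounded (\<lambda>t. - a * Kr n t)" "exp_bounded (\<lambda>t. 2 * Kr n t)" "exp_bounded (\<lambda>t. - a * Kr' n t)"
  "exp_bounded (\<lambda>t. 2 * Kr' n t)" "exp_bounded (\<lambda>t. - a * Kr'' n t)"
  "exp_bounded (\<lambda>t. hermite n t + a\<^sup>2 * t * Kr n t)" "exp_bounded (\<lambda>t. 2 * Kr n t + a\<^sup>2 * (Kr n t + t * Kr' n t))"
  "exp_bounded (\<lambda>t. 2 * Kr' n t + a\<^sup>2 * (2 * Kr' n t + t * Kr'' n t))"
  by (intro exp_bounded_intros)+

text \<open>Green's identity replaces \<open>r\<close> by \<open>w\<close>, and w is a constant
  times W_a on a row of P_m, so that \<open>P\<^sub>a_ip\<close> applies. The four cases are the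
  pairs of rows of P_n and P_m.\<close>

lemma x_integrals:
  "has_bochner_integral lborel (\<lambda>t. exp (- t\<^sup>2) * (x\<^sub>1\<^sub>1 a n t * r\<^sub>1\<^sub>1 a m t + x\<^sub>1\<^sub>2 a n t * r\<^sub>1\<^sub>2 a m t))
    (2 * (real m - 1) * (real m - 2) * (if n = m then sqnorm\<^sub>1 a n else 0))" (is ?A)
  "has_bochner_integral lborel (\<lambda>t. exp (- t\<^sup>2) * (x\<^sub>1\<^sub>1 a n t * r\<^sub>2\<^sub>1 a m t + x\<^sub>1\<^sub>2 a n t * r\<^sub>2\<^sub>2 a m t)) 0" (is ?B)
  "has_bochner_integral lborel (\<lambda>t. exp (- t\<^sup>2) * (x\<^sub>2\<^sub>1 a n t * r\<^sub>1\<^sub>1 a m t + x\<^sub>2\<^sub>2 a n t * r\<^sub>1\<^sub>2 a m t)) 0" (is ?C)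
  "has_bochner_integral lborel (\<lambda>t. exp (- t\<^sup>2) * (x\<^sub>2\<^sub>1 a n t * r\<^sub>2\<^sub>1 a m t + x\<^sub>2\<^sub>2 a n t * r\<^sub>2\<^sub>2 a m t))
    (2 * (real m - 1) * (real m - 2) * (if n = m then sqnorm\<^sub>2 a n else 0))" (is ?D)
proof -
  let ?\<kappa> = "2 * (real m - 1) * (real m - 2)"
  have *: "has_bochner_integral lborel (\<lambda>t. exp (- t\<^sup>2) * f t) (?\<kappa> * I)"
    if "exp_bounded f" "(LINT t|lborel. exp (- t\<^sup>2) * f t) = (LINT t|lborel. exp (- t\<^sup>2) * g t)"
      "\<And>t. g t = ?\<kappa> * h t" "has_bochner_integral lborel (\<lambda>t. exp (- t\<^sup>2) * h t) I" for f g h I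
  proof -
    have "has_bochner_integral lborel (\<lambda>t. ?\<kappa> * (exp (- t\<^sup>2) * h t)) (?\<kappa> * I)"
      by (intro has_bochner_integral_mult_right that)
    then have "(LINT t|lborel. exp (- t\<^sup>2) * g t) = ?\<kappa> * I"
      unfolding that(3) by (simp add: has_bochner_integral_iff mult.left_commute)
    then show ?thesis
      using exp_bounded_integrable[OF that(1)] that(2) by (simp add: has_bochner_integral_iff)
  qed
  note green1 = green_integral[OF _ _ _ _ _ _ _ _ _ _ exp_bounded_uqrw(1,2,5,6,9,10,13,14)[where a = a and n = m]
    u\<^sub>1\<^sub>1_eq[where a = a and n = m]
    u\<^sub>1\<^sub>2_eq[where a = a and n = m]
    u\<^sub>1\<^sub>1_deriv[where a = a and n = m]
    u\<^sub>1\<^sub>2_deriv[where a = a and n = m]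
    q\<^sub>1\<^sub>1_deriv[where a = a and n = m]
    q\<^sub>1\<^sub>2_deriv[where a = a and n = m]]
  note green2 = green_integral[OF _ _ _ _ _ _ _ _ _ _ exp_bounded_uqrw(3,4,7,8,11,12,15)[where a = a and n = m] exp_bounded_uqrw(16)[where n = m]
    u\<^sub>2\<^sub>1_eq[where a = a and n = m]
    u\<^sub>2\<^sub>2_eq[where a = a and n = m]
    u\<^sub>2\<^sub>1_deriv[where a = a and n = m]
    u\<^sub>2\<^sub>2_deriv[where a = a and n = m]
    q\<^sub>2\<^sub>1_deriv[where a = a and n = m]
    q\<^sub>2\<^sub>2_deriv[where a = a and n = m]]
  note row1 = hermite_deriv[where n = n] DERIV_cmult[OF Kr_deriv'[where n = n], where c = "- a"]
    DERIV_cmult[OF Kr_deriv'[where n = n], where c = 2] DERIV_cmult[OF Kr'_deriv[where n = n], where c = "- a"]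
    exp_bounded_hermite[where n = n] exp_bounded_rows(1)[where a = a and n = n] exp_bounded_rows(2)[where n = n] exp_bounded_rows(3)[where a = a and n = n] exp_bounded_rows(4)[where n = n] exp_bounded_rows(5)[where a = a and n = n]
  note row2 = DERIV_cmult[OF Kr_deriv'[where n = n], where c = "- a"] y\<^sub>2\<^sub>2_deriv[where n = n and a = a]
    DERIV_cmult[OF Kr'_deriv[where n = n], where c = "- a"] y\<^sub>2\<^sub>2_deriv'[where n = n and a = a]
    exp_bounded_rows(1,6,3,7,5,8)[where a = a and n = n]
  show ?A
    by (rule *[OF green1[OF row1, folded x\<^sub>1\<^sub>1_def x\<^sub>1\<^sub>2_def] _ P\<^sub>a_ip(1)])
      (simp add: w\<^sub>1\<^sub>1_def w\<^sub>1\<^sub>2_def algebra_simps)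
  have "has_bochner_integral lborel (\<lambda>t. exp (- t\<^sup>2) * (x\<^sub>1\<^sub>1 a n t * r\<^sub>2\<^sub>1 a m t + x\<^sub>1\<^sub>2 a n t * r\<^sub>2\<^sub>2 a m t)) (?\<kappa> * 0)"
    by (rule *[OF green2[OF row1, folded x\<^sub>1\<^sub>1_def x\<^sub>1\<^sub>2_def] _ P\<^sub>a_ip(2)])
      (simp add: w\<^sub>2\<^sub>1_def w\<^sub>2\<^sub>2_def algebra_simps)
  then show ?B by simp
  have "has_bochner_integral lborel (\<lambda>t. exp (- t\<^sup>2) * (x\<^sub>2\<^sub>1 a n t * r\<^sub>1\<^sub>1 a m t + x\<^sub>2\<^sub>2 a n t * r\<^sub>1\<^sub>2 a m t)) (?\<kappa> * 0)"
    by (rule *[OF green1[OF row2, folded x\<^sub>2\<^sub>1_def x\<^sub>2\<^sub>2_def] _ P\<^sub>a_ip(3)])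
      (simp add: w\<^sub>1\<^sub>1_def w\<^sub>1\<^sub>2_def algebra_simps)
  then show ?C by simp
  show ?D
    by (rule *[OF green2[OF row2, folded x\<^sub>2\<^sub>1_def x\<^sub>2\<^sub>2_def] _ P\<^sub>a_ip(4)])
      (simp add: w\<^sub>2\<^sub>1_def w\<^sub>2\<^sub>2_def algebra_simps)
qed

lemma has_bochner_integral_Xop:
  "has_bochner_integral lborel (\<lambda>t. Xop a (P\<^sub>a a n) t ** \<W> a t ** ctranspose (Xop a (P\<^sub>a a m) t))
    (if n = m then ((real n - 1) * (real n - 2)) *\<^sub>R
       rmat2 (sqnorm\<^sub>1 a n / (4 * (3 * a\<^sup>2 + 2)\<^sup>2)) 0 0 (sqnorm\<^sub>2 a n / (4 * (3 * a\<^sup>2 + 2) * (a\<^sup>2 + 2))) else 0)"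
proof -
  define c d where "c = 3 * a\<^sup>2 + 2" and "d = a\<^sup>2 + 2"
  have nz: "c \<noteq> 0" "d \<noteq> 0" unfolding c_def d_def by (rule nz_consts)+
  have g: "exp (- t\<^sup>2) / (\<pp> a t)\<^sup>2 * gram a t y\<^sub>1 y\<^sub>2 (x\<^sub>1\<^sub>1 a m t) (x\<^sub>1\<^sub>2 a m t) =
      exp (- t\<^sup>2) * (y\<^sub>1 * r\<^sub>1\<^sub>1 a m t + y\<^sub>2 * r\<^sub>1\<^sub>2 a m t) / (8 * c\<^sup>2)"
    "exp (- t\<^sup>2) / (\<pp> a t)\<^sup>2 * gram a t y\<^sub>1 y\<^sub>2 (x\<^sub>2\<^sub>1 a m t) (x\<^sub>2\<^sub>2 a m t) =
      exp (- t\<^sup>2) * (y\<^sub>1 * r\<^sub>2\<^sub>1 a m t + y\<^sub>2 * r\<^sub>2\<^sub>2 a m t) / (8 * c * d)" for y\<^sub>1 y\<^sub>2 t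
    unfolding gram_x[symmetric] c_def[symmetric] d_def[symmetric] using nz by (simp_all add: field_simps)
  have "has_bochner_integral lborel (\<lambda>t. Xop a (P\<^sub>a a n) t ** \<W> a t ** ctranspose (Xop a (P\<^sub>a a m) t))
    (rmat2 ((2 * (real m - 1) * (real m - 2) * (if n = m then sqnorm\<^sub>1 a n else 0)) / (8 * c\<^sup>2)) (0 / (8 * c * d))
       (0 / (8 * c\<^sup>2)) ((2 * (real m - 1) * (real m - 2) * (if n = m then sqnorm\<^sub>2 a n else 0)) / (8 * c * d)))"
    unfolding Xop_P\<^sub>a rmat2_\<W>_rmat2 g
    by (intro has_bochner_integral_rmat2 has_bochner_integral_divide_zero x_integrals)
  \<comment> \<open>The 2 from w against the 8 from the scaling gives the 4 in the norm
    formula.\<close>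
  moreover have half: "2 * p * q * x / (8 * y) = p * q * (x / (4 * y))" for p q x y :: real
    by simp
  ultimately show ?thesis unfolding c_def[symmetric] d_def[symmetric] mult.assoc[of 8] half
    by (simp add: rmat2_arith(4,8) mult.assoc split: if_splits)
qed

section \<open>Matrix polynomials\<close>

definition cpoly_fun :: "(real \<Rightarrow> complex) \<Rightarrow> bool" where
  "cpoly_fun f \<longleftrightarrow> (\<exists>p. \<forall>t. f t = poly p (of_real t))"

lemma matrix_polynomial_iff: "matrix_polynomial Q \<longleftrightarrow> (\<forall>i j. cpoly_fun (\<lambda>t. Q t $ i $ j))"
  by (simp add: matrix_polynomial_def cpoly_fun_def)

lemma cpoly_fun_const: "cpoly_fun (\<lambda>t. c)"
  unfolding cpoly_fun_def by (rule exI[of _ "[:c:]"]) simp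

lemma cpoly_fun_of_real: "cpoly_fun (\<lambda>t. of_real (poly p t))"
proof -
  have "of_real (poly p t) = poly (map_poly of_real p) (of_real t :: complex)" for t
    by (induction p) (auto simp: map_poly_pCons)
  then show ?thesis unfolding cpoly_fun_def by blast
qed

lemma cpoly_fun_add: "cpoly_fun f \<Longrightarrow> cpoly_fun g \<Longrightarrow> cpoly_fun (\<lambda>t. f t + g t)"
  unfolding cpoly_fun_def by (metis poly_add)

lemma cpoly_fun_mult: "cpoly_fun f \<Longrightarrow> cpoly_fun g \<Longrightarrow> cpoly_fun (\<lambda>t. f t * g t)"
  unfolding cpoly_fun_def by (metis poly_mult)

lemma matrix_polynomialI:
  assumes "cpoly_fun (\<lambda>t. Q t $ 1 $ 1)" "cpoly_fun (\<lambda>t. Q t $ 1 $ 2)"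
    "cpoly_fun (\<lambda>t. Q t $ 2 $ 1)" "cpoly_fun (\<lambda>t. Q t $ 2 $ 2)"
  shows "matrix_polynomial Q"
  using assms by (simp add: matrix_polynomial_iff forall_2)

lemma matrix_polynomial_const: "matrix_polynomial (\<lambda>t. C)"
  by (simp add: matrix_polynomial_iff cpoly_fun_const)

lemma matrix_polynomial_rmat2:
  "matrix_polynomial (\<lambda>t. rmat2 (poly p t) (poly q t) (poly r t) (poly s t))"
  by (rule matrix_polynomialI) (simp_all add: cpoly_fun_of_real)

lemma matrix_polynomial_add:
  "matrix_polynomial Q \<Longrightarrow> matrix_polynomial R \<Longrightarrow> matrix_polynomial (\<lambda>t. Q t + R t)"
  by (simp add: matrix_polynomial_iff cpoly_fun_add)

lemma matrix_polynomial_mult: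
  "matrix_polynomial Q \<Longrightarrow> matrix_polynomial R \<Longrightarrow> matrix_polynomial (\<lambda>t. Q t ** R t)"
  by (simp add: matrix_polynomial_iff mat2_mult_nth cpoly_fun_add cpoly_fun_mult)

lemma matrix_polynomial_sum:
  "(\<And>i. i \<in> S \<Longrightarrow> matrix_polynomial (Q i)) \<Longrightarrow> matrix_polynomial (\<lambda>t. \<Sum>i\<in>S. Q i t)"
  by (induction S rule: infinite_finite_induct)
    (simp_all add: matrix_polynomial_const matrix_polynomial_add)

lemma matrix_polynomial_scaleR_poly:
  "matrix_polynomial Q \<Longrightarrow> matrix_polynomial (\<lambda>t. poly p t *\<^sub>R Q t)"
  unfolding matrix_polynomial_iff
  by (simp add: scaleR_conv_of_real[where 'a = complex] cpoly_fun_mult cpoly_fun_of_real)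

lemma cpoly_fun_deriv:
  assumes "cpoly_fun f"
  obtains f' where "cpoly_fun f'" "\<And>t. (f has_vector_derivative f' t) (at t)"
proof -
  obtain p where "f = (\<lambda>t. poly p (of_real t))" using assms by (auto simp: cpoly_fun_def)
  moreover have "((\<lambda>t. poly p (of_real t)) has_vector_derivative poly (pderiv p) (of_real t)) (at t)" for t
    by (rule has_vector_derivative_real_field) (rule poly_DERIV)
  ultimately show thesis by (intro that[of "\<lambda>t. poly (pderiv p) (of_real t)"]) (auto simp: cpoly_fun_def)
qed

lemma cpoly_fun_antideriv:
  assumes "cpoly_fun f"
  obtains F where "cpoly_fun F" "\<And>t. (F has_vector_derivative f t) (at t)"
proof -
  obtain p where p: "f = (\<lambda>t. poly p (of_real t))" using assms by (auto simp: cpoly_fun_def)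
  define q where "q = (\<Sum>i\<le>degree p. monom (coeff p i / of_nat (Suc i)) (Suc i))"
  have *: "pderiv (sum g A) = (\<Sum>i\<in>A. pderiv (g i))" if "finite A" for g :: "nat \<Rightarrow> complex poly" and A
    using that by induction (auto simp: pderiv_add)
  have "pderiv q = (\<Sum>i\<le>degree p. monom (coeff p i) i)"
    unfolding q_def *[OF finite_atMost] pderiv_monom
    by (intro sum.cong refl) (simp del: of_nat_Suc)
  then have "pderiv q = p" by (simp add: poly_as_sum_of_monoms)
  moreover have "((\<lambda>t. poly q (of_real t)) has_vector_derivative poly (pderiv q) (of_real t)) (at t)" for t
    by (rule has_vector_derivative_real_field) (rule poly_DERIV)
  ultimately show thesis using p by (intro that[of "\<lambda>t. poly q (of_real t)"]) (auto simp: cpoly_fun_def)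
qed

lemma matrix_polynomial_deriv:
  assumes "matrix_polynomial Q"
  shows "matrix_polynomial (matrix_deriv Q)" "(Q has_vector_derivative matrix_deriv Q t) (at t)"
proof -
  have "\<exists>f'. cpoly_fun f' \<and> (\<forall>t. ((\<lambda>t. Q t $ i $ j) has_vector_derivative f' t) (at t))" for i j
    by (metis assms cpoly_fun_deriv matrix_polynomial_iff)
  then obtain g where g: "\<And>i j. cpoly_fun (g i j)"
      "\<And>i j t. ((\<lambda>t. Q t $ i $ j) has_vector_derivative g i j t) (at t)"
    by metis
  have D: "(Q has_vector_derivative (\<chi> i j. g i j t)) (at t)" for t
    by (rule has_vector_derivative_mat2) (simp add: g)
  then have "matrix_deriv Q = (\<lambda>t. \<chi> i j. g i j t)" by (rule matrix_derivI)
  then show "matrix_polynomial (matrix_deriv Q)" "(Q has_vector_derivative matrix_deriv Q t) (at t)"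
    using D by (simp_all add: matrix_polynomial_iff g)
qed

text \<open>Variation of constants prescribes only the derivatives of the coefficients, and these
  must be integrated without leaving the polynomials.\<close>

lemma matrix_polynomial_antideriv:
  assumes "matrix_polynomial Q"
  obtains S where "matrix_polynomial S" "\<And>t. (S has_vector_derivative Q t) (at t)"
proof -
  have "\<exists>F. cpoly_fun F \<and> (\<forall>t. (F has_vector_derivative Q t $ i $ j) (at t))" for i j
    by (metis assms cpoly_fun_antideriv matrix_polynomial_iff)
  then obtain g where g: "\<And>i j. cpoly_fun (g i j)"
      "\<And>i j t. (g i j has_vector_derivative Q t $ i $ j) (at t)"
    by metis
  have "((\<lambda>t. \<chi> i j. g i j t) has_vector_derivative Q t) (at t)" for t
    by (rule has_vector_derivative_mat2) (simp add: g)
  then show thesis by (intro that[of "\<lambda>t. \<chi> i j. g i j t"]) (simp_all add: matrix_polynomial_iff g)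
qed

section \<open>The composed operator on matrix polynomials and the identification of
  \<open>\<P>\<^sub>2\<close>\<close>

lemma Xop_eq:
  assumes "\<And>t. (y has_vector_derivative y' t) (at t)" "\<And>t. (y' has_vector_derivative y'' t) (at t)"
  shows "Xop a y t = y t + y' t ** X\<^sub>1 a t + y'' t ** X\<^sub>2 a t"
  unfolding Xop_def matrix_derivI[OF assms(1)] matrix_derivI[OF assms(2)] ..

lemma matrix_polynomial_X\<^sub>1: "matrix_polynomial (X\<^sub>1 a)"
  using matrix_polynomial_rmat2[of "[:0, -1:]" "[:a / 2:]" "[:a / (a\<^sup>2 + 2):]" "[:0, -1:]"]
  by (simp add: X\<^sub>1_def[abs_def])

lemma matrix_polynomial_X\<^sub>2: "matrix_polynomial (X\<^sub>2 a)"
proof -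
  have "X\<^sub>2 a = (\<lambda>t. rmat2 (poly [:(3 * a\<^sup>2 + 2) / (4 * (a\<^sup>2 + 2)), 0, 1 / 2:] t) (poly [:0, - (a / 2):] t)
      (poly [:0, - (a / (a\<^sup>2 + 2)):] t) (poly [:1 / 4, 0, 1 / 2:] t))"
    by (auto simp: X\<^sub>2_def fun_eq_iff rmat2_eq_iff power2_eq_square)
  then show ?thesis by (simp only: matrix_polynomial_rmat2)
qed

lemma matrix_polynomial_Xop:
  assumes "matrix_polynomial y"
  shows "matrix_polynomial (Xop a y)"
  unfolding Xop_def[abs_def]
  by (intro matrix_polynomial_add matrix_polynomial_mult matrix_polynomial_X\<^sub>1 matrix_polynomial_X\<^sub>2
      matrix_polynomial_deriv assms)

lemma Xop_add:
  assumes "matrix_polynomial y" "matrix_polynomial z"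
  shows "Xop a (\<lambda>t. y t + z t) t = Xop a y t + Xop a z t"
proof -
  note D = matrix_polynomial_deriv(2) matrix_polynomial_deriv(1) assms
  have "Xop a (\<lambda>t. y t + z t) t = y t + z t + (matrix_deriv y t + matrix_deriv z t) ** X\<^sub>1 a t
      + (matrix_deriv (matrix_deriv y) t + matrix_deriv (matrix_deriv z) t) ** X\<^sub>2 a t"
    by (rule Xop_eq) (intro has_vector_derivative_add D)+
  then show ?thesis by (simp add: Xop_def bounded_bilinear.add_left[OF bounded_bilinear_mat_mult])
qed

text \<open>The coefficients of X multiply from the right, so X commutes with constant left factors;
  spans with coefficients on the left rely on this.\<close>

lemma Xop_mult_left:
  assumes "matrix_polynomial y"
  shows "Xop a (\<lambda>t. C ** y t) t = C ** Xop a y t"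
proof -
  note D = matrix_polynomial_deriv(2) matrix_polynomial_deriv(1) assms
  note L = bounded_linear.has_vector_derivative[OF bounded_bilinear.bounded_linear_right[OF bounded_bilinear_mat_mult]]
  have "Xop a (\<lambda>t. C ** y t) t = C ** y t + (C ** matrix_deriv y t) ** X\<^sub>1 a t
      + (C ** matrix_deriv (matrix_deriv y) t) ** X\<^sub>2 a t"
    by (rule Xop_eq) (intro L D)+
  then show ?thesis by (simp add: Xop_def matrix_add_ldistrib matrix_mul_assoc)
qed

lemma matrix_polynomial_P\<^sub>a: "matrix_polynomial (P\<^sub>a a n)"
proof -
  have "P\<^sub>a a n = (\<lambda>t. rmat2 (poly (hermite_poly n) t) (poly (smult (- a * real n) (hermite_poly (n - 1))) t)
      (poly (smult (- a * real n) (hermite_poly (n - 1))) t)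
      (poly (hermite_poly n + [:0, a\<^sup>2:] * smult (real n) (hermite_poly (n - 1))) t))"
    by (auto simp: P\<^sub>a_eq hermite_eq_poly Kr_def fun_eq_iff rmat2_eq_iff)
  then show ?thesis by (simp only: matrix_polynomial_rmat2)
qed

text \<open>The determinant is 64 (1 + a^2) (2 (a^2 + 2) t^2 - a^2). A half-line free of its zeros
  suffices for uniqueness.\<close>

lemma invertible_matrix_deriv_\<P>\<^sub>1:
  assumes "t \<ge> 1 + \<bar>a\<bar>"
  shows "invertible (matrix_deriv (\<P>\<^sub>1 a 2) t)"
proof -
  have "a\<^sup>2 < t\<^sup>2" using power_strict_mono[of "\<bar>a\<bar>" t 2] assms by simp
  moreover have "t\<^sup>2 \<le> (a\<^sup>2 + 2) * t\<^sup>2" by (simp add: mult_le_cancel_right1)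
  ultimately have pos: "2 * (a\<^sup>2 + 2) * t\<^sup>2 - a\<^sup>2 > 0" using zero_le_power2[of t] by linarith
  have "det (rmat2 p q r s) = of_real (p * s - q * r)" for p q r s
    by (simp add: det_2)
  then have "det (matrix_deriv (\<P>\<^sub>1 a 2) t) = of_real (64 * (1 + a\<^sup>2) * (2 * (a\<^sup>2 + 2) * t\<^sup>2 - a\<^sup>2))"
    unfolding matrix_deriv_\<P>\<^sub>1_2 M\<^sub>1_def rmat2_arith using nz_consts(1)[of a]
    by (simp only: of_real_eq_iff) (simp add: field_simps power2_eq_square)
  moreover have "64 * (1 + a\<^sup>2) * (2 * (a\<^sup>2 + 2) * t\<^sup>2 - a\<^sup>2) \<noteq> 0"
    using nz_consts(3)[of a] pos by simp
  ultimately show ?thesis by (simp only: invertible_det_nz of_real_eq_0_iff not_False_eq_True)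
qed

lemma is_\<P>\<^sub>2_Xop: "is_\<P>\<^sub>2 a n (Xop a (P\<^sub>a a n))"
  unfolding is_\<P>\<^sub>2_def \<P>\<^sub>1_def[of a n]
  by (auto intro!: matrix_polynomial_Xop matrix_polynomial_P\<^sub>a \<A>\<^sub>2_\<A>\<^sub>1_eq[symmetric] P\<^sub>a_deriv P\<^sub>a'_deriv)

text \<open>The candidates agree on a half-line, so each entry of the difference is a polynomial
  with infinitely many zeros.\<close>

lemma is_\<P>\<^sub>2_unique:
  assumes "is_\<P>\<^sub>2 a n Q" "is_\<P>\<^sub>2 a n R"
  shows "Q = R"
proof -
  have "Q t $ i $ j = R t $ i $ j" for t i j
  proof -
    obtain p where p: "\<And>t. Q t $ i $ j = poly p (of_real t)"
      using assms(1) by (auto simp: is_\<P>\<^sub>2_def matrix_polynomial_def) metis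
    obtain q where q: "\<And>t. R t $ i $ j = poly q (of_real t)"
      using assms(2) by (auto simp: is_\<P>\<^sub>2_def matrix_polynomial_def) metis
    have "Q t = R t" if "t \<ge> 1 + \<bar>a\<bar>" for t
      using assms invertible_matrix_deriv_\<P>\<^sub>1[OF that] by (simp add: is_\<P>\<^sub>2_def)
    then have "of_real ` {1 + \<bar>a\<bar>..} \<subseteq> {z. poly (p - q) z = 0}"
      by (auto simp flip: p q)
    moreover have "infinite (of_real ` {1 + \<bar>a\<bar>..} :: complex set)"
      by (simp add: finite_image_iff inj_on_def infinite_Ici)
    ultimately have "p - q = 0"
      using poly_roots_finite finite_subset by blast
    then show ?thesis by (simp add: p q)
  qed
  then show ?thesis by (simp add: fun_eq_iff vec_eq_iff)
qed

lemma ex1_is_\<P>\<^sub>2: "\<exists>!Q. is_\<P>\<^sub>2 a n Q"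
  using is_\<P>\<^sub>2_Xop is_\<P>\<^sub>2_unique by blast

lemma \<P>\<^sub>2_eq: "\<P>\<^sub>2 a n = Xop a (P\<^sub>a a n)"
  unfolding \<P>\<^sub>2_def using is_\<P>\<^sub>2_Xop is_\<P>\<^sub>2_unique by (intro the_equality) blast+

text \<open>X annihilates P_1 and P_2; the derivatives are written out. This yields the two zero
  members of the family and the fundamental system for the variation of constants.\<close>

lemma kernel_eqs:
  "P\<^sub>a a 1 t + rmat2 2 0 0 (a\<^sup>2 + 2) ** X\<^sub>1 a t = 0"
  "P\<^sub>a a 2 t + matrix_deriv (P\<^sub>a a 2) t ** X\<^sub>1 a t + rmat2 8 0 0 (8 * (1 + a\<^sup>2)) ** X\<^sub>2 a t = 0"
proof -
  show "P\<^sub>a a 1 t + rmat2 2 0 0 (a\<^sup>2 + 2) ** X\<^sub>1 a t = 0"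
    unfolding P\<^sub>a_1 X\<^sub>1_def rmat2_arith using nz_consts(1)[of a] by (simp add: rmat2_eq_iff)
  show "P\<^sub>a a 2 t + matrix_deriv (P\<^sub>a a 2) t ** X\<^sub>1 a t + rmat2 8 0 0 (8 * (1 + a\<^sup>2)) ** X\<^sub>2 a t = 0"
    unfolding matrix_deriv_P\<^sub>a_2 unfolding P\<^sub>a_2 X\<^sub>1_def X\<^sub>2_def rmat2_arith rmat2_eq_iff
    using nz_consts(1)[of a] by (auto simp: divide_simps) (simp_all add: algebra_simps power2_eq_square)
qed

lemma \<P>\<^sub>2_1_2: "\<P>\<^sub>2 a 1 t = 0" "\<P>\<^sub>2 a 2 t = 0"
proof -
  have "matrix_deriv (matrix_deriv (P\<^sub>a a 1)) = (\<lambda>t. 0)"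
    unfolding matrix_deriv_P\<^sub>a_1 by (rule matrix_derivI) (rule has_vector_derivative_const)
  then have "\<P>\<^sub>2 a 1 t = P\<^sub>a a 1 t + rmat2 2 0 0 (a\<^sup>2 + 2) ** X\<^sub>1 a t + 0 ** X\<^sub>2 a t"
    unfolding \<P>\<^sub>2_eq Xop_def by (simp only: matrix_deriv_P\<^sub>a_1)
  then show "\<P>\<^sub>2 a 1 t = 0" unfolding kernel_eqs by simp
  show "\<P>\<^sub>2 a 2 t = 0"
    unfolding \<P>\<^sub>2_eq Xop_eq[OF P\<^sub>a_2_derivs] by (rule kernel_eqs)
qed

section \<open>Polynomial approximation in a Gaussian weight\<close>

definition gauss_exp :: "real \<Rightarrow> real \<Rightarrow> real" where
  "gauss_exp c t = exp (- t\<^sup>2) * exp (c * \<bar>t\<bar>)"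

lemma gauss_exp_pos: "gauss_exp c t > 0" by (simp add: gauss_exp_def)

lemma gauss_exp_measurable [measurable]: "gauss_exp c \<in> borel_measurable borel"
  unfolding gauss_exp_def[abs_def] by measurable

text \<open>The closure of the polynomials in a weighted L^2 space. Integrability is demanded
  because a non-integrable error would have integral 0.\<close>

definition poly_approx :: "real \<Rightarrow> (real \<Rightarrow> real) \<Rightarrow> bool" where
  "poly_approx c g \<longleftrightarrow> g \<in> borel_measurable borel \<and>
    (\<forall>\<epsilon>>0. \<exists>p. integrable lborel (\<lambda>t. gauss_exp c t * (g t - poly p t)\<^sup>2) \<and>
      (LINT t|lborel. gauss_exp c t * (g t - poly p t)\<^sup>2) < \<epsilon>)"

lemma poly_approxD:
  "poly_approx c g \<Longrightarrow> \<epsilon> > 0 \<Longrightarrow> \<exists>p. integrable lborel (\<lambda>t. gauss_exp c t * (g t - poly p t)\<^sup>2) \<and>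
      (LINT t|lborel. gauss_exp c t * (g t - poly p t)\<^sup>2) < \<epsilon>"
  by (simp add: poly_approx_def)

text \<open>Takes the place of Minkowski's inequality; the factors 2 explain the tolerances
  \<open>\<epsilon> / 4\<close>.\<close>

lemma square_add_le: "(x + y)\<^sup>2 \<le> 2 * x\<^sup>2 + 2 * (y::real)\<^sup>2"
  using sum_squares_ge_zero[of "x - y" 0] by (simp add: power2_eq_square algebra_simps)

lemma weighted_square_add:
  fixes g h :: "real \<Rightarrow> real"
  assumes [measurable]: "g \<in> borel_measurable borel" "h \<in> borel_measurable borel"
    and i: "integrable lborel (\<lambda>t. gauss_exp c t * (g t)\<^sup>2)" "integrable lborel (\<lambda>t. gauss_exp c t * (h t)\<^sup>2)"
  shows "integrable lborel (\<lambda>t. gauss_exp c t * (g t + h t)\<^sup>2)" (is ?A)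
    "(LINT t|lborel. gauss_exp c t * (g t + h t)\<^sup>2) \<le>
      2 * (LINT t|lborel. gauss_exp c t * (g t)\<^sup>2) + 2 * (LINT t|lborel. gauss_exp c t * (h t)\<^sup>2)" (is ?B)
proof -
  have i2: "integrable lborel (\<lambda>t. 2 * (gauss_exp c t * (g t)\<^sup>2) + 2 * (gauss_exp c t * (h t)\<^sup>2))"
    using i by simp
  have le: "gauss_exp c t * (g t + h t)\<^sup>2 \<le> 2 * (gauss_exp c t * (g t)\<^sup>2) + 2 * (gauss_exp c t * (h t)\<^sup>2)" for t
    using mult_left_mono[OF square_add_le[of "g t" "h t"], of "gauss_exp c t"] gauss_exp_pos[of c t]
    by (simp add: algebra_simps)
  show A: ?A
    by (rule Bochner_Integration.integrable_bound[OF i2], measurable)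
      (use le gauss_exp_pos[of c] in \<open>auto simp: abs_mult less_imp_le intro!: AE_I2 order_trans[OF le]\<close>)
  have "(LINT t|lborel. gauss_exp c t * (g t + h t)\<^sup>2) \<le>
      (LINT t|lborel. 2 * (gauss_exp c t * (g t)\<^sup>2) + 2 * (gauss_exp c t * (h t)\<^sup>2))"
    by (rule integral_mono[OF A i2 le])
  also have "\<dots> = 2 * (LINT t|lborel. gauss_exp c t * (g t)\<^sup>2) + 2 * (LINT t|lborel. gauss_exp c t * (h t)\<^sup>2)"
    using i by simp
  finally show ?B .
qed

lemma poly_approx_poly: "poly_approx c (poly p)"
  unfolding poly_approx_def
  by (auto intro!: exI[of _ p] exp_bounded_measurable)

lemma poly_approx_add:
  assumes "poly_approx c g" "poly_approx c h"
  shows "poly_approx c (\<lambda>t. g t + h t)"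
  unfolding poly_approx_def
proof (intro conjI allI impI)
  have [measurable]: "g \<in> borel_measurable borel" "h \<in> borel_measurable borel"
    using assms by (auto simp: poly_approx_def)
  show "(\<lambda>t. g t + h t) \<in> borel_measurable borel" by measurable
  fix \<epsilon> :: real assume "\<epsilon> > 0"
  then have e: "\<epsilon> / 4 > 0" by simp
  obtain p where p: "integrable lborel (\<lambda>t. gauss_exp c t * (g t - poly p t)\<^sup>2)"
      "(LINT t|lborel. gauss_exp c t * (g t - poly p t)\<^sup>2) < \<epsilon> / 4"
    using assms(1) e unfolding poly_approx_def by blast
  obtain q where q: "integrable lborel (\<lambda>t. gauss_exp c t * (h t - poly q t)\<^sup>2)"
      "(LINT t|lborel. gauss_exp c t * (h t - poly q t)\<^sup>2) < \<epsilon> / 4"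
    using assms(2) e unfolding poly_approx_def by blast
  have [measurable]: "poly p \<in> borel_measurable borel" "poly q \<in> borel_measurable borel"
    by (simp_all add: exp_bounded_measurable)
  have *: "g t + h t - poly (p + q) t = (g t - poly p t) + (h t - poly q t)" for t by simp
  show "\<exists>p. integrable lborel (\<lambda>t. gauss_exp c t * (g t + h t - poly p t)\<^sup>2) \<and>
      (LINT t|lborel. gauss_exp c t * (g t + h t - poly p t)\<^sup>2) < \<epsilon>"
  proof (intro exI[of _ "p + q"] conjI)
    show "integrable lborel (\<lambda>t. gauss_exp c t * (g t + h t - poly (p + q) t)\<^sup>2)"
      unfolding * by (rule weighted_square_add(1)[OF _ _ p(1) q(1)]; measurable)
    have "(LINT t|lborel. gauss_exp c t * (g t + h t - poly (p + q) t)\<^sup>2) \<le>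
        2 * (LINT t|lborel. gauss_exp c t * (g t - poly p t)\<^sup>2) + 2 * (LINT t|lborel. gauss_exp c t * (h t - poly q t)\<^sup>2)"
      unfolding * by (rule weighted_square_add(2)[OF _ _ p(1) q(1)]; measurable)
    then show "(LINT t|lborel. gauss_exp c t * (g t + h t - poly (p + q) t)\<^sup>2) < \<epsilon>"
      using p(2) q(2) by linarith
  qed
qed

lemma poly_approx_cmult:
  assumes "poly_approx c g"
  shows "poly_approx c (\<lambda>t. x * g t)"
  unfolding poly_approx_def
proof (intro conjI allI impI)
  have [measurable]: "g \<in> borel_measurable borel"
    using assms by (auto simp: poly_approx_def)
  show "(\<lambda>t. x * g t) \<in> borel_measurable borel" by measurable
  fix \<epsilon> :: real assume "\<epsilon> > 0"
  \<comment> \<open>The summand 1 avoids a separate case for \<open>x = 0\<close>.\<close>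
  then have e: "\<epsilon> / (x\<^sup>2 + 1) > 0" by (simp add: add_nonneg_pos)
  obtain p where p: "integrable lborel (\<lambda>t. gauss_exp c t * (g t - poly p t)\<^sup>2)"
      "(LINT t|lborel. gauss_exp c t * (g t - poly p t)\<^sup>2) < \<epsilon> / (x\<^sup>2 + 1)"
    using assms e unfolding poly_approx_def by blast
  have *: "gauss_exp c t * (x * g t - poly (smult x p) t)\<^sup>2 = x\<^sup>2 * (gauss_exp c t * (g t - poly p t)\<^sup>2)" for t
    by (simp add: power_mult_distrib right_diff_distrib[symmetric])
  show "\<exists>p. integrable lborel (\<lambda>t. gauss_exp c t * (x * g t - poly p t)\<^sup>2) \<and>
      (LINT t|lborel. gauss_exp c t * (x * g t - poly p t)\<^sup>2) < \<epsilon>"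
  proof (intro exI[of _ "smult x p"] conjI)
    show "integrable lborel (\<lambda>t. gauss_exp c t * (x * g t - poly (smult x p) t)\<^sup>2)"
      unfolding * using p(1) by simp
    have "(LINT t|lborel. gauss_exp c t * (x * g t - poly (smult x p) t)\<^sup>2)
        = x\<^sup>2 * (LINT t|lborel. gauss_exp c t * (g t - poly p t)\<^sup>2)"
      unfolding * by simp
    also have "\<dots> \<le> (x\<^sup>2 + 1) * (LINT t|lborel. gauss_exp c t * (g t - poly p t)\<^sup>2)"
      using gauss_exp_pos[of c] by (intro mult_right_mono integral_nonneg) (auto simp: less_imp_le)
    also have "\<dots> < (x\<^sup>2 + 1) * (\<epsilon> / (x\<^sup>2 + 1))"
      using p(2) by (intro mult_strict_left_mono) (auto simp: add_nonneg_pos)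
    also have "\<dots> = \<epsilon>" by (simp add: add_nonneg_eq_0_iff)
    finally show "(LINT t|lborel. gauss_exp c t * (x * g t - poly (smult x p) t)\<^sup>2) < \<epsilon>" .
  qed
qed

lemma poly_approx_sum:
  "finite I \<Longrightarrow> (\<And>i. i \<in> I \<Longrightarrow> poly_approx c (g i)) \<Longrightarrow> poly_approx c (\<lambda>t. \<Sum>i\<in>I. g i t)"
proof (induction rule: finite_induct)
  case empty
  show ?case using poly_approx_cmult[OF poly_approx_poly[of c 0], of 0] by simp
qed (simp add: poly_approx_add)

text \<open>Dominated convergence: the square of an exponential bound is still integrable against
  the Gaussian. The limit passages that follow, from Taylor sums to measurable functions, are
  instances.\<close>

lemma poly_approx_limit:
  assumes g: "\<And>n. poly_approx c (g n)"
    and h [measurable]: "h \<in> borel_measurable borel"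
    and lim: "AE t in lborel. (\<lambda>n. g n t) \<longlonglongrightarrow> h t"
    and bound: "\<And>n t. \<bar>g n t\<bar> \<le> C * exp (d * \<bar>t\<bar>)"
  shows "poly_approx c h"
  unfolding poly_approx_def
proof (intro conjI h allI impI)
  fix \<epsilon> :: real assume "\<epsilon> > 0"
  then have e: "\<epsilon> / 4 > 0" by simp
  have [measurable]: "g n \<in> borel_measurable borel" for n
    using g by (auto simp: poly_approx_def)
  define w where "w t = gauss_exp c t * (2 * C * exp (d * \<bar>t\<bar>))\<^sup>2" for t
  have w: "integrable lborel w"
  proof -
    have "w = (\<lambda>t. exp (- t\<^sup>2) * (exp (c * \<bar>t\<bar>) * (2 * C * exp (d * \<bar>t\<bar>))\<^sup>2))"
      by (auto simp: w_def gauss_exp_def)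
    then show ?thesis
      by (simp only:, intro exp_bounded_integrable exp_bounded_mult exp_bounded_power exp_bounded_const exp_bounded_exp_abs)
  qed
  \<comment> \<open>The limit inherits the bound only where the sequence converges.\<close>
  have "AE t in lborel. \<bar>h t\<bar> \<le> C * exp (d * \<bar>t\<bar>)"
    using lim
  proof eventually_elim
    case (elim t)
    then have "(\<lambda>n. \<bar>g n t\<bar>) \<longlonglongrightarrow> \<bar>h t\<bar>" by (rule tendsto_rabs)
    then show ?case using bound by (intro LIMSEQ_le_const2) auto
  qed
  then have bd: "AE t in lborel. norm (gauss_exp c t * (h t - g n t)\<^sup>2) \<le> w t" for n
  proof eventually_elim
    case (elim t)
    then have "\<bar>h t - g n t\<bar> \<le> \<bar>2 * C * exp (d * \<bar>t\<bar>)\<bar>" using bound[of n t] by linarith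
    then have "(h t - g n t)\<^sup>2 \<le> (2 * C * exp (d * \<bar>t\<bar>))\<^sup>2" by (simp add: abs_le_square_iff)
    then show ?case unfolding w_def using gauss_exp_pos[of c t]
      by (simp add: abs_mult mult_left_mono less_imp_le)
  qed
  have lim0: "AE t in lborel. (\<lambda>n. gauss_exp c t * (h t - g n t)\<^sup>2) \<longlonglongrightarrow> 0"
    using lim
  proof eventually_elim
    case (elim t)
    then have "(\<lambda>n. gauss_exp c t * (h t - g n t)\<^sup>2) \<longlonglongrightarrow> gauss_exp c t * (h t - h t)\<^sup>2"
      by (intro tendsto_intros)
    then show ?case by simp
  qed
  have int: "integrable lborel (\<lambda>t. gauss_exp c t * (h t - g n t)\<^sup>2)" for n
    by (rule integrable_dominated_convergence2[OF _ _ w lim0 bd]; measurable)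
  have "(\<lambda>n. LINT t|lborel. gauss_exp c t * (h t - g n t)\<^sup>2) \<longlonglongrightarrow> (LINT t|(lborel :: real measure). 0)"
    by (rule integral_dominated_convergence[OF borel_measurable_const _ w lim0 bd]) measurable
  then have "(\<lambda>n. LINT t|lborel. gauss_exp c t * (h t - g n t)\<^sup>2) \<longlonglongrightarrow> 0" by simp
  then have "eventually (\<lambda>n. (LINT t|lborel. gauss_exp c t * (h t - g n t)\<^sup>2) < \<epsilon> / 4) sequentially"
    using e by (rule order_tendstoD)
  then obtain n where n: "(LINT t|lborel. gauss_exp c t * (h t - g n t)\<^sup>2) < \<epsilon> / 4"
    by (auto simp: eventually_sequentially)
  obtain p where p: "integrable lborel (\<lambda>t. gauss_exp c t * (g n t - poly p t)\<^sup>2)"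
      "(LINT t|lborel. gauss_exp c t * (g n t - poly p t)\<^sup>2) < \<epsilon> / 4"
    using g[of n] e unfolding poly_approx_def by blast
  have [measurable]: "poly p \<in> borel_measurable borel" by (simp add: exp_bounded_measurable)
  have *: "h t - poly p t = (h t - g n t) + (g n t - poly p t)" for t by simp
  show "\<exists>p. integrable lborel (\<lambda>t. gauss_exp c t * (h t - poly p t)\<^sup>2) \<and>
      (LINT t|lborel. gauss_exp c t * (h t - poly p t)\<^sup>2) < \<epsilon>"
  proof (intro exI[of _ p] conjI)
    show "integrable lborel (\<lambda>t. gauss_exp c t * (h t - poly p t)\<^sup>2)"
      unfolding * by (rule weighted_square_add(1)[OF _ _ int p(1)]; measurable)
    have "(LINT t|lborel. gauss_exp c t * (h t - poly p t)\<^sup>2) \<le>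
        2 * (LINT t|lborel. gauss_exp c t * (h t - g n t)\<^sup>2) + 2 * (LINT t|lborel. gauss_exp c t * (g n t - poly p t)\<^sup>2)"
      unfolding * by (rule weighted_square_add(2)[OF _ _ int p(1)]; measurable)
    then show "(LINT t|lborel. gauss_exp c t * (h t - poly p t)\<^sup>2) < \<epsilon>"
      using n p(2) by linarith
  qed
qed

text \<open>The partial sums of both Taylor series are dominated by the exponential series of |l t|,
  hence by e^{|l| |t|} uniformly in the number of terms. The addition formula supplies the
  phase.\<close>

lemma poly_approx_cos: "poly_approx c (\<lambda>t. cos (l * t + m))"
proof -
  have cos: "poly_approx c (\<lambda>t. cos (l * t))" 
  proof (rule poly_approx_limit)
    let ?p = "\<lambda>n. \<Sum>i<n. monom (cos_coeff i * l ^ i) i"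
    show "poly_approx c (poly (?p n))" for n by (rule poly_approx_poly)
    have eq: "poly (?p n) t = (\<Sum>i<n. cos_coeff i *\<^sub>R (l * t) ^ i)" for n t
      by (simp add: poly_sum poly_monom power_mult_distrib mult.assoc)
    show "AE t in lborel. (\<lambda>n. poly (?p n) t) \<longlonglongrightarrow> cos (l * t)"
      unfolding eq by (intro AE_I2 cos_converges[unfolded sums_def])
    show "\<bar>poly (?p n) t\<bar> \<le> 1 * exp (\<bar>l\<bar> * \<bar>t\<bar>)" for n t
    proof -
      have "\<bar>poly (?p n) t\<bar> \<le> (\<Sum>i<n. \<bar>cos_coeff i *\<^sub>R (l * t) ^ i\<bar>)"
        unfolding eq by (rule sum_abs)
      also have "\<dots> \<le> (\<Sum>i<n. \<bar>l * t\<bar> ^ i /\<^sub>R fact i)"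
        by (intro sum_mono) (auto simp: cos_coeff_def abs_mult power_abs divide_inverse)
      also have "\<dots> \<le> exp \<bar>l * t\<bar>"
        using sum_le_suminf[OF summable_exp_generic[of "\<bar>l * t\<bar>"], of "{..<n}"] by (simp add: exp_def)
      finally show ?thesis by (simp add: abs_mult)
    qed
  qed measurable
  have sin: "poly_approx c (\<lambda>t. sin (l * t))" 
  proof (rule poly_approx_limit)
    let ?p = "\<lambda>n. \<Sum>i<n. monom (sin_coeff i * l ^ i) i"
    show "poly_approx c (poly (?p n))" for n by (rule poly_approx_poly)
    have eq: "poly (?p n) t = (\<Sum>i<n. sin_coeff i *\<^sub>R (l * t) ^ i)" for n t
      by (simp add: poly_sum poly_monom power_mult_distrib mult.assoc)
    show "AE t in lborel. (\<lambda>n. poly (?p n) t) \<longlonglongrightarrow> sin (l * t)"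
      unfolding eq by (intro AE_I2 sin_converges[unfolded sums_def])
    show "\<bar>poly (?p n) t\<bar> \<le> 1 * exp (\<bar>l\<bar> * \<bar>t\<bar>)" for n t
    proof -
      have "\<bar>poly (?p n) t\<bar> \<le> (\<Sum>i<n. \<bar>sin_coeff i *\<^sub>R (l * t) ^ i\<bar>)"
        unfolding eq by (rule sum_abs)
      also have "\<dots> \<le> (\<Sum>i<n. \<bar>l * t\<bar> ^ i /\<^sub>R fact i)"
        by (intro sum_mono) (auto simp: sin_coeff_def abs_mult power_abs divide_inverse)
      also have "\<dots> \<le> exp \<bar>l * t\<bar>"
        using sum_le_suminf[OF summable_exp_generic[of "\<bar>l * t\<bar>"], of "{..<n}"] by (simp add: exp_def)
      finally show ?thesis by (simp add: abs_mult)
    qed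
  qed measurable
  have "cos (l * t + m) = cos m * cos (l * t) + (- sin m) * sin (l * t)" for t
    by (simp add: cos_add)
  then show ?thesis by (simp only: poly_approx_add[OF poly_approx_cmult[OF cos] poly_approx_cmult[OF sin]])
qed

text \<open>Frequency and phase are free so that the induction stays among cosines: the product
  formula produces sines of shifted frequency, that is, cosines with phase shifted by -pi/2.\<close>

lemma poly_approx_sin_power: "poly_approx c (\<lambda>t. sin (x * t) ^ k * cos (l * t + m))"
proof (induction k arbitrary: l m)
  case 0
  show ?case using poly_approx_cos by simp
next
  case (Suc k)
  have "sin (x * t) * cos (l * t + m) =
      (1 / 2) * cos ((l + x) * t + (m - pi / 2)) + (- 1 / 2) * cos ((l - x) * t + (m - pi / 2))" for t
  proof -
    have "cos (A - pi / 2) = sin A" for A :: real by (simp add: cos_diff)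
    from this[of "(l + x) * t + m"] this[of "(l - x) * t + m"]
    have "cos ((l + x) * t + (m - pi / 2)) = sin ((l * t + m) + x * t)"
      "cos ((l - x) * t + (m - pi / 2)) = sin ((l * t + m) - x * t)"
      by (simp_all add: algebra_simps)
    then show ?thesis unfolding sin_add[of "l * t + m"] sin_diff[of "l * t + m"]
      by (simp add: algebra_simps)
  qed
  then have eq: "sin (x * t) ^ Suc k * cos (l * t + m) =
      (1 / 2) * (sin (x * t) ^ k * cos ((l + x) * t + (m - pi / 2)))
      + (- 1 / 2) * (sin (x * t) ^ k * cos ((l - x) * t + (m - pi / 2)))" for t
    by (simp only: power_Suc mult.commute[of "sin (x * t)"] mult.assoc) (simp add: algebra_simps)
  show ?case unfolding eq by (intro poly_approx_add poly_approx_cmult Suc.IH)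
qed

lemma poly_approx_poly_sin: "poly_approx c (\<lambda>t. poly p (sin (x * t)))"
proof -
  have "poly_approx c (\<lambda>t. coeff p i * sin (x * t) ^ i)" for i
    using poly_approx_cmult[OF poly_approx_sin_power[where l = 0 and m = 0]] by simp
  then show ?thesis unfolding poly_altdef by (intro poly_approx_sum) auto
qed

text \<open>On \<open>[-L, L]\<close> a continuous function is a continuous function of \<open>sin (\<pi>t/2L)\<close>, hence a uniform limit of
  polynomials in it; off the interval boundedness suffices.\<close>

lemma poly_approx_continuous:
  assumes cont: "continuous_on UNIV g" and bound: "\<And>t. \<bar>g t\<bar> \<le> B"
  shows "poly_approx c g"
proof -
  define L where "L n = real (Suc n)" for n
  have L: "L n > 0" for n by (simp add: L_def)
  \<comment> \<open>Outside the interval, \<open>h\<close> extends \<open>g\<close> by reflection,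
    so the bound on \<open>g\<close> is inherited.\<close>
  define G where "G n s = g (2 * L n / pi * arcsin s)" for n s
  define h where "h n t = G n (sin (pi / (2 * L n) * t))" for n t
  have contG: "continuous_on {-1..1} (G n)" for n
    unfolding G_def by (intro continuous_on_compose2[OF cont] continuous_intros) auto
  have h: "poly_approx c (h n)" for n
  proof -
    have "\<exists>p. \<forall>s\<in>{-1..1}. \<bar>G n s - poly p s\<bar> < 1 / real (Suc m)" for m
    proof -
      obtain p where p: "real_polynomial_function p" "\<And>s. s \<in> {-1..1} \<Longrightarrow> \<bar>G n s - p s\<bar> < 1 / real (Suc m)"
        using Stone_Weierstrass_real_polynomial_function[OF compact_Icc contG, of "1 / real (Suc m)" n]
        by (auto simp: real_norm_def)
      obtain a N where "p = (\<lambda>x. \<Sum>i\<le>N. a i * x ^ i)"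
        using p(1) real_polynomial_function_iff_sum by blast
      then have "p s = poly (\<Sum>i\<le>N. monom (a i) i) s" for s by (simp add: poly_sum poly_monom)
      then show ?thesis using p(2) by metis
    qed
    then obtain p where p: "\<And>m s. s \<in> {-1..1} \<Longrightarrow> \<bar>G n s - poly (p m) s\<bar> < 1 / real (Suc m)"
      by metis
    let ?f = "\<lambda>m t. poly (p m) (sin (pi / (2 * L n) * t))"
    have close: "\<bar>h n t - ?f m t\<bar> < 1 / real (Suc m)" for m t
      unfolding h_def by (rule p) simp
    have "(\<lambda>m. ?f m t) \<longlonglongrightarrow> h n t" for t
    proof (rule LIMSEQ_I)
      fix r :: real assume "r > 0"
      then obtain N where N: "1 / real (Suc N) < r" using nat_approx_posE by blast
      have "norm (?f m t - h n t) < r" if "m \<ge> N" for m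
      proof -
        have "norm (?f m t - h n t) < 1 / real (Suc m)" using close[of t m] by (simp add: abs_minus_commute)
        also have "\<dots> \<le> 1 / real (Suc N)" using that by (intro divide_left_mono) auto
        finally show ?thesis using N by simp
      qed
      then show "\<exists>no. \<forall>m\<ge>no. norm (?f m t - h n t) < r" by blast
    qed
    then have lim: "AE t in lborel. (\<lambda>m. ?f m t) \<longlonglongrightarrow> h n t" by simp
    \<comment> \<open>The uniform error is at most 1, so one constant serves all
      approximants.\<close>
    have bd: "\<bar>?f m t\<bar> \<le> (B + 1) * exp (0 * \<bar>t\<bar>)" for m t
    proof -
      have "1 / real (Suc m) \<le> 1" by simp
      moreover have "\<bar>h n t\<bar> \<le> B" using bound by (simp add: h_def G_def)
      ultimately have "\<bar>?f m t\<bar> \<le> B + 1" using close[of t m] by linarith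
      then show ?thesis by simp
    qed
    have "continuous_on UNIV (h n)"
      unfolding h_def by (intro continuous_on_compose2[OF contG] continuous_intros) auto
    then have "h n \<in> borel_measurable borel" by (rule borel_measurable_continuous_onI)
    from poly_approx_limit[OF poly_approx_poly_sin this lim bd] show ?thesis .
  qed
  have bd: "\<bar>h n t\<bar> \<le> B * exp (0 * \<bar>t\<bar>)" for n t
    using bound by (simp add: h_def G_def)
  \<comment> \<open>At fixed t the sequence is constant as soon as the interval contains t.\<close>
  have "(\<lambda>n. h n t) \<longlonglongrightarrow> g t" for t
  proof (rule tendsto_eventually)
    have "h n t = g t" if "real n \<ge> \<bar>t\<bar>" for n
    proof -
      have "\<bar>t\<bar> \<le> L n" using that by (simp add: L_def)
      then have "- 1 \<le> t / L n" "t / L n \<le> 1" using L[of n] by (auto simp: field_simps)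
      then have "pi / 2 * (- 1) \<le> pi / 2 * (t / L n)" "pi / 2 * (t / L n) \<le> pi / 2 * 1"
        by (intro mult_left_mono; simp)+
      then have "- (pi / 2) \<le> pi / (2 * L n) * t" "pi / (2 * L n) * t \<le> pi / 2" by simp_all
      then have "arcsin (sin (pi / (2 * L n) * t)) = pi / (2 * L n) * t" by (rule arcsin_sin)
      then show ?thesis using L[of n] by (simp add: h_def G_def)
    qed
    moreover have "eventually (\<lambda>n. real n \<ge> \<bar>t\<bar>) sequentially"
      by (rule eventually_sequentiallyI[of "nat \<lceil>\<bar>t\<bar>\<rceil>"]) linarith
    ultimately show "eventually (\<lambda>n. h n t = g t) sequentially" by (rule eventually_mono[rotated])
  qed
  then have lim: "AE t in lborel. (\<lambda>n. h n t) \<longlonglongrightarrow> g t" by simp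
  show ?thesis
    by (rule poly_approx_limit[OF h borel_measurable_continuous_onI[OF cont] lim bd])
qed

text \<open>A measurable function is almost everywhere a limit of continuous ones. Clipping these to
  [-B, B] gives a common bound and leaves the limit unchanged, since \<open>g\<close> takes its
  values there.\<close>

lemma poly_approx_bounded:
  assumes meas: "g \<in> borel_measurable borel" and bound: "\<And>t. \<bar>g t\<bar> \<le> B"
  shows "poly_approx c g"
proof -
  have "g measurable_on UNIV"
    using meas lebesgue_measurable_imp_measurable_on_real[of g UNIV] by (simp add: measurable_completion)
  then obtain N h where N: "negligible N" and h: "\<And>n. continuous_on UNIV (h n)"
      "\<And>t. t \<notin> N \<Longrightarrow> (\<lambda>n. h n t) \<longlonglongrightarrow> g t"
    by (auto simp: measurable_on_def)
  define k where "k n t = max (- B) (min B (h n t))" for n :: nat and t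
  have B: "B \<ge> 0" using bound[of 0] by simp
  show ?thesis
  proof (rule poly_approx_limit[OF _ meas])
    show "poly_approx c (k n)" for n
      by (rule poly_approx_continuous[where B = B])
        (use B h(1) in \<open>auto simp: k_def[abs_def] intro!: continuous_intros\<close>)
    show "\<bar>k n t\<bar> \<le> B * exp (0 * \<bar>t\<bar>)" for n t using B by (auto simp: k_def)
    have "(\<lambda>n. k n t) \<longlonglongrightarrow> g t" if "t \<notin> N" for t
    proof -
      have "(\<lambda>n. k n t) \<longlonglongrightarrow> max (- B) (min B (g t))"
        unfolding k_def using h(2)[OF that] by (intro tendsto_intros)
      moreover have "max (- B) (min B (g t)) = g t" using bound[of t] by auto
      ultimately show ?thesis by simp
    qed
    then have "AE t in lebesgue. (\<lambda>n. k n t) \<longlonglongrightarrow> g t"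
      using N by (intro AE_I'[where N = N]) (auto simp: negligible_iff_null_sets)
    then show "AE t in lborel. (\<lambda>n. k n t) \<longlonglongrightarrow> g t"
      by (simp add: AE_completion_iff)
  qed
qed

section \<open>The range of the composed operator\<close>

lemma left_spanI: "finite S \<Longrightarrow> S \<subseteq> I \<Longrightarrow> (\<lambda>t. \<Sum>n\<in>S. C n ** Q n t) \<in> left_span I Q"
  unfolding left_span_def by blast

lemma left_span_zero: "(\<lambda>t. 0) \<in> left_span I Q"
  unfolding left_span_def by (rule CollectI, rule exI[of _ "{}"]) simp

lemma left_span_base: "n \<in> I \<Longrightarrow> Q n \<in> left_span I Q"
  unfolding left_span_def by (rule CollectI, rule exI[of _ "{n}"], rule exI[of _ "\<lambda>_. mat 1"]) simp

lemma left_span_mult: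
  assumes "f \<in> left_span I Q"
  shows "(\<lambda>t. D ** f t) \<in> left_span I Q"
proof -
  obtain S C where S: "finite S" "S \<subseteq> I" "f = (\<lambda>t. \<Sum>n\<in>S. C n ** Q n t)"
    using assms by (auto simp: left_span_def)
  have "(\<lambda>t. D ** f t) = (\<lambda>t. \<Sum>n\<in>S. (D ** C n) ** Q n t)"
    by (simp add: S(3) bounded_bilinear.sum_right[OF bounded_bilinear_mat_mult] matrix_mul_assoc)
  then show ?thesis using left_spanI[OF S(1,2)] by (simp only:)
qed

lemma left_span_add:
  assumes "f \<in> left_span I Q" "g \<in> left_span I Q"
  shows "(\<lambda>t. f t + g t) \<in> left_span I Q"
proof -
  obtain S C where S: "finite S" "S \<subseteq> I" "f = (\<lambda>t. \<Sum>n\<in>S. C n ** Q n t)"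
    using assms(1) by (auto simp: left_span_def)
  obtain T D where T: "finite T" "T \<subseteq> I" "g = (\<lambda>t. \<Sum>n\<in>T. D n ** Q n t)"
    using assms(2) by (auto simp: left_span_def)
  have ext: "(\<Sum>n\<in>S. C n ** Q n t) = (\<Sum>n\<in>S \<union> T. (if n \<in> S then C n else 0) ** Q n t)"
    if "finite S" "finite T" for S T and C :: "nat \<Rightarrow> cmat" and t
    by (rule sum.mono_neutral_cong_left) (use that in auto)
  have "(\<lambda>t. f t + g t) = (\<lambda>t. \<Sum>n\<in>S \<union> T. ((if n \<in> S then C n else 0) + (if n \<in> T then D n else 0)) ** Q n t)"
    unfolding S(3) T(3) ext[OF S(1) T(1)] ext[OF T(1) S(1)] Un_commute[of T S]
    by (simp only: sum.distrib bounded_bilinear.add_left[OF bounded_bilinear_mat_mult])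
  moreover have "finite (S \<union> T)" "S \<union> T \<subseteq> I" using S T by auto
  ultimately show ?thesis using left_spanI by (simp only:)
qed

lemma left_span_sum:
  "(\<And>i. i \<in> A \<Longrightarrow> f i \<in> left_span I Q) \<Longrightarrow> (\<lambda>t. \<Sum>i\<in>A. f i t) \<in> left_span I Q"
  by (induction A rule: infinite_finite_induct) (simp_all add: left_span_zero left_span_add)

text \<open>Makes the span of the P_n stable under multiplication by t.\<close>

lemma three_term_P\<^sub>a: "\<exists>A B C. \<forall>t. t *\<^sub>R P\<^sub>a a n t = A ** P\<^sub>a a (Suc n) t + B ** P\<^sub>a a n t + C ** P\<^sub>a a (n - 1) t"
proof -
  \<comment> \<open>The entries 1/2 and \<open>w\<close> compare the leading coefficients 2^n
    diag(1, 1 + a^2 n / 2) of P_n and P_{n+1}. The coefficient diag(n x, n) of P_{n-1} is dictated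
    by the norms; it vanishes at \<open>n = 0\<close>, where the index is truncated.
    \<open>y\<close> and \<open>z\<close> are solved from the terms in H_n off the diagonal.\<close>
  define x w y z where "x = (1 + a\<^sup>2 * (n + 1) / 2) / (1 + a\<^sup>2 * n / 2)"
    and "w = (1 + a\<^sup>2 * n / 2) / (2 + a\<^sup>2 * (n + 1))"
    and "y = a * (n + 1) / 2 - a * n * x / 2" and "z = a * (n + 1) * w - a * n / 2"
  have "1 + a\<^sup>2 * n / 2 > 0" "2 + a\<^sup>2 * (n + 1) > 0"
    by (simp_all add: add_pos_nonneg)
  then have x: "x * (1 + a\<^sup>2 * n / 2) = 1 + a\<^sup>2 * (n + 1) / 2" and w: "w * (2 + a\<^sup>2 * (n + 1)) = 1 + a\<^sup>2 * n / 2"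
    unfolding x_def w_def by (simp_all add: field_simps)
  \<comment> \<open>This and the next equation are the conditions left over by the remaining
    terms.\<close>
  have xy: "x - a * y = 1" using x unfolding y_def by (simp add: field_simps power2_eq_square)
  have wz: "- a * z - 2 * w + 1 = 0" using w unfolding z_def by (simp add: field_simps power2_eq_square)
  have "t *\<^sub>R P\<^sub>a a n t = rmat2 (1 / 2) 0 0 w ** P\<^sub>a a (Suc n) t + rmat2 0 y z 0 ** P\<^sub>a a n t
      + rmat2 (n * x) 0 0 n ** P\<^sub>a a (n - 1) t" for t
  proof -
    have H: "real n * hermite (n - 1) t = Kr n t" by (simp add: Kr_def)
    have K: "real n * Kr (n - 1) t = t * Kr n t - real n * hermite n t / 2"
      using Kr_eq[of n t] by (cases "n = 0") auto
    define h k where "h = hermite n t" and "k = Kr n t"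
    have Ks: "Kr (Suc n) t = (n + 1) * h" by (simp add: Kr_Suc h_def)
    have Hs: "hermite (Suc n) t = 2 * t * h - 2 * k" by (simp add: hermite_Suc h_def k_def)
    have e1: "t * h = 1 / 2 * (2 * t * h - 2 * k) + y * (- a * k) + x * k"
      using xy by algebra
    have e2: "t * (- a * k) = 1 / 2 * (- a * ((n + 1) * h)) + y * (h + a\<^sup>2 * t * k) + x * (- a * (t * k - n * h / 2))"
      using xy unfolding y_def by (simp add: field_simps power2_eq_square) algebra
    have e3: "t * (- a * k) = w * (- a * ((n + 1) * h)) + z * h + (- a * (t * k - n * h / 2))"
      unfolding z_def by (simp add: field_simps)
    have e4: "t * (h + a\<^sup>2 * t * k) = w * (2 * t * h - 2 * k + a\<^sup>2 * t * ((n + 1) * h)) + z * (- a * k)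
        + (k + a\<^sup>2 * t * (t * k - n * h / 2))"
      using wz w unfolding z_def by (simp add: field_simps power2_eq_square) algebra
    note H' = H[folded k_def] and K' = K[folded h_def k_def]
    have c1: "n * x * hermite (n - 1) t = x * k" unfolding H'[symmetric] by simp
    have c2: "n * x * (- a * Kr (n - 1) t) = x * (- a * (t * k - n * h / 2))" unfolding K'[symmetric] by simp
    have c3: "n * (- a * Kr (n - 1) t) = - a * (t * k - n * h / 2)" unfolding K'[symmetric] by simp
    have c4: "n * (hermite (n - 1) t + a\<^sup>2 * t * Kr (n - 1) t) = k + a\<^sup>2 * t * (t * k - n * h / 2)"
      unfolding K'[symmetric] using H' by (simp add: algebra_simps)
    show ?thesis
      unfolding P\<^sub>a_eq rmat2_arith rmat2_eq_iff Ks Hs h_def[symmetric] k_def[symmetric]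
      using e1 e2 e3 e4 c1 c2 c3 c4 by (intro conjI; linarith)
  qed
  then show ?thesis by blast
qed

lemma left_span_P\<^sub>a_mult_t:
  assumes "y \<in> left_span UNIV (P\<^sub>a a)"
  shows "(\<lambda>t. t *\<^sub>R y t) \<in> left_span UNIV (P\<^sub>a a)"
proof -
  obtain S C where S: "y = (\<lambda>t. \<Sum>n\<in>S. C n ** P\<^sub>a a n t)"
    using assms by (auto simp: left_span_def)
  have "(\<lambda>t. t *\<^sub>R P\<^sub>a a n t) \<in> left_span UNIV (P\<^sub>a a)" for n
  proof -
    obtain A B C where "\<forall>t. t *\<^sub>R P\<^sub>a a n t = A ** P\<^sub>a a (Suc n) t + B ** P\<^sub>a a n t + C ** P\<^sub>a a (n - 1) t"
      using three_term_P\<^sub>a by blast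
    then show ?thesis by (simp add: left_span_add left_span_mult left_span_base)
  qed
  from left_span_sum[OF left_span_mult[OF this]] show ?thesis
    by (simp add: S scaleR_sum_right mat_scaleR_mult)
qed

text \<open>P_0 is the identity, and multiplication by t stays in the span, so Horner's scheme
  reaches every polynomial entry.\<close>

lemma matrix_polynomial_in_span:
  assumes "matrix_polynomial Q"
  shows "Q \<in> left_span UNIV (P\<^sub>a a)"
proof -
  let ?W = "left_span UNIV (P\<^sub>a a)"
  have P0: "P\<^sub>a a 0 = (\<lambda>t. mat 1)"
    by (simp add: P\<^sub>a_eq hermite_0 fun_eq_iff rmat2_arith(7))
  have const: "(\<lambda>t. C) \<in> ?W" for C
    using left_span_mult[OF left_span_base[OF UNIV_I, of "P\<^sub>a a" 0], where D = C] by (simp add: P0)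
  have ent: "(\<lambda>t. entry i j (poly p (of_real t))) \<in> ?W" for i j p
  proof (induction p)
    case 0
    show ?case using const by simp
  next
    case (pCons c p)
    have "entry i j (poly (pCons c p) (of_real t)) = entry i j c + t *\<^sub>R entry i j (poly p (of_real t))" for t
      by (simp add: entry_def vec_eq_iff scaleR_conv_of_real[where 'a = complex])
    then show ?case using left_span_add[OF const left_span_P\<^sub>a_mult_t[OF pCons.IH]] by simp
  qed
  obtain p where "\<And>i j t. Q t $ i $ j = poly (p i j) (of_real t)"
    using assms unfolding matrix_polynomial_def by metis
  then have "Q = (\<lambda>t. entry 1 1 (poly (p 1 1) (of_real t)) + entry 1 2 (poly (p 1 2) (of_real t))
      + entry 2 1 (poly (p 2 1) (of_real t)) + entry 2 2 (poly (p 2 2) (of_real t)))"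
    using mat2_decomp[of "Q t" for t] by (simp add: fun_eq_iff)
  then show ?thesis by (simp add: left_span_add ent)
qed

text \<open>The members outside \<open>idx\<close> are zero, so leaving them out does not shrink the
  span.\<close>

lemma \<P>\<^sub>2_in_span: "\<P>\<^sub>2 a n \<in> left_span idx (\<P>\<^sub>2 a)"
proof (cases "n \<in> idx")
  case False
  then have "n = 1 \<or> n = 2" by (auto simp: idx_def)
  then have "\<P>\<^sub>2 a n = (\<lambda>t. 0)" using \<P>\<^sub>2_1_2[of a] by auto
  then show ?thesis by (simp add: left_span_zero)
qed (rule left_span_base)

lemma Xop_sum:
  "(\<And>n. n \<in> S \<Longrightarrow> matrix_polynomial (y n)) \<Longrightarrow> Xop a (\<lambda>t. \<Sum>n\<in>S. y n t) t = (\<Sum>n\<in>S. Xop a (y n) t)"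
proof (induction S rule: infinite_finite_induct)
  case (insert n S)
  then show ?case by (simp add: Xop_add matrix_polynomial_sum)
qed (simp_all add: Xop_eq[of "\<lambda>t. 0" "\<lambda>t. 0" "\<lambda>t. 0"])

lemma Xop_in_span:
  assumes "matrix_polynomial y"
  shows "Xop a y \<in> left_span idx (\<P>\<^sub>2 a)"
proof -
  obtain S C where S: "y = (\<lambda>t. \<Sum>n\<in>S. C n ** P\<^sub>a a n t)"
    using matrix_polynomial_in_span[OF assms, of a] by (auto simp: left_span_def)
  have "Xop a y = (\<lambda>t. \<Sum>n\<in>S. C n ** \<P>\<^sub>2 a n t)"
    unfolding S \<P>\<^sub>2_eq
    by (simp add: fun_eq_iff Xop_sum Xop_mult_left matrix_polynomial_P\<^sub>a matrix_polynomial_mult matrix_polynomial_const)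
  then show ?thesis using left_span_sum[OF left_span_mult[OF \<P>\<^sub>2_in_span]] by simp
qed

text \<open>Variation of constants: the rows of \<open>P\<^sub>1\<close> and \<open>P\<^sub>2\<close> span the kernel of \<open>X\<close>, and for the right-hand side
  \<open>\<pp>\<^sup>2 q\<close> the derivatives of the coefficients are polynomials, because \<open>\<pp>\<close> is a multiple of \<open>det X\<^sub>2\<close>.\<close>

lemma \<pp>_square_in_range:
  assumes q: "matrix_polynomial q"
  obtains y where "matrix_polynomial y" "\<And>t. Xop a y t = (\<pp> a t)\<^sup>2 *\<^sub>R q t"
proof -
  \<comment> \<open>16 (a^2 + 2) times the adjugate of \<open>X\<^sub>2\<close>, that is, \<pp>
    times its inverse.\<close>
  define J where "J = (\<lambda>t. rmat2 (4 * (a\<^sup>2 + 2) * (2 * t\<^sup>2 + 1)) (8 * (a\<^sup>2 + 2) * a * t) (16 * a * t) (8 * (a\<^sup>2 + 2) * t\<^sup>2 + 4 * (3 * a\<^sup>2 + 2)))"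
  let ?D = "rmat2 2 0 0 (a\<^sup>2 + 2)" and ?E = "rmat2 8 0 0 (8 * (1 + a\<^sup>2))"
  define D' where "D' = rmat2 (1 / 2) 0 0 (1 / (a\<^sup>2 + 2))"
  define E' where "E' = rmat2 (1 / 8) 0 0 (1 / (8 * (1 + a\<^sup>2)))"
  let ?P1 = "P\<^sub>a a 1" and ?P2 = "P\<^sub>a a 2" and ?P2' = "matrix_deriv (P\<^sub>a a 2)"
  have D: "D' ** ?D = mat 1" and E: "E' ** ?E = mat 1"
    using nz_consts[of a] by (simp_all add: D'_def E'_def rmat2_arith rmat2_eq_iff)
  have J: "J t ** X\<^sub>2 a t = \<pp> a t *\<^sub>R mat 1" for t
    unfolding J_def X\<^sub>2_def \<pp>_def rmat2_arith rmat2_eq_iff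
    using nz_consts(1)[of a] by (auto simp: divide_simps) (simp_all add: algebra_simps power2_eq_square power4_eq_xxxx)
  have mpJ: "matrix_polynomial J"
  proof -
    have "J = (\<lambda>t. rmat2 (poly [:4 * (a\<^sup>2 + 2), 0, 8 * (a\<^sup>2 + 2):] t) (poly [:0, 8 * (a\<^sup>2 + 2) * a:] t)
       (poly [:0, 16 * a:] t) (poly [:4 * (3 * a\<^sup>2 + 2), 0, 8 * (a\<^sup>2 + 2):] t))"
      by (auto simp: J_def fun_eq_iff rmat2_eq_iff power2_eq_square algebra_simps)
    then show ?thesis by (simp only: matrix_polynomial_rmat2)
  qed
  have mpp: "matrix_polynomial (\<lambda>t. \<pp> a t *\<^sub>R Q t)" if "matrix_polynomial Q" for Q
  proof -
    have "\<pp> a t = poly [:3 * a\<^sup>2 + 2, 0, 8, 0, 4 * (a\<^sup>2 + 2):] t" for t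
      by (simp add: \<pp>_def power2_eq_square power4_eq_xxxx algebra_simps)
    then show ?thesis using matrix_polynomial_scaleR_poly[OF that] by (simp only:)
  qed
  \<comment> \<open>For y = u1 P_1 + u2 P_2 the derivatives v1, v2 have to satisfy v1 P_1 + v2 P_2 =
    0 and (v1 P_1' + v2 P_2') X_2 = \<pp>^2 q. The second equation gives v1 in terms of v2. Since
    P_2' D' P_1 - P_2 = E X_2 with E = P_2'', the first becomes v2 E X_2 = \<pp> q J D' P_1. So X_2
    is inverted twice, which is why \<pp> appears squared.\<close>
  define v2 where "v2 = (\<lambda>t. q t ** J t ** D' ** ?P1 t ** J t ** E')"
  define v1 where "v1 = (\<lambda>t. \<pp> a t *\<^sub>R (q t ** J t ** D') + v2 t ** (- ?P2' t ** D'))"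
  have mp2: "matrix_polynomial v2"
    unfolding v2_def by (intro matrix_polynomial_mult matrix_polynomial_const matrix_polynomial_P\<^sub>a q mpJ)
  have mp1: "matrix_polynomial v1"
  proof -
    have "matrix_polynomial (\<lambda>t. (- mat 1) ** ?P2' t)"
      by (intro matrix_polynomial_mult matrix_polynomial_const matrix_polynomial_deriv matrix_polynomial_P\<^sub>a)
    then have "matrix_polynomial (\<lambda>t. - ?P2' t)" by (simp add: mat_minus_mult)
    then show ?thesis
      unfolding v1_def by (intro matrix_polynomial_add matrix_polynomial_mult mpp matrix_polynomial_const q mpJ mp2)
  qed
  obtain u1 where u1: "matrix_polynomial u1" "\<And>t. (u1 has_vector_derivative v1 t) (at t)"
    using matrix_polynomial_antideriv[OF mp1] by blast
  obtain u2 where u2: "matrix_polynomial u2" "\<And>t. (u2 has_vector_derivative v2 t) (at t)"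
    using matrix_polynomial_antideriv[OF mp2] by blast
  note add_l = bounded_bilinear.add_left[OF bounded_bilinear_mat_mult]
  note add_r = bounded_bilinear.add_right[OF bounded_bilinear_mat_mult]
  have v2E: "v2 t ** ?E ** X\<^sub>2 a t = \<pp> a t *\<^sub>R (q t ** J t ** D' ** ?P1 t)" for t
  proof -
    have "v2 t ** ?E ** X\<^sub>2 a t = q t ** J t ** D' ** ?P1 t ** (J t ** ((E' ** ?E) ** X\<^sub>2 a t))"
      unfolding v2_def by (simp only: matrix_mul_assoc)
    also have "\<dots> = \<pp> a t *\<^sub>R (q t ** J t ** D' ** ?P1 t)"
      unfolding E by (simp add: J mat_scaleR_mult)
    finally show ?thesis .
  qed
  have X1: "X\<^sub>1 a t = - (D' ** ?P1 t)" for t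
  proof -
    have "D' ** (?P1 t + ?D ** X\<^sub>1 a t) = 0" unfolding kernel_eqs(1) by simp
    then have "D' ** ?P1 t + X\<^sub>1 a t = 0"
      by (simp only: add_r matrix_mul_assoc D matrix_mul_lid)
    then show ?thesis by (simp add: add_eq_0_iff)
  qed
  have P2: "?P2 t = ?P2' t ** D' ** ?P1 t - ?E ** X\<^sub>2 a t" for t
  proof -
    have "?P2 t + - (?P2' t ** D' ** ?P1 t) + ?E ** X\<^sub>2 a t = 0"
      using kernel_eqs(2)[of a t] unfolding X1 by (simp only: mat_minus_mult matrix_mul_assoc)
    then have "?P2 t - ?P2' t ** D' ** ?P1 t = - (?E ** X\<^sub>2 a t)"
      unfolding eq_neg_iff_add_eq_0 add_uminus_conv_diff .
    then show ?thesis unfolding diff_eq_eq uminus_add_conv_diff .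
  qed
  have v1: "v1 t ** B = \<pp> a t *\<^sub>R (q t ** J t ** D' ** B) - v2 t ** ?P2' t ** D' ** B" for t and B :: cmat
  proof -
    have "v1 t ** B = (\<pp> a t *\<^sub>R (q t ** J t ** D')) ** B + (v2 t ** (- ?P2' t ** D')) ** B"
      unfolding v1_def by (rule add_l)
    then show ?thesis by (simp only: mat_scaleR_mult mat_minus_mult matrix_mul_assoc add_uminus_conv_diff)
  qed
  have first: "v1 t ** ?P1 t + v2 t ** ?P2 t = 0" for t
  proof -
    have "v2 t ** ?P2 t = v2 t ** ?P2' t ** D' ** ?P1 t - v2 t ** ?E ** X\<^sub>2 a t"
      using arg_cong[OF P2, of "(**) (v2 t)"]
      by (simp only: bounded_bilinear.diff_right[OF bounded_bilinear_mat_mult] matrix_mul_assoc)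
    then show ?thesis unfolding v1 v2E by (simp only: add_diff_eq diff_add_cancel diff_self)
  qed
  have second: "(v1 t ** ?D + v2 t ** ?P2' t) ** X\<^sub>2 a t = (\<pp> a t)\<^sup>2 *\<^sub>R q t" for t
  proof -
    have "v1 t ** ?D + v2 t ** ?P2' t = \<pp> a t *\<^sub>R (q t ** J t)"
      unfolding v1 by (simp only: matrix_mul_assoc[symmetric] D matrix_mul_rid diff_add_cancel)
    then have "(v1 t ** ?D + v2 t ** ?P2' t) ** X\<^sub>2 a t = \<pp> a t *\<^sub>R (q t ** (J t ** X\<^sub>2 a t))"
      by (simp only: mat_scaleR_mult matrix_mul_assoc)
    also have "\<dots> = (\<pp> a t)\<^sup>2 *\<^sub>R q t"
      unfolding J by (simp only: mat_scaleR_mult matrix_mul_rid scaleR_scaleR power2_eq_square)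
    finally show ?thesis .
  qed
  define y where "y = (\<lambda>t. u1 t ** ?P1 t + u2 t ** ?P2 t)"
  have dP1: "(?P1 has_vector_derivative ?D) (at t)" for t
    using matrix_polynomial_deriv(2)[OF matrix_polynomial_P\<^sub>a, of a 1 t] by (simp add: matrix_deriv_P\<^sub>a_1[simplified])
  note mm = has_vector_derivative_mat_mult
  have dy: "(y has_vector_derivative u1 t ** ?D + u2 t ** ?P2' t) (at t)" for t
  proof -
    have "(y has_vector_derivative (u1 t ** ?D + v1 t ** ?P1 t) + (u2 t ** ?P2' t + v2 t ** ?P2 t)) (at t)"
      unfolding y_def by (intro has_vector_derivative_add mm u1 u2 dP1 P\<^sub>a_2_derivs)
    moreover have "(p + x) + (r + z) = p + r" if "x + z = 0" for p r x z :: cmat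
    proof -
      have "(p + x) + (r + z) = (p + r) + (x + z)" by (simp only: ac_simps)
      then show ?thesis using that by simp
    qed
    from this[OF first[of t]]
    have "(u1 t ** ?D + v1 t ** ?P1 t) + (u2 t ** ?P2' t + v2 t ** ?P2 t) = u1 t ** ?D + u2 t ** ?P2' t" .
    ultimately show ?thesis by (simp only:)
  qed
  have ddy: "((\<lambda>t. u1 t ** ?D + u2 t ** ?P2' t) has_vector_derivative
      (u1 t ** 0 + v1 t ** ?D) + (u2 t ** ?E + v2 t ** ?P2' t)) (at t)" for t
    by (intro has_vector_derivative_add mm u1 u2 has_vector_derivative_const P\<^sub>a_2_derivs)
  have "Xop a y t = (\<pp> a t)\<^sup>2 *\<^sub>R q t" for t
  proof -
    have "Xop a y t = (u1 t ** ?P1 t + u2 t ** ?P2 t) + (u1 t ** ?D + u2 t ** ?P2' t) ** X\<^sub>1 a t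
        + ((u1 t ** 0 + v1 t ** ?D) + (u2 t ** ?E + v2 t ** ?P2' t)) ** X\<^sub>2 a t"
      by (subst Xop_eq[OF dy ddy]) (simp add: y_def)
    also have "\<dots> = u1 t ** (?P1 t + ?D ** X\<^sub>1 a t) + u2 t ** (?P2 t + ?P2' t ** X\<^sub>1 a t + ?E ** X\<^sub>2 a t)
        + (v1 t ** ?D + v2 t ** ?P2' t) ** X\<^sub>2 a t"
      by (simp add: add_l add_r matrix_mul_assoc)
    finally show ?thesis unfolding kernel_eqs second by simp
  qed
  moreover have "matrix_polynomial y"
    unfolding y_def by (intro matrix_polynomial_add matrix_polynomial_mult u1 u2 matrix_polynomial_P\<^sub>a)
  ultimately show thesis using that by blast
qed

section \<open>The weight and density\<close>

lemma gram_nonneg: "gram a t x y x y \<ge> 0"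
  unfolding gram_def power2_eq_square[symmetric] using pos_consts[of a] by simp

lemma gram_pos:
  assumes "x \<noteq> 0 \<or> y \<noteq> 0"
  shows "gram a t x y x y > 0"
proof -
  define \<alpha> \<beta> where "\<alpha> = (a\<^sup>2 + 2) * (2 * t\<^sup>2 + 1) * x + 4 * a * t * y"
    and "\<beta> = a * t * (a\<^sup>2 + 2) * (2 * t\<^sup>2 + 3) * x + (3 * a\<^sup>2 + 2) * (2 * t\<^sup>2 + 1) * y"
  \<comment> \<open>Cramer's rule: the two linear forms have determinant (a^2 + 2) \<pp>, which is
    nowhere zero.\<close>
  have "(a\<^sup>2 + 2) * \<pp> a t * x = (3 * a\<^sup>2 + 2) * (2 * t\<^sup>2 + 1) * \<alpha> - 4 * a * t * \<beta>"
    "(a\<^sup>2 + 2) * \<pp> a t * y = (a\<^sup>2 + 2) * (2 * t\<^sup>2 + 1) * \<beta> - a * t * (a\<^sup>2 + 2) * (2 * t\<^sup>2 + 3) * \<alpha>"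
    unfolding \<alpha>_def \<beta>_def \<pp>_def by algebra+
  then have "\<alpha> \<noteq> 0 \<or> \<beta> \<noteq> 0"
    using assms nz_consts(1)[of a] \<pp>_nz[of a t] by auto
  then have "\<alpha>\<^sup>2 / ((3 * a\<^sup>2 + 2) * (a\<^sup>2 + 2)) > 0 \<or> \<beta>\<^sup>2 / (3 * a\<^sup>2 + 2)\<^sup>2 > 0"
    using pos_consts[of a] by (metis divide_pos_pos mult_pos_pos zero_less_power zero_less_power2)
  moreover have "\<alpha>\<^sup>2 / ((3 * a\<^sup>2 + 2) * (a\<^sup>2 + 2)) \<ge> 0" "\<beta>\<^sup>2 / (3 * a\<^sup>2 + 2)\<^sup>2 \<ge> 0"
    using pos_consts[of a] by simp_all
  ultimately show ?thesis
    unfolding gram_def \<alpha>_def[symmetric] \<beta>_def[symmetric] power2_eq_square[symmetric] by linarith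
qed

text \<open>Parallelogram law: the two sides differ by the form at the difference of the
  vectors.\<close>

lemma gram_add_le:
  "gram a t (x + x') (y + y') (x + x') (y + y') \<le> 2 * gram a t x y x y + 2 * gram a t x' y' x' y'"
proof -
  have "2 * gram a t x y x y + 2 * gram a t x' y' x' y' - gram a t (x + x') (y + y') (x + x') (y + y')
      = gram a t (x - x') (y - y') (x - x') (y - y')"
    unfolding gram_linear[of a t x y] gram_linear[of a t x' y'] gram_linear[of a t "x + x'"] gram_linear[of a t "x - x'"]
    by (simp add: algebra_simps)
  then show ?thesis using gram_nonneg[of a t "x - x'" "y - y'"] by linarith
qed

lemma gram_scale: "gram a t (r * x) (r * y) (r * x) (r * y) = r\<^sup>2 * gram a t x y x y"
  unfolding gram_linear[of a t x y] gram_linear[of a t "r * x"] by (simp add: algebra_simps power2_eq_square)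

definition gram_bound :: "real \<Rightarrow> real \<Rightarrow> real" where
  "gram_bound a t = 2 * gram a t 1 0 1 0 + 2 * gram a t 0 1 0 1"

text \<open>A crude bound by twice the trace of the form; it is polynomial in t, and this is enough
  against a Gaussian.\<close>

lemma gram_le: "gram a t x y x y \<le> gram_bound a t * (x\<^sup>2 + y\<^sup>2)"
proof -
  have "gram a t x y x y \<le> 2 * gram a t x 0 x 0 + 2 * gram a t 0 y 0 y"
    using gram_add_le[of a t x 0 0 y] by simp
  also have "\<dots> = 2 * (x\<^sup>2 * gram a t 1 0 1 0) + 2 * (y\<^sup>2 * gram a t 0 1 0 1)"
    using gram_scale[of a t x 1 0] gram_scale[of a t y 0 1] by simp
  also have "\<dots> \<le> gram_bound a t * (x\<^sup>2 + y\<^sup>2)"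
    unfolding gram_bound_def using gram_nonneg[of a t 1 0] gram_nonneg[of a t 0 1]
    by (simp add: distrib_left distrib_right mult.commute)
  finally show ?thesis .
qed

lemma exp_bounded_divide_const: "exp_bounded f \<Longrightarrow> exp_bounded (\<lambda>t. f t / c)"
  using exp_bounded_mult[of f "\<lambda>t. 1 / c"] by simp

lemma exp_bounded_gram:
  assumes "exp_bounded x" "exp_bounded y" "exp_bounded x'" "exp_bounded y'"
  shows "exp_bounded (\<lambda>t. gram a t (x t) (y t) (x' t) (y' t))"
  unfolding gram_def by (intro exp_bounded_intros exp_bounded_divide_const assms)

lemma weight_matrix_\<W>: "weight_matrix (\<W> a)"
  unfolding weight_matrix_def
proof (intro conjI allI ballI impI)
  let ?g = "\<lambda>x y x' y' t. exp (- t\<^sup>2) / (\<pp> a t)\<^sup>2 * gram a t x y x' y'"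
  have \<W>: "\<W> a t = rmat2 (?g 1 0 1 0 t) (?g 1 0 0 1 t) (?g 0 1 1 0 t) (?g 0 1 0 1 t)" for t
    unfolding \<W>_eq rmat2_arith ..
  have int: "integrable lborel (\<lambda>t. t ^ k * ?g x y x' y' t)" for k x y x' y'
  proof -
    have "integrable lborel (\<lambda>t. exp (- t\<^sup>2) * (t ^ k * gram a t x y x' y' / (\<pp> a t)\<^sup>2))"
      by (intro exp_bounded_integrable exp_bounded_divide_\<pp>2 exp_bounded_intros exp_bounded_gram)
    then show ?thesis by (simp add: mult_ac)
  qed
  have int\<W>: "integrable lborel (\<lambda>t. t ^ k *\<^sub>R \<W> a t)" for k
    unfolding \<W> rmat2_arith
    using has_bochner_integral_rmat2[OF has_bochner_integral_integrable[OF int] has_bochner_integral_integrable[OF int]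
      has_bochner_integral_integrable[OF int] has_bochner_integral_integrable[OF int]]
    by (rule has_bochner_integral_iff[THEN iffD1, THEN conjunct1])
  then show "integrable lborel (\<lambda>t. t ^ k *\<^sub>R \<W> a t)" for k .
  fix A :: "real set" assume A: "A \<in> sets lborel" "emeasure lborel A > 0"
  have ind\<W>: "integrable lborel (\<lambda>t. indicator A t *\<^sub>R \<W> a t)"
    using integrable_mult_indicator[OF A(1)] int\<W>[of 0] by simp
  define B where "B = (LINT t:A|lborel. \<W> a t)"
  have Bnth: "B $ i $ j = (LINT t|lborel. (indicator A t *\<^sub>R \<W> a t) $ i $ j)" for i j
    unfolding B_def set_lebesgue_integral_def by (rule integral_mat2_nth[OF ind\<W>])
  have "cnj (B $ j $ i) = B $ i $ j" for i j
  proof -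
    have "cnj (B $ j $ i) = (LINT t|lborel. cnj ((indicator A t *\<^sub>R \<W> a t) $ j $ i))"
      unfolding Bnth by (rule Bochner_Integration.integral_cnj[symmetric])
    also have "\<dots> = B $ i $ j"
      unfolding Bnth by (rule Bochner_Integration.integral_cong)
        (use exhaust_2[of i] exhaust_2[of j] in \<open>auto simp: \<W> gram_def mult.commute\<close>)
    finally show ?thesis .
  qed
  then have herm: "ctranspose B = B" by (simp add: vec_eq_iff)
  have pos: "0 < v \<bullet> (B *v v)" if "v \<noteq> 0" for v :: "complex^2"
  proof -
    let ?L = "\<lambda>M :: cmat. v \<bullet> (M *v v)"
    \<comment> \<open>The density is real and symmetric, so its Hermitian form splits into real and
      imaginary parts of v.\<close>
    define Q where "Q t = exp (- t\<^sup>2) / (\<pp> a t)\<^sup>2 * (gram a t (Re (v $ 1)) (Re (v $ 2)) (Re (v $ 1)) (Re (v $ 2))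
        + gram a t (Im (v $ 1)) (Im (v $ 2)) (Im (v $ 1)) (Im (v $ 2)))" for t
    have L: "bounded_linear ?L"
      by (rule linear_conv_bounded_linear[THEN iffD1])
        (auto intro!: linearI simp: matrix_vector_mult_def inner_vec_def sum_2 algebra_simps)
    have Lq: "?L (\<W> a t) = Q t" for t
      unfolding Q_def gram_linear[of a t "Re (v $ 1)"] gram_linear[of a t "Im (v $ 1)"] \<W>
      by (simp add: matrix_vector_mult_def inner_vec_def sum_2 inner_complex_def algebra_simps)
    have q_pos: "Q t > 0" for t
    proof -
      from that have "v $ 1 \<noteq> 0 \<or> v $ 2 \<noteq> 0" by (auto simp: vec_eq_iff forall_2)
      then have "(Re (v $ 1) \<noteq> 0 \<or> Re (v $ 2) \<noteq> 0) \<or> (Im (v $ 1) \<noteq> 0 \<or> Im (v $ 2) \<noteq> 0)"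
        by (auto simp: complex_eq_iff)
      then have "gram a t (Re (v $ 1)) (Re (v $ 2)) (Re (v $ 1)) (Re (v $ 2))
        + gram a t (Im (v $ 1)) (Im (v $ 2)) (Im (v $ 1)) (Im (v $ 2)) > 0"
        using gram_pos gram_nonneg by (metis add_nonneg_pos add_pos_nonneg)
      then show ?thesis unfolding Q_def using \<pp>_nz[of a t] by simp
    qed
    have iq: "integrable lborel (\<lambda>t. indicator A t *\<^sub>R Q t)"
      using integrable_bounded_linear[OF L ind\<W>]
      by (simp add: bounded_linear.linear[OF L, THEN linear_scale] Lq)
    have "?L B = (LINT t|lborel. indicator A t *\<^sub>R Q t)"
      unfolding B_def set_lebesgue_integral_def integral_bounded_linear[OF L ind\<W>, symmetric]
      by (simp only: bounded_linear.linear[OF L, THEN linear_scale] Lq)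
    moreover have "(LINT t|lborel. indicator A t *\<^sub>R Q t) \<ge> 0"
      using q_pos by (intro Bochner_Integration.integral_nonneg) (simp add: less_imp_le)
    \<comment> \<open>A positive function with integral zero over A would make A a null set.\<close>
    moreover have "(LINT t|lborel. indicator A t *\<^sub>R Q t) \<noteq> 0"
    proof
      assume "(LINT t|lborel. indicator A t *\<^sub>R Q t) = 0"
      then have "AE t in lborel. indicator A t *\<^sub>R Q t = 0"
        using integral_nonneg_eq_0_iff_AE[OF iq] q_pos by (simp add: less_imp_le)
      then have "AE t in lborel. t \<notin> A"
        by eventually_elim (use q_pos in \<open>auto simp: indicator_def less_le split: if_splits\<close>)
      then have "emeasure lborel A = 0"
        using A(1) AE_iff_measurable[of A lborel "\<lambda>t. t \<notin> A"] by simp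
      then show False using A(2) by simp
    qed
    ultimately show ?thesis by simp
  qed
  show "pos_def (LINT t:A|lborel. \<W> a t)"
    unfolding pos_def_def B_def[symmetric] using herm pos by blast
qed

section \<open>The integrand of the L^2 norm as a real quadratic form\<close>

definition quad :: "real \<Rightarrow> real \<Rightarrow> cmat \<Rightarrow> real" where
  "quad a t F = (\<Sum>i\<in>UNIV. gram a t (Re (F $ i $ 1)) (Re (F $ i $ 2)) (Re (F $ i $ 1)) (Re (F $ i $ 2))
     + gram a t (Im (F $ i $ 1)) (Im (F $ i $ 2)) (Im (F $ i $ 1)) (Im (F $ i $ 2)))"

definition energy :: "real \<Rightarrow> (real \<Rightarrow> cmat) \<Rightarrow> real \<Rightarrow> real" where
  "energy a f t = exp (- t\<^sup>2) * (quad a t (f t) / (\<pp> a t)\<^sup>2)"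

lemma trace_\<W>: "trace (f t ** \<W> a t ** ctranspose (f t)) = of_real (energy a f t)"
proof -
  have "trace (F ** \<W> a t ** ctranspose F) = of_real (exp (- t\<^sup>2) / (\<pp> a t)\<^sup>2 * quad a t F)" for F
  proof -
    have sym: "gram a t 0 1 1 0 = gram a t 1 0 0 1" by (simp add: gram_def mult.commute)
    show ?thesis
      unfolding \<W>_eq mat_scaleR_mult quad_def sum_2
        gram_linear[of a t "Re (F $ 1 $ 1)"] gram_linear[of a t "Im (F $ 1 $ 1)"]
        gram_linear[of a t "Re (F $ 2 $ 1)"] gram_linear[of a t "Im (F $ 2 $ 1)"] sym
      by (simp add: trace_def sum_2 mat2_mult_nth complex_eq_iff algebra_simps)
  qed
  then show ?thesis by (simp add: energy_def)
qed

lemma quad_nonneg: "quad a t F \<ge> 0"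
  unfolding quad_def by (intro sum_nonneg add_nonneg_nonneg gram_nonneg)

lemma energy_nonneg: "energy a f t \<ge> 0"
  unfolding energy_def using quad_nonneg by simp

lemma quad_add_le: "quad a t (F + G) \<le> 2 * quad a t F + 2 * quad a t G"
  unfolding quad_def sum_2
  using gram_add_le[of a t "Re (F $ 1 $ 1)" "Re (G $ 1 $ 1)" "Re (F $ 1 $ 2)" "Re (G $ 1 $ 2)"]
    gram_add_le[of a t "Im (F $ 1 $ 1)" "Im (G $ 1 $ 1)" "Im (F $ 1 $ 2)" "Im (G $ 1 $ 2)"]
    gram_add_le[of a t "Re (F $ 2 $ 1)" "Re (G $ 2 $ 1)" "Re (F $ 2 $ 2)" "Re (G $ 2 $ 2)"]
    gram_add_le[of a t "Im (F $ 2 $ 1)" "Im (G $ 2 $ 1)" "Im (F $ 2 $ 2)" "Im (G $ 2 $ 2)"]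
  by simp

lemma energy_add_le: "energy a (\<lambda>t. f t + g t) t \<le> 2 * energy a f t + 2 * energy a g t"
proof -
  have "energy a (\<lambda>t. f t + g t) t \<le> exp (- t\<^sup>2) * ((2 * quad a t (f t) + 2 * quad a t (g t)) / (\<pp> a t)\<^sup>2)"
    unfolding energy_def by (intro mult_left_mono divide_right_mono quad_add_le) auto
  then show ?thesis by (simp add: energy_def add_divide_distrib algebra_simps)
qed

lemma quad_scaleR: "quad a t (r *\<^sub>R F) = r\<^sup>2 * quad a t F"
  unfolding quad_def by (simp add: gram_scale sum_distrib_left distrib_left)

lemma quad_le: "quad a t F \<le> gram_bound a t * (\<Sum>i\<in>UNIV. \<Sum>j\<in>UNIV. (Re (F $ i $ j))\<^sup>2 + (Im (F $ i $ j))\<^sup>2)"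
  unfolding quad_def sum_distrib_left
proof (rule sum_mono)
  fix i :: 2
  show "gram a t (Re (F $ i $ 1)) (Re (F $ i $ 2)) (Re (F $ i $ 1)) (Re (F $ i $ 2))
     + gram a t (Im (F $ i $ 1)) (Im (F $ i $ 2)) (Im (F $ i $ 1)) (Im (F $ i $ 2))
     \<le> (\<Sum>j\<in>UNIV. gram_bound a t * ((Re (F $ i $ j))\<^sup>2 + (Im (F $ i $ j))\<^sup>2))"
    using gram_le[of a t "Re (F $ i $ 1)" "Re (F $ i $ 2)"] gram_le[of a t "Im (F $ i $ 1)" "Im (F $ i $ 2)"]
    by (simp add: sum_2 algebra_simps)
qed

lemma energy_measurable:
  assumes "f \<in> borel_measurable borel"
  shows "energy a f \<in> borel_measurable borel"
proof -
  have [measurable]: "(\<lambda>t. f t $ i $ j) \<in> borel_measurable borel" for i j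
    using measurable_mat2_nth[OF assms] .
  have [measurable]: "\<pp> a \<in> borel_measurable borel"
    by (rule borel_measurable_continuous_onI[OF continuous_\<pp>])
  show ?thesis unfolding energy_def[abs_def] quad_def gram_def by measurable
qed

lemma L2_space_iff: "f \<in> L2_space (\<W> a) \<longleftrightarrow> f \<in> borel_measurable borel \<and> integrable lborel (energy a f)"
  unfolding L2_space_def trace_\<W> by (simp add: complex_of_real_integrable_eq)

lemma L2_seminorm_eq: "L2_seminorm (\<W> a) f = sqrt (LINT t|lborel. energy a f t)"
  unfolding L2_seminorm_def trace_\<W> by simp

lemma exp_bounded_cpoly_fun:
  assumes "cpoly_fun f"
  shows "exp_bounded (\<lambda>t. Re (f t))" "exp_bounded (\<lambda>t. Im (f t))"
proof -
  obtain p where p: "f = (\<lambda>t. poly p (of_real t))" using assms by (auto simp: cpoly_fun_def)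
  have "exp_bounded (\<lambda>t. Re (poly p (of_real t))) \<and> exp_bounded (\<lambda>t. Im (poly p (of_real t)))"
    by (induction p) (auto intro!: exp_bounded_add exp_bounded_mult exp_bounded_const exp_bounded_ident)
  then show "exp_bounded (\<lambda>t. Re (f t))" "exp_bounded (\<lambda>t. Im (f t))" by (auto simp: p)
qed

lemma matrix_polynomial_in_L2:
  assumes "matrix_polynomial Q"
  shows "Q \<in> L2_space (\<W> a)"
  unfolding L2_space_iff
proof
  have "continuous_on UNIV Q"
    using matrix_polynomial_deriv(2)[OF assms] by (auto intro!: continuous_at_imp_continuous_on
        has_vector_derivative_continuous)
  then show "Q \<in> borel_measurable borel" by (rule borel_measurable_continuous_onI)
  have "cpoly_fun (\<lambda>t. Q t $ i $ j)" for i j using assms by (simp add: matrix_polynomial_iff)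
  note eb = exp_bounded_cpoly_fun[OF this]
  show "integrable lborel (energy a Q)"
    unfolding energy_def[abs_def] quad_def
    by (intro exp_bounded_integrable exp_bounded_divide_\<pp>2 exp_bounded_sum exp_bounded_add exp_bounded_gram eb)
qed


lemma quad_0: "quad a t 0 = 0"
  by (simp add: quad_def gram_def)

text \<open>The error is the energy of \<open>f\<close> where its norm exceeds \<open>n\<close>, and
  zero elsewhere; dominated convergence applies. Truncation provides the boundedness required for
  polynomial approximation.\<close>

lemma energy_truncate_small:
  assumes f: "f \<in> L2_space (\<W> a)" and "\<delta> > 0"
  obtains n :: nat where "(LINT t|lborel. energy a (\<lambda>t. f t - (if norm (f t) \<le> n then f t else 0)) t) < \<delta>"
proof -
  let ?h = "\<lambda>n t. f t - (if norm (f t) \<le> real n then f t else 0)"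
  have f_meas [measurable]: "f \<in> borel_measurable borel" and fi: "integrable lborel (energy a f)"
    using f by (simp_all add: L2_space_iff)
  have e: "energy a (?h n) t = (if norm (f t) \<le> real n then 0 else energy a f t)" for n t
    by (simp add: energy_def quad_0)
  have "(\<lambda>n. LINT t|lborel. energy a (?h n) t) \<longlonglongrightarrow> (LINT t|(lborel :: real measure). 0)"
  proof (rule integral_dominated_convergence[OF _ _ fi])
    have "?h n \<in> borel_measurable borel" for n by measurable
    then show "energy a (?h n) \<in> borel_measurable lborel" for n by (simp add: energy_measurable)
    show "AE t in lborel. norm (energy a (?h n) t) \<le> energy a f t" for n
      unfolding e using energy_nonneg[of a f] by simp
    have "(\<lambda>n. energy a (?h n) t) \<longlonglongrightarrow> 0" for t
    proof (rule tendsto_eventually)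
      show "eventually (\<lambda>n. energy a (?h n) t = 0) sequentially"
        unfolding e by (rule eventually_sequentiallyI[of "nat \<lceil>norm (f t)\<rceil>"]) (auto simp: nat_le_iff ceiling_le_iff)
    qed
    then show "AE t in lborel. (\<lambda>n. energy a (?h n) t) \<longlonglongrightarrow> 0" by simp
  qed simp
  then have "(\<lambda>n. LINT t|lborel. energy a (?h n) t) \<longlonglongrightarrow> 0" by simp
  then have "eventually (\<lambda>n. (LINT t|lborel. energy a (?h n) t) < \<delta>) sequentially"
    using \<open>\<delta> > 0\<close> by (rule order_tendstoD)
  then show thesis using that by (auto simp: eventually_sequentially)
qed

text \<open>Real and imaginary parts of each entry are approximated separately, with half the
  tolerance each.\<close>

lemma matrix_polynomial_approx:
  assumes g: "g \<in> borel_measurable borel" "\<And>t i j. norm (g t $ i $ j) \<le> B" and "\<eta> > 0"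
  obtains q where "matrix_polynomial q"
    "\<And>i j. integrable lborel (\<lambda>t. gauss_exp c t * ((Re ((g t - q t) $ i $ j))\<^sup>2 + (Im ((g t - q t) $ i $ j))\<^sup>2))"
    "\<And>i j. (LINT t|lborel. gauss_exp c t * ((Re ((g t - q t) $ i $ j))\<^sup>2 + (Im ((g t - q t) $ i $ j))\<^sup>2)) < \<eta>"
proof -
  have "\<eta> / 2 > 0" using assms(3) by simp
  have meas: "(\<lambda>t. g t $ i $ j) \<in> borel_measurable borel" for i j
    by (rule measurable_mat2_nth[OF g(1)])
  have exRe: "\<exists>p. integrable lborel (\<lambda>t. gauss_exp c t * (Re (g t $ i $ j) - poly p t)\<^sup>2) \<and>
      (LINT t|lborel. gauss_exp c t * (Re (g t $ i $ j) - poly p t)\<^sup>2) < \<eta> / 2" for i j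
  proof -
    have "poly_approx c (\<lambda>t. Re (g t $ i $ j))"
    proof (rule poly_approx_bounded[where B = B])
      show "(\<lambda>t. Re (g t $ i $ j)) \<in> borel_measurable borel" using meas[of i j] by measurable
      show "\<bar>Re (g t $ i $ j)\<bar> \<le> B" for t by (rule order_trans[OF abs_Re_le_cmod g(2)])
    qed
    then show ?thesis using \<open>\<eta> / 2 > 0\<close> by (rule poly_approxD)
  qed
  define p where "p i j = (SOME p. integrable lborel (\<lambda>t. gauss_exp c t * (Re (g t $ i $ j) - poly p t)\<^sup>2) \<and>
      (LINT t|lborel. gauss_exp c t * (Re (g t $ i $ j) - poly p t)\<^sup>2) < \<eta> / 2)" for i j
  note someI_ex[OF exRe, folded p_def]
  then have p: "integrable lborel (\<lambda>t. gauss_exp c t * (Re (g t $ i $ j) - poly (p i j) t)\<^sup>2)"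
    "(LINT t|lborel. gauss_exp c t * (Re (g t $ i $ j) - poly (p i j) t)\<^sup>2) < \<eta> / 2" for i j by blast+
  have exIm: "\<exists>p. integrable lborel (\<lambda>t. gauss_exp c t * (Im (g t $ i $ j) - poly p t)\<^sup>2) \<and>
      (LINT t|lborel. gauss_exp c t * (Im (g t $ i $ j) - poly p t)\<^sup>2) < \<eta> / 2" for i j
  proof -
    have "poly_approx c (\<lambda>t. Im (g t $ i $ j))"
    proof (rule poly_approx_bounded[where B = B])
      show "(\<lambda>t. Im (g t $ i $ j)) \<in> borel_measurable borel" using meas[of i j] by measurable
      show "\<bar>Im (g t $ i $ j)\<bar> \<le> B" for t by (rule order_trans[OF abs_Im_le_cmod g(2)])
    qed
    then show ?thesis using \<open>\<eta> / 2 > 0\<close> by (rule poly_approxD)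
  qed
  define r where "r i j = (SOME p. integrable lborel (\<lambda>t. gauss_exp c t * (Im (g t $ i $ j) - poly p t)\<^sup>2) \<and>
      (LINT t|lborel. gauss_exp c t * (Im (g t $ i $ j) - poly p t)\<^sup>2) < \<eta> / 2)" for i j
  note someI_ex[OF exIm, folded r_def]
  then have r: "integrable lborel (\<lambda>t. gauss_exp c t * (Im (g t $ i $ j) - poly (r i j) t)\<^sup>2)"
    "(LINT t|lborel. gauss_exp c t * (Im (g t $ i $ j) - poly (r i j) t)\<^sup>2) < \<eta> / 2" for i j by blast+
  define q :: "real \<Rightarrow> cmat" where "q t = (\<chi> i j. of_real (poly (p i j) t) + \<i> * of_real (poly (r i j) t))" for t
  have eq: "gauss_exp c t * ((Re ((g t - q t) $ i $ j))\<^sup>2 + (Im ((g t - q t) $ i $ j))\<^sup>2) =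
      gauss_exp c t * (Re (g t $ i $ j) - poly (p i j) t)\<^sup>2 + gauss_exp c t * (Im (g t $ i $ j) - poly (r i j) t)\<^sup>2" for t i j
    by (simp add: q_def distrib_left)
  show thesis
  proof (rule that)
    show "matrix_polynomial q"
      unfolding matrix_polynomial_iff q_def
      by (simp add: cpoly_fun_add cpoly_fun_mult cpoly_fun_const cpoly_fun_of_real)
    show "integrable lborel (\<lambda>t. gauss_exp c t * ((Re ((g t - q t) $ i $ j))\<^sup>2 + (Im ((g t - q t) $ i $ j))\<^sup>2))" for i j
      unfolding eq using p(1) r(1) by (rule Bochner_Integration.integrable_add)
    show "(LINT t|lborel. gauss_exp c t * ((Re ((g t - q t) $ i $ j))\<^sup>2 + (Im ((g t - q t) $ i $ j))\<^sup>2)) < \<eta>" for i j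
      unfolding eq Bochner_Integration.integral_add[OF p(1) r(1)] using p(2)[of i j] r(2)[of i j] by linarith
  qed
qed

text \<open>With g = f / \<pp>^2 the energy of f - \<pp>^2 q is e^{-t^2} \<pp>^2 times the form at g
  - q. Its growing factor is at most C e^{c|t|}, which fixes the weight in which \<open>q\<close>
  has to approximate \<open>g\<close>.\<close>

lemma energy_poly_approx:
  assumes f: "f \<in> borel_measurable borel" "\<And>t. norm (f t) \<le> B" and "\<delta> > 0"
  obtains q where "matrix_polynomial q"
    "(LINT t|lborel. energy a (\<lambda>t. f t - (\<pp> a t)\<^sup>2 *\<^sub>R q t) t) < \<delta>"
    "integrable lborel (energy a (\<lambda>t. f t - (\<pp> a t)\<^sup>2 *\<^sub>R q t))"
proof -
  have "exp_bounded (\<lambda>t. (\<pp> a t)\<^sup>2 * gram_bound a t)"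
    unfolding gram_bound_def \<pp>_def by (intro exp_bounded_intros exp_bounded_gram)
  then obtain C c where C: "\<And>t. \<bar>(\<pp> a t)\<^sup>2 * gram_bound a t\<bar> \<le> C * exp (c * \<bar>t\<bar>)"
    by (auto simp: exp_bounded_def)
  have "C \<ge> 0" using C[of 0] by (simp add: order_trans[OF abs_ge_zero])
  \<comment> \<open>Four entries, each multiplied by \<open>C\<close>; \<open>C + 1\<close> keeps
    the denominator positive.\<close>
  define \<eta> where "\<eta> = \<delta> / (4 * (C + 1))"
  have "\<eta> > 0" using \<open>\<delta> > 0\<close> \<open>C \<ge> 0\<close> by (simp add: \<eta>_def)
  define g where "g t = (1 / (\<pp> a t)\<^sup>2) *\<^sub>R f t" for t
  have [measurable]: "\<pp> a \<in> borel_measurable borel"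
    by (rule borel_measurable_continuous_onI[OF continuous_\<pp>])
  have g_meas: "g \<in> borel_measurable borel" unfolding g_def using f(1) by measurable
  have "norm (g t $ i $ j) \<le> B" for t i j
  proof -
    have "norm (g t $ i $ j) \<le> norm (g t)"
      by (rule order_trans[OF Finite_Cartesian_Product.norm_nth_le Finite_Cartesian_Product.norm_nth_le])
    also have "\<dots> \<le> 1 * norm (f t)"
      unfolding g_def norm_scaleR using \<pp>_ge[of a t] by (intro mult_right_mono) (auto simp: one_le_power)
    finally show ?thesis using f(2)[of t] by simp
  qed
  from matrix_polynomial_approx[OF g_meas this \<open>\<eta> > 0\<close>, of c] obtain q where q: "matrix_polynomial q"
    "\<And>i j. integrable lborel (\<lambda>t. gauss_exp c t * ((Re ((g t - q t) $ i $ j))\<^sup>2 + (Im ((g t - q t) $ i $ j))\<^sup>2))"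
    "\<And>i j. (LINT t|lborel. gauss_exp c t * ((Re ((g t - q t) $ i $ j))\<^sup>2 + (Im ((g t - q t) $ i $ j))\<^sup>2)) < \<eta>"
    by blast
  define S where "S t = C * (\<Sum>i\<in>UNIV. \<Sum>j\<in>UNIV. gauss_exp c t * ((Re ((g t - q t) $ i $ j))\<^sup>2 + (Im ((g t - q t) $ i $ j))\<^sup>2))" for t
  have S_int: "integrable lborel S"
    unfolding S_def by (intro integrable_mult_right Bochner_Integration.integrable_sum q)
  have le: "energy a (\<lambda>t. f t - (\<pp> a t)\<^sup>2 *\<^sub>R q t) t \<le> S t" for t
  proof -
    let ?\<Sigma> = "\<Sum>i\<in>UNIV. \<Sum>j\<in>UNIV. (Re ((g t - q t) $ i $ j))\<^sup>2 + (Im ((g t - q t) $ i $ j))\<^sup>2"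
    have \<Sigma>: "?\<Sigma> \<ge> 0" by (intro sum_nonneg) simp
    have "f t - (\<pp> a t)\<^sup>2 *\<^sub>R q t = (\<pp> a t)\<^sup>2 *\<^sub>R (g t - q t)"
      using \<pp>_nz[of a t] by (simp add: g_def scaleR_diff_right)
    then have "energy a (\<lambda>t. f t - (\<pp> a t)\<^sup>2 *\<^sub>R q t) t = exp (- t\<^sup>2) * ((\<pp> a t)\<^sup>2 * quad a t (g t - q t))"
      using \<pp>_nz[of a t] by (simp add: energy_def quad_scaleR power2_eq_square)
    also have "\<dots> \<le> exp (- t\<^sup>2) * ((\<pp> a t)\<^sup>2 * (gram_bound a t * ?\<Sigma>))"
      by (intro mult_left_mono quad_le) auto
    also have "\<dots> = exp (- t\<^sup>2) * (((\<pp> a t)\<^sup>2 * gram_bound a t) * ?\<Sigma>)" by (simp only: mult.assoc)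
    also have "\<dots> \<le> exp (- t\<^sup>2) * ((C * exp (c * \<bar>t\<bar>)) * ?\<Sigma>)"
      using order_trans[OF abs_ge_self C] by (intro mult_left_mono mult_right_mono \<Sigma>) auto
    also have "\<dots> = S t" by (simp add: S_def gauss_exp_def sum_distrib_left mult_ac)
    finally show ?thesis .
  qed
  have "energy a (\<lambda>t. f t - (\<pp> a t)\<^sup>2 *\<^sub>R q t) \<in> borel_measurable borel"
  proof (rule energy_measurable)
    have [measurable]: "q \<in> borel_measurable borel"
      using matrix_polynomial_in_L2[OF q(1), of a] by (simp add: L2_space_iff)
    show "(\<lambda>t. f t - (\<pp> a t)\<^sup>2 *\<^sub>R q t) \<in> borel_measurable borel" using f(1) by measurable
  qed
  then have int: "integrable lborel (energy a (\<lambda>t. f t - (\<pp> a t)\<^sup>2 *\<^sub>R q t))"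
    using le energy_nonneg[of a "\<lambda>t. f t - (\<pp> a t)\<^sup>2 *\<^sub>R q t"]
    by (intro Bochner_Integration.integrable_bound[OF S_int])
      (auto intro!: AE_I2 order_trans[OF _ abs_ge_self])
  have "(LINT t|lborel. energy a (\<lambda>t. f t - (\<pp> a t)\<^sup>2 *\<^sub>R q t) t) \<le> (LINT t|lborel. S t)"
    by (rule integral_mono[OF int S_int le])
  also have "\<dots> = C * (\<Sum>i\<in>UNIV. \<Sum>j\<in>UNIV. LINT t|lborel. gauss_exp c t * ((Re ((g t - q t) $ i $ j))\<^sup>2 + (Im ((g t - q t) $ i $ j))\<^sup>2))"
    unfolding S_def by (simp only: integral_mult_right_zero Bochner_Integration.integral_sum Bochner_Integration.integrable_sum q(2))
  also have "\<dots> \<le> C * (\<Sum>i\<in>(UNIV :: 2 set). \<Sum>j\<in>(UNIV :: 2 set). \<eta>)"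
    using q(3) \<open>C \<ge> 0\<close> by (intro mult_left_mono sum_mono) (auto intro: less_imp_le)
  also have "\<dots> = C * (4 * \<eta>)" by simp
  also have "\<dots> < (C + 1) * (4 * \<eta>)" using \<open>\<eta> > 0\<close> by simp
  also have "\<dots> = \<delta>" using \<open>C \<ge> 0\<close> by (simp add: \<eta>_def field_simps)
  finally show thesis using that q(1) int by blast
qed

lemma left_span_\<P>\<^sub>2_in_L2: "left_span idx (\<P>\<^sub>2 a) \<subseteq> L2_space (\<W> a)"
proof
  fix f assume "f \<in> left_span idx (\<P>\<^sub>2 a)"
  then obtain S C where "f = (\<lambda>t. \<Sum>n\<in>S. C n ** \<P>\<^sub>2 a n t)" by (auto simp: left_span_def)
  then have "matrix_polynomial f"
    by (simp add: \<P>\<^sub>2_eq matrix_polynomial_sum matrix_polynomial_mult matrix_polynomial_const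
        matrix_polynomial_Xop matrix_polynomial_P\<^sub>a)
  then show "f \<in> L2_space (\<W> a)" by (rule matrix_polynomial_in_L2)
qed

lemma dense_left_span: "dense_in_L2 (\<W> a) (left_span idx (\<P>\<^sub>2 a))"
  unfolding dense_in_L2_def
proof (intro conjI ballI allI impI left_span_\<P>\<^sub>2_in_L2)
  fix f and \<epsilon> :: real assume f: "f \<in> L2_space (\<W> a)" and "\<epsilon> > 0"
  \<comment> \<open>Truncation and approximation errors, each doubled by
    \<open>energy_add_le\<close>, stay below \<epsilon>^2, and the seminorm is the square
    root.\<close>
  then have \<delta>: "\<epsilon>\<^sup>2 / 4 > 0" by simp
  obtain n :: nat where n: "(LINT t|lborel. energy a (\<lambda>t. f t - (if norm (f t) \<le> n then f t else 0)) t) < \<epsilon>\<^sup>2 / 4"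
    using energy_truncate_small[OF f \<delta>] by blast
  define h where "h t = (if norm (f t) \<le> n then f t else 0)" for t
  have f_meas [measurable]: "f \<in> borel_measurable borel" and fi: "integrable lborel (energy a f)"
    using f by (simp_all add: L2_space_iff)
  have h_meas [measurable]: "h \<in> borel_measurable borel" unfolding h_def by measurable
  have "norm (h t) \<le> real n" for t by (simp add: h_def)
  from energy_poly_approx[OF h_meas this \<delta>, of a] obtain q where q: "matrix_polynomial q"
    "(LINT t|lborel. energy a (\<lambda>t. h t - (\<pp> a t)\<^sup>2 *\<^sub>R q t) t) < \<epsilon>\<^sup>2 / 4"
    "integrable lborel (energy a (\<lambda>t. h t - (\<pp> a t)\<^sup>2 *\<^sub>R q t))" by blast
  obtain y where y: "matrix_polynomial y" "\<And>t. Xop a y t = (\<pp> a t)\<^sup>2 *\<^sub>R q t"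
    using \<pp>_square_in_range[OF q(1)] by blast
  have int1: "integrable lborel (energy a (\<lambda>t. f t - h t))"
  proof (rule Bochner_Integration.integrable_bound[OF fi])
    show "energy a (\<lambda>t. f t - h t) \<in> borel_measurable lborel"
      using energy_measurable[of "\<lambda>t. f t - h t" a] by simp
    show "AE t in lborel. norm (energy a (\<lambda>t. f t - h t) t) \<le> norm (energy a f t)"
      by (simp add: energy_def h_def quad_0)
  qed
  have le: "energy a (\<lambda>t. f t - Xop a y t) t \<le>
      2 * energy a (\<lambda>t. f t - h t) t + 2 * energy a (\<lambda>t. h t - (\<pp> a t)\<^sup>2 *\<^sub>R q t) t" for t
    using energy_add_le[of a "\<lambda>t. f t - h t" "\<lambda>t. h t - (\<pp> a t)\<^sup>2 *\<^sub>R q t" t] by (simp add: y(2))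
  have "(LINT t|lborel. energy a (\<lambda>t. f t - Xop a y t) t) \<le>
      (LINT t|lborel. 2 * energy a (\<lambda>t. f t - h t) t + 2 * energy a (\<lambda>t. h t - (\<pp> a t)\<^sup>2 *\<^sub>R q t) t)"
    by (rule integral_mono'[OF _ le]) (use int1 q(3) energy_nonneg in auto)
  also have "\<dots> = 2 * (LINT t|lborel. energy a (\<lambda>t. f t - h t) t)
      + 2 * (LINT t|lborel. energy a (\<lambda>t. h t - (\<pp> a t)\<^sup>2 *\<^sub>R q t) t)"
    using int1 q(3) by simp
  also have "\<dots> < \<epsilon>\<^sup>2" using n q(2) unfolding h_def[symmetric] by linarith
  finally have "L2_seminorm (\<W> a) (\<lambda>t. f t - Xop a y t) < \<epsilon>"
    unfolding L2_seminorm_eq using \<open>\<epsilon> > 0\<close> by (simp add: real_less_lsqrt)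
  then show "\<exists>g\<in>left_span idx (\<P>\<^sub>2 a). L2_seminorm (\<W> a) (\<lambda>t. f t - g t) < \<epsilon>"
    using Xop_in_span[OF y(1)] by blast
qed

theorem theorem14:
  fixes a :: real
  shows "(\<forall>n. \<exists>!Q. is_\<P>\<^sub>2 a n Q)
    \<and> weight_matrix (\<W> a)
    \<and> matrix_orthogonal (\<W> a) idx (\<P>\<^sub>2 a)
    \<and> (\<forall>n\<in>idx. matrix_sqnorm (\<W> a) (\<P>\<^sub>2 a n) =
         ((real n - 1) * (real n - 2)) *\<^sub>R
           (rmat2 (1 / (4 * (3 * a\<^sup>2 + 2)\<^sup>2)) 0 0 (1 / (4 * (3 * a\<^sup>2 + 2) * (a\<^sup>2 + 2)))
             ** matrix_sqnorm (W\<^sub>a a) (P\<^sub>a a n)))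
    \<and> (\<forall>n. matrix_sqnorm (W\<^sub>a a) (P\<^sub>a a n) =
         (sqrt pi * 2 ^ n * fact n) *\<^sub>R
           rmat2 (1 + a\<^sup>2 * (real n + 1) / 2) 0 0 (1 + a\<^sup>2 * real n / 2))
    \<and> dense_in_L2 (\<W> a) (left_span idx (\<P>\<^sub>2 a))"
proof (intro conjI allI ballI)
  have W\<^sub>a: "matrix_sqnorm (W\<^sub>a a) (P\<^sub>a a n) = rmat2 (sqnorm\<^sub>1 a n) 0 0 (sqnorm\<^sub>2 a n)" for n
    using has_bochner_integral_W\<^sub>a[of a n n] by (simp add: matrix_ip_def has_bochner_integral_iff)
  show "matrix_orthogonal (\<W> a) idx (\<P>\<^sub>2 a)"
    unfolding matrix_orthogonal_def matrix_ip_def \<P>\<^sub>2_eq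
    using has_bochner_integral_Xop[of a] by (simp add: has_bochner_integral_iff)
  show "matrix_sqnorm (\<W> a) (\<P>\<^sub>2 a n) =
      ((real n - 1) * (real n - 2)) *\<^sub>R
        (rmat2 (1 / (4 * (3 * a\<^sup>2 + 2)\<^sup>2)) 0 0 (1 / (4 * (3 * a\<^sup>2 + 2) * (a\<^sup>2 + 2)))
          ** matrix_sqnorm (W\<^sub>a a) (P\<^sub>a a n))" for n
    using has_bochner_integral_Xop[of a n n] unfolding W\<^sub>a
    by (simp add: matrix_ip_def \<P>\<^sub>2_eq has_bochner_integral_iff rmat2_arith(5))
  show "matrix_sqnorm (W\<^sub>a a) (P\<^sub>a a n) = (sqrt pi * 2 ^ n * fact n) *\<^sub>R
      rmat2 (1 + a\<^sup>2 * (real n + 1) / 2) 0 0 (1 + a\<^sup>2 * real n / 2)" for n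
    unfolding W\<^sub>a sqnorm\<^sub>1_def sqnorm\<^sub>2_def by (simp add: rmat2_arith(4))
qed (rule ex1_is_\<P>\<^sub>2 weight_matrix_\<W> dense_left_span)+

end
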